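(* Let $k$ be a field, let $A_1,\dots,A_n$ be non-empty disjoint finite sets and let $T\subseteq A_1\times\cdots\times A_n$. The rainbow ideal $I(T)$ has a linear resolution if and only if $$H_i\big(\tilde C_\bullet(T_{|R_\bullet})\big)=0$$ for all $i\ge0$ and all families $R_\bullet=(R_1,\dots,R_n)$ of non-empty subsets $R_i\subseteq A_i$, where $T_{|R_\bullet}=T\cap(R_1\times\cdots\times R_n)$.
   Context: Let $A=\bigcup_i A_i$ and let $k[A]$ be the polynomial ring with variables the elements of $A$. The rainbow ideal $I(T)\subseteq k[A]$ is generated by the monomials $a_1a_2\cdots a_n$ for $(a_1,\dots,a_n)\in T$. Linear resolution means $n$-linear: the $i$-th module in the minimal graded free resolution of $I(T)$ is generated in degree $n+i$ for all $i\ge0$ (the zero ideal satisfies this vacuously). For a finite set $V$ let $\Delta(V)\subseteq\mathbb R^V$ be the geometric simplex with vertices $V$. For $U\subseteq A_1\times\cdots\times A_n$, the cell complex $C(U)$ consists of all cells $\Pi(R_\bullet)=\Delta(R_1)\times\cdots\times\Delta(R_n)$ with $\emptyset\neq R_i\subseteq A_i$ and $R_1\times\cdots\times R_n\subseteq U$; the dimension of $\Pi(R_\bullet)$ is $\sum_i|R_i|-n$. $\tilde C_\bullet(U)$ is the augmented cellular chain complex of $C(U)$ over $k$: $C_p(U)$ is the $k$-vector space with basis the $p$-dimensional cells of $C(U)$ for $p\ge0$, $C_{-1}(U)=k$ (spanned by the empty cell), with standard differentials. Thus its homology is the reduced homology of $C(U)$ with coefficients in $k$. *)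

theory Defs
  imports
    "HOL-Library.Poly_Mapping"
    "HOL-Library.FuncSet"
    "HOL-Library.Disjoint_Sets"
    "HOL-Algebra.Ideal"
    "HOL-Algebra.Elementary_Groups"
    "Jordan_Normal_Form.Matrix"
begin

text \<open>
  Throughout, the sets \<open>A\<^sub>1, \<dots>, A\<^sub>n\<close> are indexed by \<open>{..<n}\<close>, and
  \<open>A\<^sub>1 \<times> \<dots> \<times> A\<^sub>n\<close> is \<open>PiE {..<n} A\<close>.
\<close>

section \<open>The polynomial ring and graded free resolutions\<close>

text \<open>
  Multivariate polynomials are finitely supported functions from exponent vectors to coefficients;
  the multiplication of \<^typ>\<open>'a \<Rightarrow>\<^sub>0 'b\<close> in \<^theory>\<open>HOL-Library.Poly_Mapping\<close> is the convolution product.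
\<close>

type_synonym ('a, 'k) mpoly = "('a \<Rightarrow>\<^sub>0 nat) \<Rightarrow>\<^sub>0 'k"

definition mvar :: "'a \<Rightarrow> ('a, 'k::field) mpoly" where
  "mvar a = Poly_Mapping.single (Poly_Mapping.single a 1) 1"

text \<open>\<open>k[V]\<close>, for a set \<open>V\<close> of variables.\<close>

definition mpoly_ring :: "'a set \<Rightarrow> ('a, 'k::field) mpoly ring" where
  "mpoly_ring V = \<lparr>carrier = {p. \<forall>m\<in>Poly_Mapping.keys p. Poly_Mapping.keys m \<subseteq> V},
     monoid.mult = (*), one = 1, zero = 0, add = (+)\<rparr>"

definition mon_degree :: "('a \<Rightarrow>\<^sub>0 nat) \<Rightarrow> nat" where
  "mon_degree m = (\<Sum>a\<in>Poly_Mapping.keys m. Poly_Mapping.lookup m a)"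

text \<open>The zero polynomial is homogeneous of every degree, and the only one of negative degree.\<close>

definition homogeneous :: "int \<Rightarrow> ('a, 'k::field) mpoly \<Rightarrow> bool" where
  "homogeneous d p \<longleftrightarrow> (\<forall>m\<in>Poly_Mapping.keys p. int (mon_degree m) = d)"

definition irrelevant_ideal :: "'a set \<Rightarrow> ('a, 'k::field) mpoly set" where
  "irrelevant_ideal V = Idl\<^bsub>mpoly_ring V\<^esub> (mvar ` V)"

definition free_module :: "'a set \<Rightarrow> nat \<Rightarrow> ('a, 'k::field) mpoly vec set" where
  "free_module V r = {v \<in> carrier_vec r. \<forall>j<r. v $ j \<in> carrier (mpoly_ring V)}"

text \<open>
  A minimal graded free resolution of a homogeneous ideal \<open>I\<close> of \<open>S = k[V]\<close>,
  \<open>\<dots> \<longrightarrow> F\<^sub>2 \<longrightarrow> F\<^sub>1 \<longrightarrow> F\<^sub>0 \<longrightarrow> I \<longrightarrow> 0\<close>.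
  The module \<open>F\<^sub>i\<close> is free of rank \<open>b i\<close>, its \<open>j\<close>-th basis element having degree \<open>d i j\<close>
  (that is, \<open>F\<^sub>i\<close> is the direct sum of the \<open>S(- d i j)\<close> for \<open>j < b i\<close>). The map \<open>F\<^sub>0 \<longrightarrow> I\<close> is given
  by the vector \<open>g\<close> of images of the basis elements and \<open>F\<^sub>i\<^sub>+\<^sub>1 \<longrightarrow> F\<^sub>i\<close> by the matrix \<open>D i\<close>.
  Minimality says that each \<open>D i\<close> maps \<open>F\<^sub>i\<^sub>+\<^sub>1\<close> into \<open>\<mm> F\<^sub>i\<close> for the irrelevant ideal \<open>\<mm>\<close>.
\<close>

definition minimal_graded_free_resolution ::
  "'a set \<Rightarrow> ('a, 'k::field) mpoly set \<Rightarrow> (nat \<Rightarrow> nat) \<Rightarrow> (nat \<Rightarrow> nat \<Rightarrow> int) \<Rightarrow>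
    ('a, 'k) mpoly vec \<Rightarrow> (nat \<Rightarrow> ('a, 'k) mpoly mat) \<Rightarrow> bool" where
  "minimal_graded_free_resolution V I b d g D \<longleftrightarrow>
     g \<in> free_module V (b 0) \<and>
     (\<forall>j<b 0. homogeneous (d 0 j) (g $ j)) \<and>
     (\<forall>i. D i \<in> carrier_mat (b i) (b (Suc i))) \<and>
     (\<forall>i. \<forall>r<b i. \<forall>c<b (Suc i).
        D i $$ (r, c) \<in> irrelevant_ideal V \<and> homogeneous (d (Suc i) c - d i r) (D i $$ (r, c))) \<and>
     (\<lambda>v. g \<bullet> v) ` free_module V (b 0) = I \<and>
     {v \<in> free_module V (b 0). g \<bullet> v = 0} = (\<lambda>w. D 0 *\<^sub>v w) ` free_module V (b 1) \<and>
     (\<forall>i. {v \<in> free_module V (b (Suc i)). D i *\<^sub>v v = 0\<^sub>v (b i)}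
           = (\<lambda>w. D (Suc i) *\<^sub>v w) ` free_module V (b (Suc (Suc i))))"

text \<open>
  Since minimal graded free resolutions exist and are unique up to isomorphism,
  ``the'' minimal one is \<open>n\<close>-linear iff some minimal one is.
\<close>

definition has_linear_resolution :: "'a set \<Rightarrow> nat \<Rightarrow> ('a, 'k::field) mpoly set \<Rightarrow> bool" where
  "has_linear_resolution V n I \<longleftrightarrow>
     (\<exists>b d g D. minimal_graded_free_resolution V I b d g D \<and>
        (\<forall>i. \<forall>j<b i. d i j = int (n + i)))"

definition rainbow_ideal ::
  "nat \<Rightarrow> (nat \<Rightarrow> 'a set) \<Rightarrow> (nat \<Rightarrow> 'a) set \<Rightarrow> ('a, 'k::field) mpoly set" where
  "rainbow_ideal n A T = Idl\<^bsub>mpoly_ring (\<Union>i<n. A i)\<^esub> ((\<lambda>a. \<Prod>i<n. mvar (a i)) ` T)"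

section \<open>The cell complex of products of simplices\<close>

text \<open>The cell \<open>\<Delta>(R\<^sub>1) \<times> \<dots> \<times> \<Delta>(R\<^sub>n)\<close> is represented by the family \<open>R\<close>.\<close>

definition cell_complex :: "nat \<Rightarrow> (nat \<Rightarrow> 'a set) \<Rightarrow> (nat \<Rightarrow> 'a) set \<Rightarrow> (nat \<Rightarrow> 'a set) set" where
  "cell_complex n A U = {R \<in> PiE {..<n} (\<lambda>i. Pow (A i) - {{}}). PiE {..<n} R \<subseteq> U}"

definition cell_dim :: "nat \<Rightarrow> (nat \<Rightarrow> 'a set) \<Rightarrow> int" where
  "cell_dim n R = (\<Sum>i<n. int (card (R i))) - int n"

text \<open>The empty cell, spanning degree \<open>-1\<close>, is represented by \<^term>\<open>None\<close>.\<close>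

definition cells_of_dim ::
  "nat \<Rightarrow> (nat \<Rightarrow> 'a set) \<Rightarrow> (nat \<Rightarrow> 'a) set \<Rightarrow> int \<Rightarrow> (nat \<Rightarrow> 'a set) option set" where
  "cells_of_dim n A U p =
     (if p = -1 then {None} else Some ` {R \<in> cell_complex n A U. cell_dim n R = p})"

type_synonym ('a, 'k) chain = "(nat \<Rightarrow> 'a set) option \<Rightarrow>\<^sub>0 'k"

definition chain_group ::
  "nat \<Rightarrow> (nat \<Rightarrow> 'a set) \<Rightarrow> (nat \<Rightarrow> 'a) set \<Rightarrow> int \<Rightarrow> ('a, 'k::field) chain monoid" where
  "chain_group n A U p =
     \<lparr>carrier = {c. Poly_Mapping.keys c \<subseteq> cells_of_dim n A U p}, monoid.mult = (+), one = 0\<rparr>"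

text \<open>
  The simplices are oriented by the order that the injective map \<open>pos\<close> induces on vertices.
  The boundary is that of the tensor product of the (non-augmented) simplicial chain complexes of the
  simplices: removing the vertex \<open>v\<close> from the \<open>i\<close>-th factor gives the sign \<open>(-1)^s\<close>, with \<open>s\<close> the sum
  of the dimensions of the previous factors and the position of \<open>v\<close> in \<open>R i\<close>. No vertex is removed
  from a one-point factor. The boundary of a \<open>0\<close>-cell is the empty cell.
  The scalar \<open>x\<close> is the coefficient of the cell in the chain.
\<close>

fun cell_boundary ::
  "nat \<Rightarrow> ('a \<Rightarrow> nat) \<Rightarrow> 'k::field \<Rightarrow> (nat \<Rightarrow> 'a set) option \<Rightarrow> ('a, 'k) chain" where
  "cell_boundary n pos x None = 0"
| "cell_boundary n pos x (Some R) =
     (if cell_dim n R = 0 then Poly_Mapping.single None x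
      else \<Sum>i<n. \<Sum>v\<in>{v \<in> R i. R i \<noteq> {v}}.
             Poly_Mapping.single (Some (R(i := R i - {v})))
               ((-1) ^ ((\<Sum>j<i. (card (R j) - 1)) + card {w \<in> R i. pos w < pos v}) * x))"

definition boundary :: "nat \<Rightarrow> ('a \<Rightarrow> nat) \<Rightarrow> ('a, 'k::field) chain \<Rightarrow> ('a, 'k) chain" where
  "boundary n pos c =
     (\<Sum>\<sigma>\<in>Poly_Mapping.keys c. cell_boundary n pos (Poly_Mapping.lookup c \<sigma>) \<sigma>)"

definition cycles ::
  "nat \<Rightarrow> (nat \<Rightarrow> 'a set) \<Rightarrow> ('a \<Rightarrow> nat) \<Rightarrow> (nat \<Rightarrow> 'a) set \<Rightarrow> int \<Rightarrow> ('a, 'k::field) chain set" where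
  "cycles n A pos U p = {c \<in> carrier (chain_group n A U p). boundary n pos c = 0}"

definition boundaries ::
  "nat \<Rightarrow> (nat \<Rightarrow> 'a set) \<Rightarrow> ('a \<Rightarrow> nat) \<Rightarrow> (nat \<Rightarrow> 'a) set \<Rightarrow> int \<Rightarrow> ('a, 'k::field) chain set" where
  "boundaries n A pos U p = boundary n pos ` carrier (chain_group n A U (p + 1))"

text \<open>
  The underlying additive group of the \<open>k\<close>-vector space \<open>H\<^sub>p\<close>; the one is zero iff the other is.
\<close>

definition cell_homology ::
  "nat \<Rightarrow> (nat \<Rightarrow> 'a set) \<Rightarrow> ('a \<Rightarrow> nat) \<Rightarrow> (nat \<Rightarrow> 'a) set \<Rightarrow> int \<Rightarrow> ('a, 'k::field) chain set monoid"
  where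
  "cell_homology n A pos U p =
     (chain_group n A U p)\<lparr>carrier := cycles n A pos U p\<rparr> Mod boundaries n A pos U p"

end

theory Submission
  imports Defs
begin

text \<open>
  The monomial labels turn the cells contained in \<open>T\<close> into a complex \<open>G\<close> of free modules with linear
  differentials. Its strand in multidegree \<open>m\<close> is the augmented chain complex of
  \<open>T\<^bsub>|R\<^esub>\<close> with \<open>R i = supp m \<inter> A i\<close>, so \<open>G\<close> is a resolution of \<open>I(T)\<close>, necessarily minimal and
  linear, iff the stated homology vanishes.

  Conversely, let \<open>F\<close> be any linear resolution of \<open>I(T)\<close>. In \<open>F\<close>, and unconditionally in \<open>G\<close>, no
  nonzero constant vector is killed by the differential, and every cycle with linear entries is the
  boundary of a constant vector; for \<open>G\<close> the latter holds because a cycle of codimension one in a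
  product of simplices is a multiple of the boundary of the product. These two properties let one build,
  degree by degree, invertible constant matrices intertwining the differentials of \<open>F\<close> and \<open>G\<close>,
  so \<open>G\<close> is exact as well.
\<close>

section \<open>Graded polynomial rings\<close>

text \<open>The obstacle is that \<open>has_linear_resolution\<close> only asserts that some
  resolution exists, and nothing relates its matrices to cells. Lifting F to G in the usual way
  would need G to be exact, which is the very thing to be proved. Linearity breaks the circle: a
  lift by constants only ever meets kernel vectors whose entries have degree 1, so the two
  properties of \<open>linear_strand\<close> suffice on both sides. Cycles with linear entries in G
  can be filled for every T because the cell complex has no missing cells: once all facets of a
  product of positive dimension lie in T, each of its transversals lies in one of them, so the
  product itself is a cell. Both complexes carry the ring S as a term in front; in G it belongs to
  the empty cell with label 1. Exactness is demanded only behind it, because at S itself the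
  homology is S/I(T); this is why reduced homology in dimension -1 does not occur. A multidegree
  whose support misses some A_i sees no cell except the empty one, so only families of non-empty
  sets have to be considered.\<close>

abbreviation monom :: "('a \<Rightarrow>\<^sub>0 nat) \<Rightarrow> 'k \<Rightarrow> ('a, 'k::field) mpoly" where
  "monom \<equiv> Poly_Mapping.single"

abbreviation coeff :: "('a, 'k::field) mpoly \<Rightarrow> ('a \<Rightarrow>\<^sub>0 nat) \<Rightarrow> 'k" where
  "coeff \<equiv> Poly_Mapping.lookup"

abbreviation keys where "keys \<equiv> Poly_Mapping.keys"

abbreviation polys :: "'a set \<Rightarrow> ('a, 'k::field) mpoly set" where
  "polys V \<equiv> carrier (mpoly_ring V)"

section \<open>Degrees of monomials and coefficients of products\<close>

lemma mon_degree_superset: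
  assumes "finite S" "keys m \<subseteq> S"
  shows "mon_degree m = (\<Sum>a\<in>S. Poly_Mapping.lookup m a)"
  unfolding mon_degree_def
  by (rule sum.mono_neutral_left) (use assms in \<open>auto simp: in_keys_iff\<close>)

lemma mon_degree_plus: "mon_degree (m + m') = mon_degree m + mon_degree m'"
proof -
  let ?S = "keys m \<union> keys m'"
  have "mon_degree (m + m') = (\<Sum>a\<in>?S. Poly_Mapping.lookup (m + m') a)"
    using Poly_Mapping.keys_add[of m m'] by (intro mon_degree_superset) auto
  also have "\<dots> = (\<Sum>a\<in>?S. Poly_Mapping.lookup m a) + (\<Sum>a\<in>?S. Poly_Mapping.lookup m' a)"
    by (simp add: lookup_add sum.distrib)
  also have "\<dots> = mon_degree m + mon_degree m'"
    by (simp add: mon_degree_superset[of ?S])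
  finally show ?thesis .
qed

lemma mon_degree_eq_0_iff: "mon_degree m = 0 \<longleftrightarrow> m = 0"
proof
  assume "mon_degree m = 0"
  hence "\<forall>a\<in>keys m. Poly_Mapping.lookup m a = 0" by (simp add: mon_degree_def)
  thus "m = 0" by (metis in_keys_iff lookup_zero poly_mapping_eqI)
qed (simp add: mon_degree_def)

lemma keys_plus_nat: "keys (m + m' :: 'a \<Rightarrow>\<^sub>0 nat) = keys m \<union> keys m'"
  by (auto simp: in_keys_iff lookup_add)

lemma coeff_monom_mult: "coeff (monom l c * p) (l + m) = c * coeff p m"
proof -
  have "coeff (monom l c * p) (l + m) =
      (\<Sum>k. (c when l = k) * (\<Sum>q. coeff p q when l + m = k + q))"
    by (simp only: lookup_mult lookup_single)
  also have "\<dots> = (\<Sum>k. c * coeff p m when l = k)"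
  proof (rule Sum_any.cong)
    fix k
    show "(c when l = k) * (\<Sum>q. coeff p q when l + m = k + q) = (c * coeff p m when l = k)"
      by (cases "l = k") simp_all
  qed
  also have "\<dots> = c * coeff p m"
    by simp
  finally show ?thesis .
qed

lemma coeff_monom_mult_nonzero:
  assumes "coeff (monom l c * p) m \<noteq> 0"
  obtains k where "m = l + k" "k \<in> keys p"
  using assms Poly_Mapping.keys_mult[of "monom l c" p]
  by (auto simp: in_keys_iff[symmetric] split: if_splits)

section \<open>Homogeneous polynomials and homogeneous components\<close>

lemma homogeneousD: "homogeneous d p \<Longrightarrow> coeff p m \<noteq> 0 \<Longrightarrow> int (mon_degree m) = d"
  by (simp add: homogeneous_def in_keys_iff)

lemma homogeneousI: "(\<And>m. coeff p m \<noteq> 0 \<Longrightarrow> int (mon_degree m) = d) \<Longrightarrow> homogeneous d p"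
  by (simp add: homogeneous_def in_keys_iff)

lemma homogeneous_zero [simp]: "homogeneous d 0"
  by (simp add: homogeneous_def)

lemma homogeneous_add: "homogeneous d p \<Longrightarrow> homogeneous d q \<Longrightarrow> homogeneous d (p + q)"
  using Poly_Mapping.keys_add[of p q] by (auto simp: homogeneous_def)

lemma homogeneous_diff: "homogeneous d p \<Longrightarrow> homogeneous d q \<Longrightarrow> homogeneous d (p - q)"
  by (intro homogeneousI) (metis diff_zero homogeneousD lookup_minus)

lemma homogeneous_sum: "(\<And>i. i \<in> I \<Longrightarrow> homogeneous d (f i)) \<Longrightarrow> homogeneous d (sum f I)"
  by (induction I rule: infinite_finite_induct) (auto intro: homogeneous_add)

lemma homogeneous_mult: "homogeneous d p \<Longrightarrow> homogeneous e q \<Longrightarrow> homogeneous (d + e) (p * q)"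
  using Poly_Mapping.keys_mult[of p q] by (fastforce simp: homogeneous_def mon_degree_plus)

lemma homogeneous_one: "homogeneous 0 1"
  by (intro homogeneousI) (auto simp: lookup_one when_def mon_degree_def split: if_splits)

lift_definition hcomp :: "int \<Rightarrow> ('a, 'k::field) mpoly \<Rightarrow> ('a, 'k) mpoly" is
  "\<lambda>d p m. if int (mon_degree m) = d then p m else 0"
  by (rule finite_subset) auto

lemma homogeneous_hcomp: "homogeneous d (hcomp d p)"
  by (intro homogeneousI) (auto simp: hcomp.rep_eq split: if_splits)

lemma hcomp_homogeneous: "homogeneous d p \<Longrightarrow> hcomp d p = p"
  by (intro poly_mapping_eqI) (use homogeneousD in \<open>fastforce simp: hcomp.rep_eq\<close>)

lemma hcomp_add: "hcomp d (p + q) = hcomp d p + hcomp d q"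
  by (intro poly_mapping_eqI) (auto simp: hcomp.rep_eq lookup_add)

lemma hcomp_zero: "hcomp d 0 = 0"
  by (intro poly_mapping_eqI) (auto simp: hcomp.rep_eq)

lemma hcomp_sum: "hcomp d (sum f I) = (\<Sum>i\<in>I. hcomp d (f i))"
  by (induction I rule: infinite_finite_induct) (auto simp: hcomp_add hcomp_zero)

text \<open>Split q into its component of degree e and a remainder without monomials of degree e;
  the remainder contributes nothing in degree d + e. This lets a preimage under a homogeneous matrix
  be replaced by its component of the matching degree.\<close>

lemma hcomp_mult:
  assumes "homogeneous d p"
  shows "hcomp (d + e) (p * q) = p * hcomp e q"
proof -
  define r where "r = q - hcomp e q"
  have q: "q = hcomp e q + r" by (simp add: r_def)
  have r: "int (mon_degree m) \<noteq> e" if "m \<in> keys r" for m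
    using that by (auto simp: r_def in_keys_iff lookup_minus hcomp.rep_eq split: if_splits)
  have "hcomp (d + e) (p * r) = 0"
  proof (rule poly_mapping_eqI)
    fix m
    show "coeff (hcomp (d + e) (p * r)) m = coeff 0 m"
    proof (rule ccontr)
      assume "\<not> ?thesis"
      hence "m \<in> keys (p * r)" and deg: "int (mon_degree m) = d + e"
        by (auto simp: hcomp.rep_eq in_keys_iff split: if_splits)
      then obtain a b where "m = a + b" "a \<in> keys p" "b \<in> keys r"
        using Poly_Mapping.keys_mult[of p r] by auto
      with deg r[of b] assms show False by (auto simp: homogeneous_def mon_degree_plus)
    qed
  qed
  moreover have "hcomp (d + e) (p * hcomp e q) = p * hcomp e q"
    by (intro hcomp_homogeneous homogeneous_mult assms homogeneous_hcomp)
  ultimately show ?thesis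
    by (subst q) (simp add: distrib_left hcomp_add)
qed

section \<open>The ring k[V], its ideals and its free modules\<close>

lemma mem_polys: "p \<in> polys V \<longleftrightarrow> (\<forall>m. coeff p m \<noteq> 0 \<longrightarrow> keys m \<subseteq> V)"
  by (auto simp: mpoly_ring_def in_keys_iff)

lemma polys_zero: "0 \<in> polys V"
  by (simp add: mem_polys)

lemma polys_one: "1 \<in> polys V"
  by (auto simp: mem_polys lookup_one when_def split: if_splits)

lemma polys_add: "p \<in> polys V \<Longrightarrow> q \<in> polys V \<Longrightarrow> p + q \<in> polys V"
  by (simp add: mem_polys lookup_add) (metis add.right_neutral)

lemma polys_uminus: "p \<in> polys V \<Longrightarrow> - p \<in> polys V"
  by (simp add: mem_polys)

lemma polys_mult:
  assumes "p \<in> polys V" "q \<in> polys V"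
  shows "p * q \<in> polys V"
  unfolding mem_polys
proof (intro allI impI)
  fix m assume "coeff (p * q) m \<noteq> 0"
  then obtain a b where "m = a + b" "a \<in> keys p" "b \<in> keys q"
    using Poly_Mapping.keys_mult[of p q] by (auto simp: in_keys_iff[symmetric])
  thus "keys m \<subseteq> V" using assms by (auto simp: keys_plus_nat mpoly_ring_def)
qed

lemma polys_sum: "(\<And>i. i \<in> I \<Longrightarrow> f i \<in> polys V) \<Longrightarrow> sum f I \<in> polys V"
  by (induction I rule: infinite_finite_induct) (auto simp: polys_zero polys_add)

lemma polys_homogeneous_0: "homogeneous 0 p \<Longrightarrow> p \<in> polys V"
  unfolding mem_polys by (metis homogeneousD keys_zero mon_degree_eq_0_iff of_nat_0_eq_iff empty_subsetI)

lemma mpoly_ring_simps: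
  "x \<otimes>\<^bsub>mpoly_ring V\<^esub> y = x * y" "x \<oplus>\<^bsub>mpoly_ring V\<^esub> y = x + y"
  "\<zero>\<^bsub>mpoly_ring V\<^esub> = 0" "\<one>\<^bsub>mpoly_ring V\<^esub> = 1"
  by (simp_all add: mpoly_ring_def)

lemma cring_mpoly_ring: "cring (mpoly_ring V :: ('a, 'k::field) mpoly ring)"
proof (rule cringI)
  show "abelian_group (mpoly_ring V :: ('a, 'k) mpoly ring)"
  proof (rule abelian_groupI)
    fix x :: "('a, 'k) mpoly" assume "x \<in> polys V"
    thus "\<exists>y\<in>polys V. y \<oplus>\<^bsub>mpoly_ring V\<^esub> x = \<zero>\<^bsub>mpoly_ring V\<^esub>"
      by (intro bexI[of _ "- x"]) (auto simp: mpoly_ring_simps polys_uminus)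
  qed (auto simp: mpoly_ring_simps polys_add polys_zero algebra_simps)
  show "Group.comm_monoid (mpoly_ring V :: ('a, 'k) mpoly ring)"
    by (rule comm_monoidI) (auto simp: mpoly_ring_simps polys_mult polys_one algebra_simps)
qed (auto simp: mpoly_ring_simps algebra_simps)

lemma idealI_mpoly_ring:
  assumes "I \<subseteq> polys V" "0 \<in> I" "\<And>a b. a \<in> I \<Longrightarrow> b \<in> I \<Longrightarrow> a + b \<in> I"
    and "\<And>a x. a \<in> I \<Longrightarrow> x \<in> polys V \<Longrightarrow> x * a \<in> I"
  shows "ideal I (mpoly_ring V :: ('a, 'k::field) mpoly ring)"
proof (rule idealI)
  interpret R: cring "mpoly_ring V :: ('a, 'k) mpoly ring" by (rule cring_mpoly_ring)
  show "ring (mpoly_ring V :: ('a, 'k) mpoly ring)" by (rule R.ring_axioms)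
  \<comment> \<open>Closure under negation is multiplication by the constant polynomial -1.\<close>
  have um: "- a \<in> I" if "a \<in> I" for a
    using assms(4)[OF that, of "- 1"] by (simp add: polys_uminus polys_one)
  show "subgroup I (add_monoid (mpoly_ring V))"
  proof (rule group.subgroupI)
    show "Group.group (add_monoid (mpoly_ring V :: ('a, 'k) mpoly ring))" by (rule R.a_group)
    show "inv\<^bsub>add_monoid (mpoly_ring V)\<^esub> a \<in> I" if "a \<in> I" for a
    proof -
      have "\<ominus>\<^bsub>mpoly_ring V\<^esub> a = - a"
        by (rule R.minus_equality)
          (use that assms(1) in \<open>auto simp: mpoly_ring_simps polys_uminus\<close>)
      thus ?thesis using um[OF that] by (simp add: a_inv_def)
    qed
  qed (use assms in \<open>auto simp: mpoly_ring_simps\<close>)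
qed (use assms in \<open>auto simp: mpoly_ring_simps mult.commute\<close>)

text \<open>The polynomials without constant term form an ideal that contains the variables. This is
  the form in which minimality enters the comparison of resolutions.\<close>

lemma irrelevant_ideal_coeff_0:
  assumes "(p :: ('a, 'k::field) mpoly) \<in> irrelevant_ideal V"
  shows "coeff p 0 = 0"
proof -
  interpret R: cring "mpoly_ring V :: ('a, 'k) mpoly ring" by (rule cring_mpoly_ring)
  let ?I = "{p \<in> polys V. coeff p 0 = 0} :: ('a, 'k) mpoly set"
  have ideal: "ideal ?I (mpoly_ring V)"
  proof (rule idealI_mpoly_ring)
    fix a x :: "('a, 'k) mpoly" assume a: "a \<in> ?I" and x: "x \<in> polys V"
    have "coeff (x * a) 0 = 0"
    proof (rule ccontr)
      assume "coeff (x * a) 0 \<noteq> 0"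
      then obtain u v where uv: "0 = u + v" "u \<in> keys x" "v \<in> keys a"
        using Poly_Mapping.keys_mult[of x a] by (auto simp: in_keys_iff[symmetric])
      hence "v = 0" by (metis add_is_0 mon_degree_eq_0_iff mon_degree_plus)
      with uv a show False by (simp add: in_keys_iff)
    qed
    thus "x * a \<in> ?I" using a x by (simp add: polys_mult)
  qed (auto simp: polys_zero polys_add lookup_add)
  have "mvar ` V \<subseteq> ?I"
    by (auto simp: mvar_def mem_polys lookup_single when_def
      simp flip: mon_degree_eq_0_iff split: if_splits) (simp add: mon_degree_def)
  with R.genideal_minimal[OF ideal] have "irrelevant_ideal V \<subseteq> ?I"
    by (simp add: irrelevant_ideal_def)
  thus ?thesis using assms by auto
qed

lemma free_module_carrier: "v \<in> free_module V r \<Longrightarrow> v \<in> carrier_vec r"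
  by (simp add: free_module_def)

lemma free_module_mult_mat_vec:
  assumes "M \<in> carrier_mat r s" "\<And>i j. i < r \<Longrightarrow> j < s \<Longrightarrow> M $$ (i, j) \<in> polys V" "w \<in> free_module V s"
  shows "M *\<^sub>v w \<in> free_module V r"
  using assms unfolding free_module_def
  by (auto simp: scalar_prod_def intro!: polys_sum polys_mult)

section \<open>Comparison of linear complexes\<close>

definition hom_vec :: "int \<Rightarrow> ('a, 'k::field) mpoly vec \<Rightarrow> bool" where
  "hom_vec d v \<longleftrightarrow> (\<forall>j<dim_vec v. homogeneous d (v $ j))"

text \<open>For d = 0 the entries are constants, so \<open>hom_vec 0\<close> and
  \<open>hom_mat 0\<close> stand for vectors and matrices over the field k inside the polynomial
  ring; for d = 1 the entries are linear forms.\<close>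

definition hom_mat :: "int \<Rightarrow> ('a, 'k::field) mpoly mat \<Rightarrow> bool" where
  "hom_mat d M \<longleftrightarrow> (\<forall>i<dim_row M. \<forall>j<dim_col M. homogeneous d (M $$ (i, j)))"

definition polys_mat :: "'a set \<Rightarrow> ('a, 'k::field) mpoly mat \<Rightarrow> bool" where
  "polys_mat V M \<longleftrightarrow> (\<forall>i<dim_row M. \<forall>j<dim_col M. M $$ (i, j) \<in> polys V)"

lemma hom_vec_col: "hom_mat d M \<Longrightarrow> j < dim_col M \<Longrightarrow> hom_vec d (col M j)"
  by (simp add: hom_vec_def hom_mat_def)

lemma hom_mat_mult:
  assumes "hom_mat d M" "hom_mat e N" "dim_col M = dim_row N"
  shows "hom_mat (d + e) (M * N)"
  using assms
  by (auto simp: hom_mat_def scalar_prod_def intro!: homogeneous_sum homogeneous_mult)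

lemma hom_mat_minus:
  "hom_mat d M \<Longrightarrow> hom_mat d N \<Longrightarrow> M \<in> carrier_mat r s \<Longrightarrow> N \<in> carrier_mat r s \<Longrightarrow> hom_mat d (M - N)"
  by (auto simp: hom_mat_def intro: homogeneous_diff)

lemma hom_mat_one: "hom_mat 0 (1\<^sub>m r)"
  by (auto simp: hom_mat_def one_mat_def homogeneous_one)

lemma polys_mat_mult:
  "polys_mat V M \<Longrightarrow> polys_mat V N \<Longrightarrow> dim_col M = dim_row N \<Longrightarrow> polys_mat V (M * N)"
  by (auto simp: polys_mat_def scalar_prod_def intro!: polys_sum polys_mult)

lemma polys_mat_hom_0: "hom_mat 0 M \<Longrightarrow> polys_mat V M"
  by (auto simp: polys_mat_def hom_mat_def intro: polys_homogeneous_0)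

lemma free_module_col:
  "polys_mat V M \<Longrightarrow> M \<in> carrier_mat r s \<Longrightarrow> j < s \<Longrightarrow> col M j \<in> free_module V r"
  by (auto simp: polys_mat_def free_module_def)

lemma hom_vec_0_free_module: "hom_vec 0 v \<Longrightarrow> v \<in> carrier_vec r \<Longrightarrow> v \<in> free_module V r"
  by (auto simp: hom_vec_def free_module_def intro: polys_homogeneous_0)

lemma free_module_polys_mat:
  "polys_mat V M \<Longrightarrow> M \<in> carrier_mat r s \<Longrightarrow> w \<in> free_module V s \<Longrightarrow> M *\<^sub>v w \<in> free_module V r"
  by (rule free_module_mult_mat_vec) (auto simp: polys_mat_def)

lemma map_hcomp_mult_mat_vec:
  assumes "hom_mat d M" "dim_col M = dim_vec w"
  shows "map_vec (hcomp (d + e)) (M *\<^sub>v w) = M *\<^sub>v map_vec (hcomp e) w"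
  using assms
  by (intro eq_vecI) (auto simp: scalar_prod_def hcomp_sum hom_mat_def hcomp_mult intro!: sum.cong)

lemma map_hcomp_hom_vec: "hom_vec d v \<Longrightarrow> map_vec (hcomp d) v = v"
  by (intro eq_vecI) (auto simp: hom_vec_def hcomp_homogeneous)

lemma factor_mat_columns:
  fixes N :: "('a, 'k::field) mpoly mat"
  assumes "N \<in> carrier_mat s t" "M \<in> carrier_mat s r"
    and "\<And>j. j < t \<Longrightarrow> \<exists>c\<in>carrier_vec r. hom_vec 0 c \<and> col N j = M *\<^sub>v c"
  shows "\<exists>P\<in>carrier_mat r t. hom_mat 0 P \<and> N = M * P"
proof -
  from assms(3) obtain c where c: "\<And>j. j < t \<Longrightarrow> c j \<in> carrier_vec r \<and> hom_vec 0 (c j) \<and> col N j = M *\<^sub>v c j"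
    by metis
  define P where "P = mat r t (\<lambda>(i, j). c j $ i)"
  have P: "P \<in> carrier_mat r t" by (simp add: P_def)
  have colP: "col P j = c j" if "j < t" for j
    using c[OF that] that by (intro eq_vecI) (auto simp: P_def)
  have "hom_mat 0 P"
    using c by (simp add: hom_mat_def hom_vec_def P_def) (metis carrier_vecD)
  moreover have "N = M * P"
  proof (rule mat_col_eqI)
    fix j assume "j < dim_col (M * P)"
    hence j: "j < t" using P by simp
    show "col N j = col (M * P) j"
      using c[OF j] colP[OF j] col_mult2[OF assms(2) P j] by simp
  qed (use assms P in auto)
  ultimately show ?thesis using P by blast
qed

text \<open>
  The matrices \<open>E 0, E 1, \<dots>\<close> present \<open>\<dots> \<longrightarrow> F\<^sub>1 \<longrightarrow> F\<^sub>0 \<longrightarrow> S\<close>. The last two axioms say that the part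
  of minimal degree of this complex is exact, as in the linear strand of a minimal resolution.
\<close>

locale linear_strand =
  fixes V :: "'a set" and n :: int and r :: "nat \<Rightarrow> nat" and E :: "nat \<Rightarrow> ('a, 'k::field) mpoly mat"
  assumes r0: "r 0 = 1"
    and E_carrier: "E i \<in> carrier_mat (r i) (r (Suc i))"
    and E_polys: "polys_mat V (E i)"
    and E_0_hom: "hom_mat n (E 0)"
    and E_Suc_hom: "hom_mat 1 (E (Suc i))"
    and E_E: "E i * E (Suc i) = 0\<^sub>m (r i) (r (Suc (Suc i)))"
    and const_inj: "c \<in> carrier_vec (r (Suc i)) \<Longrightarrow> hom_vec 0 c \<Longrightarrow> E i *\<^sub>v c = 0\<^sub>v (r i) \<Longrightarrow>
      c = 0\<^sub>v (r (Suc i))"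
    and linear_ker: "v \<in> free_module V (r (Suc i)) \<Longrightarrow> hom_vec 1 v \<Longrightarrow> E i *\<^sub>v v = 0\<^sub>v (r i) \<Longrightarrow>
      \<exists>c\<in>carrier_vec (r (Suc (Suc i))). hom_vec 0 c \<and> v = E (Suc i) *\<^sub>v c"
begin

lemma const_inj_mat:
  assumes C: "C \<in> carrier_mat (r (Suc i)) t" "hom_mat 0 C" and 0: "E i * C = 0\<^sub>m (r i) t"
  shows "C = 0\<^sub>m (r (Suc i)) t"
proof (rule mat_col_eqI)
  fix j assume "j < dim_col (0\<^sub>m (r (Suc i)) t :: ('a, 'k) mpoly mat)"
  hence j: "j < t" by simp
  have "E i *\<^sub>v col C j = col (E i * C) j"
    using col_mult2[OF E_carrier C(1) j] by simp
  also have "\<dots> = 0\<^sub>v (r i)" using j by (simp add: 0)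
  finally have "col C j = 0\<^sub>v (r (Suc i))"
    using C j by (intro const_inj) (auto intro: hom_vec_col)
  thus "col C j = col (0\<^sub>m (r (Suc i)) t) j" using j by simp
qed (use C in auto)

end

section \<open>Constant chain maps between linear strands\<close>

definition exact_complex :: "'a set \<Rightarrow> (nat \<Rightarrow> nat) \<Rightarrow> (nat \<Rightarrow> ('a, 'k::field) mpoly mat) \<Rightarrow> bool" where
  "exact_complex V r E \<longleftrightarrow> (\<forall>i. {v \<in> free_module V (r (Suc i)). E i *\<^sub>v v = 0\<^sub>v (r i)} =
     (\<lambda>w. E (Suc i) *\<^sub>v w) ` free_module V (r (Suc (Suc i))))"

text \<open>The columns of \<open>P' * E (Suc i)\<close> are vectors of linear forms killed by
  \<open>E' i\<close>, so \<open>linear_ker\<close> for the target writes each of them as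
  \<open>E' (Suc i)\<close> times a constant vector. These vectors are the columns of the
  lift.\<close>

lemma lift_const:
  assumes F: "linear_strand V n r E" and G: "linear_strand V n r' E'"
    and P: "P \<in> carrier_mat (r' i) (r i)" "hom_mat 0 P"
    and P': "P' \<in> carrier_mat (r' (Suc i)) (r (Suc i))" "hom_mat 0 P'"
    and comm: "E' i * P' = P * E i"
  shows "\<exists>P''\<in>carrier_mat (r' (Suc (Suc i))) (r (Suc (Suc i))). hom_mat 0 P'' \<and>
    P' * E (Suc i) = E' (Suc i) * P''"
proof -
  interpret F: linear_strand V n r E by fact
  interpret G: linear_strand V n r' E' by fact
  let ?N = "P' * E (Suc i)"
  have N: "?N \<in> carrier_mat (r' (Suc i)) (r (Suc (Suc i)))"
    using P'(1) F.E_carrier[of "Suc i"] by simp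
  have "E' i * ?N = (E' i * P') * E (Suc i)"
    by (rule assoc_mult_mat[symmetric, OF G.E_carrier P'(1) F.E_carrier])
  also have "\<dots> = P * (E i * E (Suc i))"
    unfolding comm by (rule assoc_mult_mat[OF P(1) F.E_carrier F.E_carrier])
  also have "\<dots> = 0\<^sub>m (r' i) (r (Suc (Suc i)))"
    using P(1) by (simp add: F.E_E right_mult_zero_mat)
  finally have 0: "E' i * ?N = 0\<^sub>m (r' i) (r (Suc (Suc i)))" .
  have hom: "hom_mat 1 ?N"
    using hom_mat_mult[OF P'(2) F.E_Suc_hom[of i]] P'(1) F.E_carrier[of "Suc i"] by simp
  have polys: "polys_mat V ?N"
    using P' F.E_carrier[of "Suc i"] by (intro polys_mat_mult polys_mat_hom_0 F.E_polys) auto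
  show ?thesis
  proof (rule factor_mat_columns[OF N G.E_carrier])
    fix j assume j: "j < r (Suc (Suc i))"
    show "\<exists>c\<in>carrier_vec (r' (Suc (Suc i))). hom_vec 0 c \<and> col ?N j = E' (Suc i) *\<^sub>v c"
    proof (rule G.linear_ker)
      show "col ?N j \<in> free_module V (r' (Suc i))" by (rule free_module_col[OF polys N j])
      show "hom_vec 1 (col ?N j)" by (rule hom_vec_col[OF hom]) (use carrier_matD(2)[OF N] j in simp)
      show "E' i *\<^sub>v col ?N j = 0\<^sub>v (r' i)"
        using col_mult2[OF G.E_carrier N j] j by (simp add: 0)
    qed
  qed
qed

text \<open>Moving \<open>E' i\<close> through both squares gives
  \<open>E' i * (P' * Q') = P * Q * E' i = E' i\<close>. Hence \<open>P' * Q'\<close> minus the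
  identity is a constant matrix killed by \<open>E' i\<close>, and \<open>const_inj\<close> makes it
  zero: invertibility climbs one step.\<close>

lemma lift_inverse:
  assumes F: "linear_strand V n r E" and G: "linear_strand V n r' E'"
    and P: "P \<in> carrier_mat (r' i) (r i)" and Q: "Q \<in> carrier_mat (r i) (r' i)"
    and P': "P' \<in> carrier_mat (r' (Suc i)) (r (Suc i))" "hom_mat 0 P'"
    and Q': "Q' \<in> carrier_mat (r (Suc i)) (r' (Suc i))" "hom_mat 0 Q'"
    and PE: "P * E i = E' i * P'" and QE: "Q * E' i = E i * Q'" and PQ: "P * Q = 1\<^sub>m (r' i)"
  shows "P' * Q' = 1\<^sub>m (r' (Suc i))"
proof -
  interpret F: linear_strand V n r E by fact
  interpret G: linear_strand V n r' E' by fact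
  note car = P Q P'(1) Q'(1) F.E_carrier[of i] G.E_carrier[of i]
  have "E' i * (P' * Q') = (E' i * P') * Q'"
    by (rule assoc_mult_mat[symmetric]) (use car in auto)
  also have "\<dots> = P * (E i * Q')"
    unfolding PE[symmetric] by (rule assoc_mult_mat) (use car in auto)
  also have "\<dots> = (P * Q) * E' i"
    unfolding QE[symmetric] by (rule assoc_mult_mat[symmetric]) (use car in auto)
  also have "\<dots> = E' i" using car by (simp add: PQ)
  finally have eq: "E' i * (P' * Q') = E' i" .
  let ?C = "P' * Q' - 1\<^sub>m (r' (Suc i))"
  have "E' i * ?C = E' i * (P' * Q') - E' i * 1\<^sub>m (r' (Suc i))"
    by (rule mult_minus_distrib_mat) (use car in auto)
  also have "\<dots> = 0\<^sub>m (r' i) (r' (Suc i))"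
    unfolding eq using car by (auto intro!: eq_matI simp: right_mult_one_mat)
  finally have "E' i * ?C = 0\<^sub>m (r' i) (r' (Suc i))" .
  moreover have "hom_mat 0 ?C"
    using hom_mat_mult[OF P'(2) Q'(2)] car by (intro hom_mat_minus hom_mat_one) auto
  ultimately have C: "?C = 0\<^sub>m (r' (Suc i)) (r' (Suc i))"
    using car by (intro G.const_inj_mat) auto
  show ?thesis
  proof (rule eq_matI)
    fix a b assume ab: "a < dim_row (1\<^sub>m (r' (Suc i)) :: ('a, 'b) mpoly mat)"
      "b < dim_col (1\<^sub>m (r' (Suc i)) :: ('a, 'b) mpoly mat)"
    hence "?C $$ (a, b) = 0" by (simp add: C)
    thus "(P' * Q') $$ (a, b) = 1\<^sub>m (r' (Suc i)) $$ (a, b)" using ab car by simp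
  qed (use car in auto)
qed

text \<open>The induction carries two neighbouring levels. The inverse relations are recorded for
  the lower pair \<open>P\<close>, \<open>Q\<close>; those for \<open>P'\<close>, \<open>Q'\<close>
  follow by \<open>lift_inverse\<close>, and the next lift starts from the commuting square that
  contains \<open>P'\<close>, \<open>Q'\<close>.\<close>

lemma linear_strand_comparison:
  assumes F: "linear_strand V n r E" and G: "linear_strand V n r' E'"
    and base: "\<exists>P\<in>carrier_mat (r' 1) (r 1). hom_mat 0 P \<and> E 0 = E' 0 * P"
      "\<exists>Q\<in>carrier_mat (r 1) (r' 1). hom_mat 0 Q \<and> E' 0 = E 0 * Q"
  shows "\<exists>P Q P' Q'. P \<in> carrier_mat (r' i) (r i) \<and> Q \<in> carrier_mat (r i) (r' i) \<and>
    P' \<in> carrier_mat (r' (Suc i)) (r (Suc i)) \<and> Q' \<in> carrier_mat (r (Suc i)) (r' (Suc i)) \<and>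
    hom_mat 0 P \<and> hom_mat 0 Q \<and> hom_mat 0 P' \<and> hom_mat 0 Q' \<and>
    P * E i = E' i * P' \<and> Q * E' i = E i * Q' \<and>
    P * Q = 1\<^sub>m (r' i) \<and> Q * P = 1\<^sub>m (r i)"
proof (induction i)
  case 0
  interpret F: linear_strand V n r E by fact
  interpret G: linear_strand V n r' E' by fact
  from base obtain P Q where "P \<in> carrier_mat (r' 1) (r 1)" "hom_mat 0 P" "E 0 = E' 0 * P"
    "Q \<in> carrier_mat (r 1) (r' 1)" "hom_mat 0 Q" "E' 0 = E 0 * Q" by blast
  \<comment> \<open>At index 0 both complexes have the term S and the maps are the identity; the two
    assumed factorisations are the first commuting squares.\<close>
  thus ?case
    using F.E_carrier[of 0] G.E_carrier[of 0]
    by (intro exI[of _ "1\<^sub>m 1"] exI[of _ P] exI[of _ Q]) (auto simp: F.r0 G.r0 hom_mat_one)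
next
  case (Suc i)
  then obtain P Q P' Q' where *: "P \<in> carrier_mat (r' i) (r i)" "Q \<in> carrier_mat (r i) (r' i)"
    "P' \<in> carrier_mat (r' (Suc i)) (r (Suc i))" "Q' \<in> carrier_mat (r (Suc i)) (r' (Suc i))"
    "hom_mat 0 P" "hom_mat 0 Q" "hom_mat 0 P'" "hom_mat 0 Q'"
    "P * E i = E' i * P'" "Q * E' i = E i * Q'" "P * Q = 1\<^sub>m (r' i)" "Q * P = 1\<^sub>m (r i)"
    by metis
  obtain P'' where P'': "P'' \<in> carrier_mat (r' (Suc (Suc i))) (r (Suc (Suc i)))" "hom_mat 0 P''"
    "P' * E (Suc i) = E' (Suc i) * P''"
    using lift_const[OF F G *(1,5,3,7) *(9)[symmetric]] by blast
  obtain Q'' where Q'': "Q'' \<in> carrier_mat (r (Suc (Suc i))) (r' (Suc (Suc i)))" "hom_mat 0 Q''"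
    "Q' * E' (Suc i) = E (Suc i) * Q''"
    using lift_const[OF G F *(2,6,4,8) *(10)[symmetric]] by blast
  have "P' * Q' = 1\<^sub>m (r' (Suc i))" by (rule lift_inverse[OF F G *(1,2,3,7,4,8,9,10,11)])
  moreover have "Q' * P' = 1\<^sub>m (r (Suc i))" by (rule lift_inverse[OF G F *(2,1,4,8,3,7,10,9,12)])
  ultimately show ?case using * P'' Q'' by metis
qed

text \<open>A cycle of \<open>E'\<close> is carried over by \<open>Q'\<close>, filled in the exact
  complex, and the filling is carried back by \<open>P''\<close>; since \<open>P' * Q'\<close> is
  the identity, it fills the original cycle.\<close>

theorem linear_strand_exact_transfer:
  assumes F: "linear_strand V n r E" and G: "linear_strand V n r' E'"
    and base: "\<exists>P\<in>carrier_mat (r' 1) (r 1). hom_mat 0 P \<and> E 0 = E' 0 * P"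
      "\<exists>Q\<in>carrier_mat (r 1) (r' 1). hom_mat 0 Q \<and> E' 0 = E 0 * Q"
    and exact: "exact_complex V r E"
  shows "exact_complex V r' E'"
  unfolding exact_complex_def
proof (intro allI equalityI subsetI)
  fix i v
  interpret F: linear_strand V n r E by fact
  interpret G: linear_strand V n r' E' by fact
  assume "v \<in> {v \<in> free_module V (r' (Suc i)). E' i *\<^sub>v v = 0\<^sub>v (r' i)}"
  hence v: "v \<in> free_module V (r' (Suc i))" "E' i *\<^sub>v v = 0\<^sub>v (r' i)" by auto
  obtain P Q P' Q' where PQ: "P \<in> carrier_mat (r' i) (r i)" "Q \<in> carrier_mat (r i) (r' i)"
    "P' \<in> carrier_mat (r' (Suc i)) (r (Suc i))" "Q' \<in> carrier_mat (r (Suc i)) (r' (Suc i))"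
    "hom_mat 0 P" "hom_mat 0 Q" "hom_mat 0 P'" "hom_mat 0 Q'"
    "P * E i = E' i * P'" "Q * E' i = E i * Q'" "P * Q = 1\<^sub>m (r' i)" "Q * P = 1\<^sub>m (r i)"
    using linear_strand_comparison[OF F G base, of i] by metis
  have inv: "P' * Q' = 1\<^sub>m (r' (Suc i))" by (rule lift_inverse[OF F G PQ(1,2,3,7,4,8,9,10,11)])
  obtain P'' where P'': "P'' \<in> carrier_mat (r' (Suc (Suc i))) (r (Suc (Suc i)))" "hom_mat 0 P''"
    "P' * E (Suc i) = E' (Suc i) * P''"
    using lift_const[OF F G PQ(1,5,3,7) PQ(9)[symmetric]] by blast
  note vc = free_module_carrier[OF v(1)]
  have Qv: "Q' *\<^sub>v v \<in> free_module V (r (Suc i))"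
    by (rule free_module_polys_mat[OF polys_mat_hom_0[OF PQ(8)] PQ(4) v(1)])
  have "E i *\<^sub>v (Q' *\<^sub>v v) = Q *\<^sub>v (E' i *\<^sub>v v)"
    using assoc_mult_mat_vec[OF F.E_carrier PQ(4) vc] assoc_mult_mat_vec[OF PQ(2) G.E_carrier vc]
    by (simp add: PQ(10))
  also have "\<dots> = 0\<^sub>v (r i)" using PQ(2) by (auto simp: v(2) intro!: eq_vecI)
  finally have "Q' *\<^sub>v v \<in> (\<lambda>w. E (Suc i) *\<^sub>v w) ` free_module V (r (Suc (Suc i)))"
    using exact Qv unfolding exact_complex_def by blast
  then obtain w where w: "w \<in> free_module V (r (Suc (Suc i)))" "Q' *\<^sub>v v = E (Suc i) *\<^sub>v w" by blast
  note wc = free_module_carrier[OF w(1)]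
  have "v = (P' * Q') *\<^sub>v v" using vc by (simp add: inv)
  also have "\<dots> = P' *\<^sub>v (E (Suc i) *\<^sub>v w)"
    by (simp add: assoc_mult_mat_vec[OF PQ(3,4) vc] w(2))
  also have "\<dots> = E' (Suc i) *\<^sub>v (P'' *\<^sub>v w)"
    using assoc_mult_mat_vec[OF PQ(3) F.E_carrier wc] assoc_mult_mat_vec[OF G.E_carrier P''(1) wc]
    by (simp add: P''(3))
  finally show "v \<in> (\<lambda>w. E' (Suc i) *\<^sub>v w) ` free_module V (r' (Suc (Suc i)))"
    using free_module_polys_mat[OF polys_mat_hom_0[OF P''(2)] P''(1) w(1)] by blast
next
  fix i v
  interpret G: linear_strand V n r' E' by fact
  assume "v \<in> (\<lambda>w. E' (Suc i) *\<^sub>v w) ` free_module V (r' (Suc (Suc i)))"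
  then obtain w where w: "w \<in> free_module V (r' (Suc (Suc i)))" "v = E' (Suc i) *\<^sub>v w" by blast
  have "E' i *\<^sub>v v = (E' i * E' (Suc i)) *\<^sub>v w"
    unfolding w(2)
    by (rule assoc_mult_mat_vec[symmetric, OF G.E_carrier G.E_carrier free_module_carrier[OF w(1)]])
  also have "\<dots> = 0\<^sub>v (r' i)"
    using free_module_carrier[OF w(1)] by (intro eq_vecI) (auto simp: G.E_E)
  finally show "v \<in> {v \<in> free_module V (r' (Suc i)). E' i *\<^sub>v v = 0\<^sub>v (r' i)}"
    using free_module_polys_mat[OF G.E_polys G.E_carrier w(1)] w(2) by simp
qed

section \<open>Labelled complexes\<close>

abbreviation mon_dvd :: "('a \<Rightarrow>\<^sub>0 nat) \<Rightarrow> ('a \<Rightarrow>\<^sub>0 nat) \<Rightarrow> bool" where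
  "mon_dvd l m \<equiv> \<exists>k. m = l + k"

lemma coeff_monom_scale: "coeff (monom l c * p) m = c * coeff (monom l 1 * p) m"
proof -
  have "monom l c * p = monom 0 c * (monom l 1 * p)"
    by (simp add: mult_single flip: mult.assoc)
  thus ?thesis using coeff_monom_mult[of 0 c "monom l 1 * p" m] by simp
qed

section \<open>Strands of a labelled complex in a fixed multidegree\<close>

definition incidence_boundary ::
  "(nat \<Rightarrow> 'c set) \<Rightarrow> (nat \<Rightarrow> 'c \<Rightarrow> 'c \<Rightarrow> 'k::field) \<Rightarrow> nat \<Rightarrow> ('c \<Rightarrow> 'k) \<Rightarrow> 'c \<Rightarrow> 'k" where
  "incidence_boundary X inc i f \<sigma> = (\<Sum>\<tau>\<in>X (Suc i). inc i \<sigma> \<tau> * f \<tau>)"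

locale labelled_complex =
  fixes X :: "nat \<Rightarrow> 'c set" and lab :: "'c \<Rightarrow> 'a \<Rightarrow>\<^sub>0 nat"
    and inc :: "nat \<Rightarrow> 'c \<Rightarrow> 'c \<Rightarrow> 'k::field"
  assumes finite_X: "finite (X i)"
    and inc_lab: "\<sigma> \<in> X i \<Longrightarrow> \<tau> \<in> X (Suc i) \<Longrightarrow> inc i \<sigma> \<tau> \<noteq> 0 \<Longrightarrow> mon_dvd (lab \<sigma>) (lab \<tau>)"
begin

definition rank :: "nat \<Rightarrow> nat" where
  "rank i = card (X i)"

definition enum :: "nat \<Rightarrow> nat \<Rightarrow> 'c" where
  "enum i = (SOME e. bij_betw e {..<rank i} (X i))"

definition idx :: "nat \<Rightarrow> 'c \<Rightarrow> nat" where
  "idx i = inv_into {..<rank i} (enum i)"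

abbreviation bd :: "nat \<Rightarrow> ('c \<Rightarrow> 'k) \<Rightarrow> 'c \<Rightarrow> 'k" where
  "bd \<equiv> incidence_boundary X inc"

text \<open>Subtraction of exponents is truncated, but by \<open>inc_lab\<close> it is a true
  quotient of monomials wherever the incidence number is non-zero; elsewhere the entry is 0 whatever
  the exponent.\<close>

definition dmat :: "nat \<Rightarrow> ('a, 'k) mpoly mat" where
  "dmat i = mat (rank i) (rank (Suc i)) (\<lambda>(s, t).
     monom (lab (enum (Suc i) t) - lab (enum i s)) (inc i (enum i s) (enum (Suc i) t)))"

text \<open>
  Multiplying each entry by its label embeds the free module into
  one on which the differential has constant coefficients, so that it acts on each coefficient
  separately.
\<close>

definition strand :: "nat \<Rightarrow> ('a, 'k) mpoly vec \<Rightarrow> ('a \<Rightarrow>\<^sub>0 nat) \<Rightarrow> 'c \<Rightarrow> 'k" where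
  "strand i w m \<tau> = coeff (monom (lab \<tau>) 1 * w $ idx i \<tau>) m"

lemma bij_enum: "bij_betw (enum i) {..<rank i} (X i)"
  unfolding enum_def rank_def
  using ex_bij_betw_nat_finite[OF finite_X[of i]] by (metis atLeast0LessThan someI_ex)

lemma enum_mem: "j < rank i \<Longrightarrow> enum i j \<in> X i"
  using bij_enum bij_betw_apply by fastforce

lemma idx_less: "\<tau> \<in> X i \<Longrightarrow> idx i \<tau> < rank i"
  using bij_betw_apply[OF bij_betw_inv_into[OF bij_enum]] by (auto simp: idx_def)

lemma enum_idx: "\<tau> \<in> X i \<Longrightarrow> enum i (idx i \<tau>) = \<tau>"
  unfolding idx_def by (rule bij_betw_inv_into_right[OF bij_enum])

lemma idx_enum: "j < rank i \<Longrightarrow> idx i (enum i j) = j"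
  unfolding idx_def by (rule bij_betw_inv_into_left[OF bij_enum]) simp

lemma dmat_carrier: "dmat i \<in> carrier_mat (rank i) (rank (Suc i))"
  by (simp add: dmat_def)

lemma strand_plus: "strand i w (lab \<tau> + k) \<tau> = coeff (w $ idx i \<tau>) k"
  by (simp add: strand_def coeff_monom_mult)

lemma strand_nonzero:
  assumes "strand i w m \<tau> \<noteq> 0"
  obtains k where "m = lab \<tau> + k" "coeff (w $ idx i \<tau>) k \<noteq> 0"
  using coeff_monom_mult_nonzero[OF assms[unfolded strand_def]] by (auto simp: in_keys_iff)

text \<open>Multiplication by a label only shifts exponents, so every coefficient of a coordinate
  reappears in some strand.\<close>

lemma strand_eqI:
  assumes "v \<in> carrier_vec (rank i)" "w \<in> carrier_vec (rank i)"
    and "\<And>m \<tau>. \<tau> \<in> X i \<Longrightarrow> strand i v m \<tau> = strand i w m \<tau>"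
  shows "v = w"
proof (rule eq_vecI)
  fix j assume "j < dim_vec w"
  hence j: "j < rank i" using assms by simp
  show "v $ j = w $ j"
  proof (rule poly_mapping_eqI)
    fix k
    show "coeff (v $ j) k = coeff (w $ j) k"
      using assms(3)[OF enum_mem[OF j], of "lab (enum i j) + k"] by (simp add: strand_plus idx_enum j)
  qed
qed (use assms in auto)

lemma strand_zero: "\<tau> \<in> X i \<Longrightarrow> strand i (0\<^sub>v (rank i)) m \<tau> = 0"
  by (simp add: strand_def idx_less)

lemma finite_strand: "finite {m. \<exists>\<tau>\<in>X i. strand i w m \<tau> \<noteq> 0}"
proof -
  have "{m. \<exists>\<tau>\<in>X i. strand i w m \<tau> \<noteq> 0} = (\<Union>\<tau>\<in>X i. keys (monom (lab \<tau>) 1 * w $ idx i \<tau>))"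
    by (auto simp: strand_def in_keys_iff)
  thus ?thesis by (simp add: finite_X)
qed

text \<open>In row \<sigma> the monomial of \<open>lab \<sigma>\<close> cancels against the quotient
  in \<open>dmat\<close>; what remains is the monomial of \<open>lab \<tau>\<close>, the one that
  \<open>strand\<close> puts on the coordinate \<tau>, times a scalar.\<close>

lemma strand_dmat:
  assumes w: "w \<in> carrier_vec (rank (Suc i))" and \<sigma>: "\<sigma> \<in> X i"
  shows "strand i (dmat i *\<^sub>v w) m \<sigma> = bd i (strand (Suc i) w m) \<sigma>"
proof -
  let ?e = "enum (Suc i)"
  have "monom (lab \<sigma>) 1 * (dmat i *\<^sub>v w) $ idx i \<sigma> =
      (\<Sum>t<rank (Suc i). monom (lab \<sigma>) 1 * (monom (lab (?e t) - lab \<sigma>) (inc i \<sigma> (?e t)) * w $ t))"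
    using w by (simp add: dmat_def idx_less[OF \<sigma>] enum_idx[OF \<sigma>] scalar_prod_def
      sum_distrib_left atLeast0LessThan)
  also have "\<dots> = (\<Sum>t<rank (Suc i). monom (lab (?e t)) (inc i \<sigma> (?e t)) * w $ t)"
  proof (rule sum.cong[OF refl])
    fix t assume t: "t \<in> {..<rank (Suc i)}"
    show "monom (lab \<sigma>) 1 * (monom (lab (?e t) - lab \<sigma>) (inc i \<sigma> (?e t)) * w $ t) =
        monom (lab (?e t)) (inc i \<sigma> (?e t)) * w $ t"
      using inc_lab[OF \<sigma> enum_mem[of t]] t
      by (cases "inc i \<sigma> (?e t) = 0") (auto simp: mult_single simp flip: mult.assoc)
  qed
  finally have "strand i (dmat i *\<^sub>v w) m \<sigma> =
      (\<Sum>t<rank (Suc i). coeff (monom (lab (?e t)) (inc i \<sigma> (?e t)) * w $ t) m)"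
    by (simp add: strand_def lookup_sum)
  also have "\<dots> = (\<Sum>t<rank (Suc i). inc i \<sigma> (?e t) * strand (Suc i) w m (?e t))"
    by (intro sum.cong) (simp_all add: strand_def idx_enum coeff_monom_scale[of _ "inc i _ _"])
  also have "\<dots> = bd i (strand (Suc i) w m) \<sigma>"
    unfolding incidence_boundary_def by (rule sum.reindex_bij_betw[OF bij_enum])
  finally show ?thesis .
qed

text \<open>Values in multidegree m can be prescribed at \<tau> as soon as \<open>lab \<tau>\<close>
  divides m, because the label can then be divided out. Finiteness of \<open>M\<close> keeps the
  coordinates polynomial.\<close>

lemma strand_build:
  assumes "finite M" and h: "\<And>m \<tau>. \<tau> \<in> X i \<Longrightarrow> h m \<tau> \<noteq> 0 \<Longrightarrow> m \<in> M \<and> mon_dvd (lab \<tau>) m"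
  obtains w where "w \<in> carrier_vec (rank i)" "\<And>m \<tau>. \<tau> \<in> X i \<Longrightarrow> strand i w m \<tau> = h m \<tau>"
proof
  let ?w = "vec (rank i) (\<lambda>j. \<Sum>m\<in>M. monom (m - lab (enum i j)) (h m (enum i j)))"
  show "?w \<in> carrier_vec (rank i)" by simp
  fix m \<tau> assume \<tau>: "\<tau> \<in> X i"
  have "monom (lab \<tau>) 1 * ?w $ idx i \<tau> = (\<Sum>m\<in>M. monom (lab \<tau>) 1 * monom (m - lab \<tau>) (h m \<tau>))"
    by (simp add: idx_less[OF \<tau>] enum_idx[OF \<tau>] sum_distrib_left)
  also have "\<dots> = (\<Sum>m\<in>M. monom m (h m \<tau>))"
  proof (rule sum.cong[OF refl])
    fix m
    show "monom (lab \<tau>) 1 * monom (m - lab \<tau>) (h m \<tau>) = monom m (h m \<tau>)"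
      using h[OF \<tau>, of m] by (cases "h m \<tau> = 0") (auto simp: mult_single)
  qed
  finally have "strand i ?w m \<tau> = (\<Sum>m'\<in>M. h m' \<tau> when m' = m)"
    by (simp add: strand_def lookup_sum lookup_single)
  also have "\<dots> = h m \<tau>"
    using h[OF \<tau>, of m] by (auto simp: when_def sum.delta[OF \<open>finite M\<close>])
  finally show "strand i ?w m \<tau> = h m \<tau>" .
qed

text \<open>Fillings found separately in each multidegree are assembled into one vector. The
  predicate \<open>Q\<close> transports an extra property of the fillings: labels equal to the
  multidegree when the lift has to be constant, and nothing when plain exactness is at
  stake.\<close>

lemma strand_lift:
  assumes v: "v \<in> carrier_vec (rank i)"
    and ex: "\<And>m. \<exists>h. (\<forall>\<upsilon>\<in>X (Suc i). h \<upsilon> \<noteq> 0 \<longrightarrow> mon_dvd (lab \<upsilon>) m \<and> Q m \<upsilon>) \<and>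
      (\<forall>\<tau>\<in>X i. strand i v m \<tau> = bd i h \<tau>)"
  obtains w where "w \<in> carrier_vec (rank (Suc i))" "v = dmat i *\<^sub>v w"
    "\<And>m \<upsilon>. \<upsilon> \<in> X (Suc i) \<Longrightarrow> strand (Suc i) w m \<upsilon> \<noteq> 0 \<Longrightarrow> Q m \<upsilon> \<and> (\<exists>\<tau>\<in>X i. strand i v m \<tau> \<noteq> 0)"
proof -
  from ex obtain h where
    h: "\<And>m \<upsilon>. \<upsilon> \<in> X (Suc i) \<Longrightarrow> h m \<upsilon> \<noteq> 0 \<Longrightarrow> mon_dvd (lab \<upsilon>) m \<and> Q m \<upsilon>"
      "\<And>m \<tau>. \<tau> \<in> X i \<Longrightarrow> strand i v m \<tau> = bd i (h m) \<tau>"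
    by metis
  let ?M = "{m. \<exists>\<tau>\<in>X i. strand i v m \<tau> \<noteq> 0}"
  \<comment> \<open>The chosen fillings may be non-zero in infinitely many multidegrees. Cutting
    them off where the strand of v vanishes leaves finitely many and does not change what they
    bound.\<close>
  define h' where "h' m \<upsilon> = (if m \<in> ?M then h m \<upsilon> else 0)" for m \<upsilon>
  obtain w where w: "w \<in> carrier_vec (rank (Suc i))"
    "\<And>m \<upsilon>. \<upsilon> \<in> X (Suc i) \<Longrightarrow> strand (Suc i) w m \<upsilon> = h' m \<upsilon>"
    by (rule strand_build[OF finite_strand[of i v], of "Suc i" h'])
      (use h(1) in \<open>auto simp: h'_def split: if_splits\<close>)
  have "v = dmat i *\<^sub>v w"
  proof (rule strand_eqI[OF v])
    show "dmat i *\<^sub>v w \<in> carrier_vec (rank i)" by (rule mult_mat_vec_carrier[OF dmat_carrier w(1)])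
    fix m \<tau> assume \<tau>: "\<tau> \<in> X i"
    have "strand i (dmat i *\<^sub>v w) m \<tau> = bd i (h' m) \<tau>"
      unfolding strand_dmat[OF w(1) \<tau>] by (simp add: incidence_boundary_def w(2))
    also have "\<dots> = strand i v m \<tau>"
      using h(2)[OF \<tau>] \<tau> by (cases "m \<in> ?M") (auto simp: h'_def incidence_boundary_def)
    finally show "strand i v m \<tau> = strand i (dmat i *\<^sub>v w) m \<tau>" ..
  qed
  moreover have "Q m \<upsilon> \<and> (\<exists>\<tau>\<in>X i. strand i v m \<tau> \<noteq> 0)"
    if "\<upsilon> \<in> X (Suc i)" "strand (Suc i) w m \<upsilon> \<noteq> 0" for m \<upsilon>
    using that h(1)[OF that(1)] by (auto simp: w(2) h'_def split: if_splits)
  ultimately show ?thesis using that w(1) by blast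
qed

lemma hom_vec_strand:
  assumes w: "w \<in> carrier_vec (rank i)"
  shows "hom_vec d w \<longleftrightarrow>
    (\<forall>\<tau>\<in>X i. \<forall>m. strand i w m \<tau> \<noteq> 0 \<longrightarrow> int (mon_degree m) = int (mon_degree (lab \<tau>)) + d)"
proof (intro iffI ballI allI impI)
  fix \<tau> m assume "hom_vec d w" "\<tau> \<in> X i" "strand i w m \<tau> \<noteq> 0"
  moreover from this(3) obtain k where "m = lab \<tau> + k" "coeff (w $ idx i \<tau>) k \<noteq> 0"
    by (rule strand_nonzero)
  ultimately show "int (mon_degree m) = int (mon_degree (lab \<tau>)) + d"
    using idx_less[of \<tau> i] w homogeneousD[of d "w $ idx i \<tau>" k] by (simp add: mon_degree_plus hom_vec_def)
next
  assume *: "\<forall>\<tau>\<in>X i. \<forall>m. strand i w m \<tau> \<noteq> 0 \<longrightarrow> int (mon_degree m) = int (mon_degree (lab \<tau>)) + d"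
  show "hom_vec d w"
    unfolding hom_vec_def
  proof (intro allI impI homogeneousI)
    fix j k assume "j < dim_vec w" and nz: "coeff (w $ j) k \<noteq> 0"
    hence j: "j < rank i" using w by simp
    show "int (mon_degree k) = d"
      using *[rule_format, OF enum_mem[OF j], of "lab (enum i j) + k"] nz
      by (simp add: strand_plus idx_enum j mon_degree_plus)
  qed
qed

end

text \<open>The last two axioms are \<open>const_inj\<close> and \<open>linear_ker\<close> read in
  one multidegree: a constant entry at \<tau> lives only in the multidegree
  \<open>lab \<tau>\<close>, and a linear entry at a cell of index \<open>Suc i\<close> lives in
  multidegrees of degree n + i + 1.\<close>

locale linear_labelled_complex = labelled_complex X lab inc
  for X :: "nat \<Rightarrow> 'c set" and lab :: "'c \<Rightarrow> 'a \<Rightarrow>\<^sub>0 nat" and inc :: "nat \<Rightarrow> 'c \<Rightarrow> 'c \<Rightarrow> 'k::field" +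
  fixes V :: "'a set" and n :: nat
  assumes card_X_0: "card (X 0) = 1"
    and lab_0: "\<tau> \<in> X 0 \<Longrightarrow> lab \<tau> = 0"
    and lab_Suc: "\<tau> \<in> X (Suc i) \<Longrightarrow> mon_degree (lab \<tau>) = n + i"
    and lab_V: "\<tau> \<in> X i \<Longrightarrow> keys (lab \<tau>) \<subseteq> V"
    and bd_bd: "\<sigma> \<in> X i \<Longrightarrow> \<upsilon> \<in> X (Suc (Suc i)) \<Longrightarrow>
      (\<Sum>\<tau>\<in>X (Suc i). inc i \<sigma> \<tau> * inc (Suc i) \<tau> \<upsilon>) = 0"
    and bd_inj: "\<lbrakk>\<forall>\<tau>\<in>X (Suc i). f \<tau> \<noteq> 0 \<longrightarrow> lab \<tau> = m; \<forall>\<sigma>\<in>X i. bd i f \<sigma> = 0; \<tau> \<in> X (Suc i)\<rbrakk>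
      \<Longrightarrow> f \<tau> = 0"
    and bd_linear: "\<lbrakk>\<forall>\<tau>\<in>X (Suc i). f \<tau> \<noteq> 0 \<longrightarrow> mon_dvd (lab \<tau>) m; mon_degree m = Suc (n + i);
        \<forall>\<sigma>\<in>X i. bd i f \<sigma> = 0\<rbrakk> \<Longrightarrow>
      \<exists>h. (\<forall>\<upsilon>\<in>X (Suc (Suc i)). h \<upsilon> \<noteq> 0 \<longrightarrow> lab \<upsilon> = m) \<and> (\<forall>\<tau>\<in>X (Suc i). f \<tau> = bd (Suc i) h \<tau>)"
begin

lemma free_module_strand:
  assumes w: "w \<in> carrier_vec (rank i)"
  shows "w \<in> free_module V (rank i) \<longleftrightarrow> (\<forall>\<tau>\<in>X i. \<forall>m. strand i w m \<tau> \<noteq> 0 \<longrightarrow> keys m \<subseteq> V)"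
proof (intro iffI ballI allI impI)
  fix \<tau> m assume a: "w \<in> free_module V (rank i)" "\<tau> \<in> X i" "strand i w m \<tau> \<noteq> 0"
  then obtain k where k: "m = lab \<tau> + k" "coeff (w $ idx i \<tau>) k \<noteq> 0" by (auto elim: strand_nonzero)
  have "w $ idx i \<tau> \<in> polys V" using a idx_less by (simp add: free_module_def)
  with k lab_V[OF a(2)] show "keys m \<subseteq> V" by (simp add: keys_plus_nat mem_polys)
next
  assume *: "\<forall>\<tau>\<in>X i. \<forall>m. strand i w m \<tau> \<noteq> 0 \<longrightarrow> keys m \<subseteq> V"
  have "w $ j \<in> polys V" if j: "j < rank i" for j
    unfolding mem_polys
  proof (intro allI impI)
    fix k assume "coeff (w $ j) k \<noteq> 0"
    thus "keys k \<subseteq> V"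
      using *[rule_format, OF enum_mem[OF j], of "lab (enum i j) + k"]
      by (simp add: strand_plus idx_enum j keys_plus_nat)
  qed
  thus "w \<in> free_module V (rank i)" using w by (simp add: free_module_def)
qed

lemma dmat_entry_nonzero:
  assumes "s < rank i" "t < rank (Suc i)" "coeff (dmat i $$ (s, t)) m \<noteq> 0"
  shows "lab (enum (Suc i) t) = lab (enum i s) + m"
  using assms inc_lab[OF enum_mem[OF assms(1)] enum_mem[OF assms(2)]]
  by (auto simp: dmat_def lookup_single when_def split: if_splits)

lemma dmat_dmat: "dmat i * dmat (Suc i) = 0\<^sub>m (rank i) (rank (Suc (Suc i)))"
proof (rule eq_matI)
  fix s u assume "s < dim_row (0\<^sub>m (rank i) (rank (Suc (Suc i))) :: ('a, 'k) mpoly mat)"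
    "u < dim_col (0\<^sub>m (rank i) (rank (Suc (Suc i))) :: ('a, 'k) mpoly mat)"
  hence s: "s < rank i" and u: "u < rank (Suc (Suc i))" by auto
  let ?\<sigma> = "enum i s" and ?\<upsilon> = "enum (Suc (Suc i)) u" and ?e = "enum (Suc i)"
  have "(dmat i * dmat (Suc i)) $$ (s, u) =
      (\<Sum>t<rank (Suc i). monom (lab (?e t) - lab ?\<sigma>) (inc i ?\<sigma> (?e t)) *
        monom (lab ?\<upsilon> - lab (?e t)) (inc (Suc i) (?e t) ?\<upsilon>))"
    using s u by (simp add: dmat_def scalar_prod_def atLeast0LessThan)
  also have "\<dots> = (\<Sum>t<rank (Suc i). monom (lab ?\<upsilon> - lab ?\<sigma>) (inc i ?\<sigma> (?e t) * inc (Suc i) (?e t) ?\<upsilon>))"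
  proof (rule sum.cong[OF refl])
    fix t assume "t \<in> {..<rank (Suc i)}"
    hence t: "?e t \<in> X (Suc i)" by (simp add: enum_mem)
    show "monom (lab (?e t) - lab ?\<sigma>) (inc i ?\<sigma> (?e t)) *
        monom (lab ?\<upsilon> - lab (?e t)) (inc (Suc i) (?e t) ?\<upsilon>) =
        monom (lab ?\<upsilon> - lab ?\<sigma>) (inc i ?\<sigma> (?e t) * inc (Suc i) (?e t) ?\<upsilon>)"
      using inc_lab[OF enum_mem[OF s] t] inc_lab[OF t enum_mem[OF u]]
      by (cases "inc i ?\<sigma> (?e t) = 0 \<or> inc (Suc i) (?e t) ?\<upsilon> = 0")
        (auto simp: mult_single add.assoc)
  qed
  also have "\<dots> = (\<Sum>\<tau>\<in>X (Suc i). monom (lab ?\<upsilon> - lab ?\<sigma>) (inc i ?\<sigma> \<tau> * inc (Suc i) \<tau> ?\<upsilon>))"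
    by (rule sum.reindex_bij_betw[OF bij_enum])
  also have "\<dots> = monom (lab ?\<upsilon> - lab ?\<sigma>) (\<Sum>\<tau>\<in>X (Suc i). inc i ?\<sigma> \<tau> * inc (Suc i) \<tau> ?\<upsilon>)"
    by (rule poly_mapping_eqI) (auto simp: lookup_sum lookup_single when_def)
  also have "\<dots> = 0" by (simp add: bd_bd[OF enum_mem[OF s] enum_mem[OF u]])
  finally show "(dmat i * dmat (Suc i)) $$ (s, u) = 0\<^sub>m (rank i) (rank (Suc (Suc i))) $$ (s, u)"
    using s u by simp
qed (simp_all add: dmat_def)

lemma linear_strand: "linear_strand V (int n) rank dmat"
proof
  show "rank 0 = 1" by (simp add: rank_def card_X_0)
  show "dmat i \<in> carrier_mat (rank i) (rank (Suc i))" for i by (rule dmat_carrier)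
  show "polys_mat V (dmat i)" for i
    unfolding polys_mat_def
  proof (intro allI impI)
    fix s t assume "s < dim_row (dmat i)" "t < dim_col (dmat i)"
    hence st: "s < rank i" "t < rank (Suc i)" by (simp_all add: dmat_def)
    show "dmat i $$ (s, t) \<in> polys V"
      unfolding mem_polys
      using dmat_entry_nonzero[OF st] lab_V[OF enum_mem[OF st(2)]] by (auto simp: keys_plus_nat)
  qed
  have hom: "hom_mat d (dmat i)"
    if "\<And>\<sigma> \<tau>. \<sigma> \<in> X i \<Longrightarrow> \<tau> \<in> X (Suc i) \<Longrightarrow> int (mon_degree (lab \<tau>)) = int (mon_degree (lab \<sigma>)) + d"
    for d i
    unfolding hom_mat_def
  proof (intro allI impI homogeneousI)
    fix s t m assume "s < dim_row (dmat i)" "t < dim_col (dmat i)" and nz: "coeff (dmat i $$ (s, t)) m \<noteq> 0"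
    hence st: "s < rank i" "t < rank (Suc i)" by (simp_all add: dmat_def)
    show "int (mon_degree m) = d"
      using that[OF enum_mem[OF st(1)] enum_mem[OF st(2)]] dmat_entry_nonzero[OF st nz]
      by (simp add: mon_degree_plus)
  qed
  show "hom_mat (int n) (dmat 0)"
    by (rule hom) (simp add: lab_0 lab_Suc[of _ 0] iffD2[OF mon_degree_eq_0_iff])
  show "hom_mat 1 (dmat (Suc i))" for i
    by (rule hom) (simp add: lab_Suc)
  show "dmat i * dmat (Suc i) = 0\<^sub>m (rank i) (rank (Suc (Suc i)))" for i by (rule dmat_dmat)
next
  fix c :: "('a, 'k) mpoly vec" and i
  assume c: "c \<in> carrier_vec (rank (Suc i))" "hom_vec 0 c" and 0: "dmat i *\<^sub>v c = 0\<^sub>v (rank i)"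
  show "c = 0\<^sub>v (rank (Suc i))"
  proof (rule strand_eqI[OF c(1)])
    fix m \<tau> assume \<tau>: "\<tau> \<in> X (Suc i)"
    have "strand (Suc i) c m \<tau> = 0"
    proof (rule bd_inj[OF _ _ \<tau>])
      \<comment> \<open>The cofactor of the label in m has degree 0, hence is 1.\<close>
      show "\<forall>\<tau>\<in>X (Suc i). strand (Suc i) c m \<tau> \<noteq> 0 \<longrightarrow> lab \<tau> = m"
        using c(2) unfolding hom_vec_strand[OF c(1)]
        by (auto simp: mon_degree_plus mon_degree_eq_0_iff elim!: strand_nonzero)
          (metis add_cancel_right_right mon_degree_eq_0_iff mon_degree_plus strand_plus)
      show "\<forall>\<sigma>\<in>X i. bd i (strand (Suc i) c m) \<sigma> = 0"
        using strand_dmat[OF c(1)] strand_zero by (simp add: 0)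
    qed
    thus "strand (Suc i) c m \<tau> = strand (Suc i) (0\<^sub>v (rank (Suc i))) m \<tau>" by (simp add: strand_zero \<tau>)
  qed simp
next
  fix v :: "('a, 'k) mpoly vec" and i
  assume "v \<in> free_module V (rank (Suc i))" and hom: "hom_vec 1 v" and 0: "dmat i *\<^sub>v v = 0\<^sub>v (rank i)"
  hence v: "v \<in> carrier_vec (rank (Suc i))" by (simp add: free_module_carrier)
  obtain c where c: "c \<in> carrier_vec (rank (Suc (Suc i)))" "v = dmat (Suc i) *\<^sub>v c"
    "\<And>m \<upsilon>. \<upsilon> \<in> X (Suc (Suc i)) \<Longrightarrow> strand (Suc (Suc i)) c m \<upsilon> \<noteq> 0 \<Longrightarrow>
      lab \<upsilon> = m \<and> (\<exists>\<tau>\<in>X (Suc i). strand (Suc i) v m \<tau> \<noteq> 0)"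
  proof (rule strand_lift[OF v, where Q = "\<lambda>m \<upsilon>. lab \<upsilon> = m"])
    fix m
    show "\<exists>h. (\<forall>\<upsilon>\<in>X (Suc (Suc i)). h \<upsilon> \<noteq> 0 \<longrightarrow> mon_dvd (lab \<upsilon>) m \<and> lab \<upsilon> = m) \<and>
        (\<forall>\<tau>\<in>X (Suc i). strand (Suc i) v m \<tau> = bd (Suc i) h \<tau>)"
    \<comment> \<open>The degree of m is known only through a non-zero coefficient of v; in all
      other multidegrees the filling 0 serves.\<close>
    proof (cases "\<exists>\<tau>\<in>X (Suc i). strand (Suc i) v m \<tau> \<noteq> 0")
      case True
      then obtain \<tau> where \<tau>: "\<tau> \<in> X (Suc i)" "strand (Suc i) v m \<tau> \<noteq> 0" by blast
      have deg: "mon_degree m = Suc (n + i)"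
        using hom[unfolded hom_vec_strand[OF v], rule_format, OF \<tau>] lab_Suc[OF \<tau>(1)] by simp
      have dvd: "\<forall>\<tau>\<in>X (Suc i). strand (Suc i) v m \<tau> \<noteq> 0 \<longrightarrow> mon_dvd (lab \<tau>) m"
        by (auto elim: strand_nonzero)
      have "\<forall>\<sigma>\<in>X i. bd i (strand (Suc i) v m) \<sigma> = 0"
        using strand_dmat[OF v] strand_zero by (simp add: 0)
      from bd_linear[OF dvd deg this] show ?thesis
        by (metis add.right_neutral)
    next
      case False
      thus ?thesis by (intro exI[of _ "\<lambda>_. 0"]) (auto simp: incidence_boundary_def)
    qed
  qed blast
  have "hom_vec 0 c"
    unfolding hom_vec_strand[OF c(1)] using c(3) by fastforce
  thus "\<exists>c\<in>carrier_vec (rank (Suc (Suc i))). hom_vec 0 c \<and> v = dmat (Suc i) *\<^sub>v c"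
    using c by blast
qed

text \<open>The cells whose label divides m span the complex that governs multidegree m. The
  position is \<open>Suc i\<close>; for the rainbow complex this is dimension i.\<close>

definition exact_at :: "nat \<Rightarrow> ('a \<Rightarrow>\<^sub>0 nat) \<Rightarrow> bool" where
  "exact_at i m \<longleftrightarrow> (\<forall>f. (\<forall>\<tau>\<in>X (Suc i). f \<tau> \<noteq> 0 \<longrightarrow> mon_dvd (lab \<tau>) m) \<and> (\<forall>\<sigma>\<in>X i. bd i f \<sigma> = 0) \<longrightarrow>
     (\<exists>h. (\<forall>\<upsilon>\<in>X (Suc (Suc i)). h \<upsilon> \<noteq> 0 \<longrightarrow> mon_dvd (lab \<upsilon>) m) \<and> (\<forall>\<tau>\<in>X (Suc i). f \<tau> = bd (Suc i) h \<tau>)))"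

text \<open>In one direction a cycle f is made the only non-zero strand of a vector, and a preimage
  of that vector is read off in multidegree m. In the other direction the strands of a vector are
  filled one by one and glued by \<open>strand_lift\<close>.\<close>

theorem exact_complex_iff:
  "exact_complex V rank dmat \<longleftrightarrow> (\<forall>i m. keys m \<subseteq> V \<longrightarrow> exact_at i m)"
proof (intro iffI allI impI)
  fix i and m :: "'a \<Rightarrow>\<^sub>0 nat"
  assume ex: "exact_complex V rank dmat" and m: "keys m \<subseteq> V"
  show "exact_at i m"
    unfolding exact_at_def
  proof (intro allI impI, elim conjE)
    fix f assume f: "\<forall>\<tau>\<in>X (Suc i). f \<tau> \<noteq> 0 \<longrightarrow> mon_dvd (lab \<tau>) m" "\<forall>\<sigma>\<in>X i. bd i f \<sigma> = 0"
    obtain v where v: "v \<in> carrier_vec (rank (Suc i))"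
      "\<And>m' \<tau>. \<tau> \<in> X (Suc i) \<Longrightarrow> strand (Suc i) v m' \<tau> = (if m' = m then f \<tau> else 0)"
      by (rule strand_build[of "{m}" "Suc i" "\<lambda>m' \<tau>. if m' = m then f \<tau> else 0"])
        (use f in \<open>auto split: if_splits\<close>)
    have "v \<in> free_module V (rank (Suc i))"
      unfolding free_module_strand[OF v(1)] using v(2) m by (auto split: if_splits)
    moreover have "dmat i *\<^sub>v v = 0\<^sub>v (rank i)"
    proof (rule strand_eqI)
      fix m' \<sigma> assume "\<sigma> \<in> X i"
      thus "strand i (dmat i *\<^sub>v v) m' \<sigma> = strand i (0\<^sub>v (rank i)) m' \<sigma>"
        using f(2) by (cases "m' = m") (simp_all add: strand_dmat[OF v(1)] strand_zero incidence_boundary_def v(2))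
    qed (auto intro: mult_mat_vec_carrier[OF dmat_carrier v(1)])
    ultimately obtain w where w: "w \<in> free_module V (rank (Suc (Suc i)))" "v = dmat (Suc i) *\<^sub>v w"
      using ex unfolding exact_complex_def by blast
    have wc: "w \<in> carrier_vec (rank (Suc (Suc i)))" by (rule free_module_carrier[OF w(1)])
    show "\<exists>h. (\<forall>\<upsilon>\<in>X (Suc (Suc i)). h \<upsilon> \<noteq> 0 \<longrightarrow> mon_dvd (lab \<upsilon>) m) \<and>
        (\<forall>\<tau>\<in>X (Suc i). f \<tau> = bd (Suc i) h \<tau>)"
    proof (intro exI[of _ "strand (Suc (Suc i)) w m"] conjI ballI impI)
      fix \<tau> assume "\<tau> \<in> X (Suc i)"
      thus "f \<tau> = bd (Suc i) (strand (Suc (Suc i)) w m) \<tau>"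
        using v(2)[of \<tau> m] strand_dmat[OF wc, of \<tau> m] w(2) by simp
    qed (auto elim: strand_nonzero)
  qed
next
  assume ex: "\<forall>i m. keys m \<subseteq> V \<longrightarrow> exact_at i m"
  interpret L: linear_strand V "int n" rank dmat by (rule linear_strand)
  show "exact_complex V rank dmat"
    unfolding exact_complex_def
  proof (intro allI equalityI subsetI)
    fix i v assume "v \<in> {v \<in> free_module V (rank (Suc i)). dmat i *\<^sub>v v = 0\<^sub>v (rank i)}"
    hence vf: "v \<in> free_module V (rank (Suc i))" and 0: "dmat i *\<^sub>v v = 0\<^sub>v (rank i)" by auto
    have v: "v \<in> carrier_vec (rank (Suc i))" by (rule free_module_carrier[OF vf])
    note vV = vf[unfolded free_module_strand[OF v], rule_format]
    obtain w where w: "w \<in> carrier_vec (rank (Suc (Suc i)))" "v = dmat (Suc i) *\<^sub>v w"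
      "\<And>m \<upsilon>. \<upsilon> \<in> X (Suc (Suc i)) \<Longrightarrow> strand (Suc (Suc i)) w m \<upsilon> \<noteq> 0 \<Longrightarrow>
        True \<and> (\<exists>\<tau>\<in>X (Suc i). strand (Suc i) v m \<tau> \<noteq> 0)"
    proof (rule strand_lift[OF v, where Q = "\<lambda>m \<upsilon>. True"])
      fix m
      show "\<exists>h. (\<forall>\<upsilon>\<in>X (Suc (Suc i)). h \<upsilon> \<noteq> 0 \<longrightarrow> mon_dvd (lab \<upsilon>) m \<and> True) \<and>
          (\<forall>\<tau>\<in>X (Suc i). strand (Suc i) v m \<tau> = bd (Suc i) h \<tau>)"
      proof (cases "\<exists>\<tau>\<in>X (Suc i). strand (Suc i) v m \<tau> \<noteq> 0")
        case True
        hence "exact_at i m" using ex vV by blast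
        moreover have "\<forall>\<sigma>\<in>X i. bd i (strand (Suc i) v m) \<sigma> = 0"
          using strand_dmat[OF v] strand_zero by (simp add: 0)
        moreover have "\<forall>\<tau>\<in>X (Suc i). strand (Suc i) v m \<tau> \<noteq> 0 \<longrightarrow> mon_dvd (lab \<tau>) m"
          by (auto elim: strand_nonzero)
        ultimately show ?thesis unfolding exact_at_def by simp
      next
        case False
        thus ?thesis by (intro exI[of _ "\<lambda>_. 0"]) (auto simp: incidence_boundary_def)
      qed
    qed blast
    have "w \<in> free_module V (rank (Suc (Suc i)))"
      unfolding free_module_strand[OF w(1)] using w(3) vV by blast
    thus "v \<in> (\<lambda>w. dmat (Suc i) *\<^sub>v w) ` free_module V (rank (Suc (Suc i)))"
      using w(2) by blast
  next
    fix i v assume "v \<in> (\<lambda>w. dmat (Suc i) *\<^sub>v w) ` free_module V (rank (Suc (Suc i)))"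
    then obtain w where w: "w \<in> free_module V (rank (Suc (Suc i)))" "v = dmat (Suc i) *\<^sub>v w" by blast
    have "dmat i *\<^sub>v v = (dmat i * dmat (Suc i)) *\<^sub>v w"
      unfolding w(2)
      by (rule assoc_mult_mat_vec[symmetric, OF dmat_carrier dmat_carrier free_module_carrier[OF w(1)]])
    also have "\<dots> = 0\<^sub>v (rank i)"
      using free_module_carrier[OF w(1)] by (intro eq_vecI) (auto simp: dmat_dmat)
    finally show "v \<in> {v \<in> free_module V (rank (Suc i)). dmat i *\<^sub>v v = 0\<^sub>v (rank i)}"
      using free_module_polys_mat[OF L.E_polys dmat_carrier w(1)] w(2) by simp
  qed
qed

end

section \<open>The labelled complex of a rainbow ideal\<close>

definition label :: "'a set \<Rightarrow> 'a \<Rightarrow>\<^sub>0 nat" where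
  "label W = (\<Sum>a\<in>W. Poly_Mapping.single a 1)"

lemma lookup_label: "finite W \<Longrightarrow> Poly_Mapping.lookup (label W) a = (if a \<in> W then 1 else 0)"
  by (simp add: label_def lookup_sum lookup_single when_def sum.delta)

lemma keys_label: "finite W \<Longrightarrow> keys (label W) = W"
  by (auto simp: in_keys_iff lookup_label split: if_splits)

lemma mon_degree_label: "finite W \<Longrightarrow> mon_degree (label W) = card W"
  by (simp add: mon_degree_def keys_label lookup_label)

lemma label_eq_iff: "finite W \<Longrightarrow> finite W' \<Longrightarrow> label W = label W' \<longleftrightarrow> W = W'"
  by (metis keys_label)

lemma mon_dvd_label_iff:
  assumes "finite W"
  shows "mon_dvd (label W) m \<longleftrightarrow> W \<subseteq> keys m"
proof
  assume "W \<subseteq> keys m"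
  hence "m = label W + (m - label W)"
    by (intro poly_mapping_eqI) (auto simp: lookup_add lookup_minus lookup_label assms in_keys_iff)
  thus "mon_dvd (label W) m" ..
qed (auto simp: keys_plus_nat keys_label assms)

text \<open>The product of the variables in the support divides m, and the degree bound leaves no
  room for a further factor: m is squarefree.\<close>

lemma label_keys:
  assumes "mon_degree m \<le> card (keys m)"
  shows "label (keys m) = m"
proof -
  obtain k where k: "m = label (keys m) + k"
    using mon_dvd_label_iff[of "keys m" m] by auto
  hence "mon_degree m = card (keys m) + mon_degree k"
    by (metis finite_keys mon_degree_label mon_degree_plus)
  with assms have "k = 0" by (simp add: mon_degree_eq_0_iff)
  with k show ?thesis by simp
qed

lemma card_facet:
  assumes "finite W" "\<tau> \<subseteq> W" "card W = Suc (card \<tau>)"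
  obtains v where "v \<in> W" "\<tau> = W - {v}"
proof -
  have "card (W - \<tau>) = 1"
    using assms by (simp add: card_Diff_subset finite_subset)
  then obtain v where "W - \<tau> = {v}" by (auto simp: card_1_singleton_iff)
  with assms(2) have "v \<in> W" "\<tau> = W - {v}" by auto
  thus ?thesis using that by blast
qed

section \<open>Products of simplices encoded by their vertex sets\<close>

locale rainbow =
  fixes n :: nat and A :: "nat \<Rightarrow> 'a set" and T :: "(nat \<Rightarrow> 'a) set" and pos :: "'a \<Rightarrow> nat"
  assumes finite_A: "i < n \<Longrightarrow> finite (A i)"
    and disjoint_A: "disjoint_family_on A {..<n}"
    and T_subset: "T \<subseteq> PiE {..<n} A"
    and inj_pos: "inj_on pos (\<Union>i<n. A i)"
begin

definition verts :: "'a set" where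
  "verts = (\<Union>i<n. A i)"

definition ix :: "'a \<Rightarrow> nat" where
  "ix v = (THE i. i < n \<and> v \<in> A i)"

text \<open>These are the vertex sets of the cells of the whole product: every \<open>A i\<close>
  contributes a non-empty factor.\<close>

definition full :: "'a set \<Rightarrow> bool" where
  "full W \<longleftrightarrow> W \<subseteq> verts \<and> {..<n} \<subseteq> ix ` W"

definition part :: "'a set \<Rightarrow> nat \<Rightarrow> 'a set" where
  "part W = (\<lambda>i\<in>{..<n}. W \<inter> A i)"

text \<open>
  As the sets \<open>A i\<close> are disjoint, the cell \<open>R\<close> is determined by the union \<open>W\<close> of its factors,
  and \<open>part W\<close> recovers it.
\<close>

definition cell_sets :: "(nat \<Rightarrow> 'a) set \<Rightarrow> nat \<Rightarrow> 'a set set" where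
  "cell_sets U q = {W. full W \<and> PiE {..<n} (part W) \<subseteq> U \<and> card W = n + q}"

text \<open>The empty cell comes first, so cells of dimension \<open>q\<close> have index \<open>Suc q\<close>.\<close>

definition X :: "nat \<Rightarrow> 'a set set" where
  "X i = (case i of 0 \<Rightarrow> {{}} | Suc q \<Rightarrow> cell_sets T q)"

definition before :: "'a set \<Rightarrow> 'a \<Rightarrow> 'a set" where
  "before W v = {w \<in> W. ix w < ix v \<or> ix w = ix v \<and> pos w < pos v}"

text \<open>
  The sign exponent counts the dimensions of the previous factors, each one less than its number of
  vertices; modulo two these corrections add up to \<open>ix v\<close>.
\<close>

definition orient :: "'a set \<Rightarrow> 'a \<Rightarrow> 'k::field" where
  "orient W v = (- 1) ^ (card (before W v) + ix v)"

text \<open>Index 0 is the augmentation. Above it at most one summand is non-zero, since \<sigma>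
  determines the removed vertex; writing a sum avoids choosing that vertex.\<close>

definition inc :: "nat \<Rightarrow> 'a set \<Rightarrow> 'a set \<Rightarrow> 'k::field" where
  "inc i \<sigma> \<tau> = (case i of 0 \<Rightarrow> 1 | Suc q \<Rightarrow> \<Sum>v\<in>\<tau>. if \<sigma> = \<tau> - {v} then orient \<tau> v else 0)"

abbreviation bd :: "nat \<Rightarrow> ('a set \<Rightarrow> 'k::field) \<Rightarrow> 'a set \<Rightarrow> 'k" where
  "bd \<equiv> incidence_boundary X inc"

lemma X_simps [simp]: "X 0 = {{}}" "X (Suc q) = cell_sets T q"
  by (simp_all add: X_def)

lemma inc_0 [simp]: "inc 0 \<sigma> \<tau> = 1"
  by (simp add: inc_def)

lemma ix_eq: "i < n \<Longrightarrow> v \<in> A i \<Longrightarrow> ix v = i"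
  unfolding ix_def using disjoint_A
  by (intro the_equality) (auto simp: disjoint_family_on_def)

lemma ix_verts: "v \<in> verts \<Longrightarrow> ix v < n" "v \<in> verts \<Longrightarrow> v \<in> A (ix v)"
  using ix_eq by (auto simp: verts_def)

lemma mem_A_iff: "i < n \<Longrightarrow> v \<in> verts \<Longrightarrow> v \<in> A i \<longleftrightarrow> ix v = i"
  using ix_eq ix_verts by blast

lemma finite_verts: "finite verts"
  by (simp add: verts_def finite_A)

lemma full_finite: "full W \<Longrightarrow> finite W"
  using finite_verts finite_subset by (auto simp: full_def)

lemma full_mono: "full W \<Longrightarrow> W \<subseteq> W' \<Longrightarrow> W' \<subseteq> verts \<Longrightarrow> full W'"
  by (meson full_def image_mono order_trans)

lemma full_ix: "full W \<Longrightarrow> ix ` W = {..<n}"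
  using ix_verts by (auto simp: full_def)

lemma full_iff_part:
  assumes "W \<subseteq> verts"
  shows "full W \<longleftrightarrow> (\<forall>i<n. part W i \<noteq> {})"
proof -
  have "i \<in> ix ` W \<longleftrightarrow> part W i \<noteq> {}" if "i < n" for i
    using mem_A_iff[OF that] assms that by (auto simp: part_def)
  thus ?thesis unfolding full_def using assms by (metis lessThan_iff subset_iff)
qed

lemma full_transversal:
  assumes "full W"
  obtains t where "t \<in> PiE {..<n} (part W)"
proof -
  have "\<forall>i\<in>{..<n}. \<exists>v. v \<in> part W i"
    using assms full_iff_part full_def by blast
  then obtain t where "\<forall>i\<in>{..<n}. t i \<in> part W i" by (rule bchoice[THEN exE])
  thus ?thesis using that[of "restrict t {..<n}"] by auto
qed

lemma transversal_ix: "t \<in> PiE {..<n} (part W) \<Longrightarrow> i < n \<Longrightarrow> t i \<in> W \<and> ix (t i) = i"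
  using ix_eq by (fastforce simp: part_def PiE_iff)

text \<open>A transversal uses at most n vertices, so some vertex of W lies off it. Deleting that
  vertex keeps the transversal, which alone guarantees that all n indices still occur.\<close>

lemma transversal_remove:
  assumes W: "full W" "n < card W" and t: "t \<in> PiE {..<n} (part W)"
  obtains w where "w \<in> W" "full (W - {w})" "t \<in> PiE {..<n} (part (W - {w}))"
proof -
  have "card (t ` {..<n}) \<le> n" using card_image_le[of "{..<n}" t] by simp
  hence "\<not> W \<subseteq> t ` {..<n}" using W(2) card_mono[of "t ` {..<n}" W] by auto
  then obtain w where w: "w \<in> W" "w \<notin> t ` {..<n}" by blast
  have "i \<in> ix ` (W - {w})" if "i < n" for i
    using transversal_ix[OF t that] w that by (intro image_eqI[of _ _ "t i"]) auto
  hence "full (W - {w})" using W by (auto simp: full_def)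
  moreover have "t \<in> PiE {..<n} (part (W - {w}))"
    using t w by (auto simp: PiE_iff part_def)
  ultimately show ?thesis using that w by blast
qed

lemma cell_sets_full: "W \<in> cell_sets U q \<Longrightarrow> full W"
  by (simp add: cell_sets_def)

lemma cell_sets_finite: "W \<in> cell_sets U q \<Longrightarrow> finite W"
  by (simp add: cell_sets_full full_finite)

lemma cell_sets_card: "W \<in> cell_sets U q \<Longrightarrow> card W = n + q"
  by (simp add: cell_sets_def)

lemma PiE_part_mono: "W \<subseteq> W' \<Longrightarrow> PiE {..<n} (part W) \<subseteq> PiE {..<n} (part W')"
  by (rule PiE_mono) (auto simp: part_def)

lemma cell_sets_subset:
  "W' \<in> cell_sets U q' \<Longrightarrow> W \<subseteq> W' \<Longrightarrow> full W \<Longrightarrow> card W = n + q \<Longrightarrow> W \<in> cell_sets U q"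
  using PiE_part_mono[of W W'] by (auto simp: cell_sets_def)

lemma finite_X: "finite (X i)"
proof (cases i)
  case (Suc q)
  have "cell_sets T q \<subseteq> Pow verts" by (auto simp: cell_sets_def full_def)
  thus ?thesis by (simp add: Suc finite_verts finite_subset)
qed simp

section \<open>Incidence numbers and the vanishing of the double boundary\<close>

lemma inc_facet:
  assumes "finite \<tau>" "v \<in> \<tau>"
  shows "inc (Suc q) (\<tau> - {v}) \<tau> = orient \<tau> v"
proof -
  have "\<tau> - {v} = \<tau> - {u} \<longleftrightarrow> u = v" if "u \<in> \<tau>" for u
    using assms that by blast
  hence "inc (Suc q) (\<tau> - {v}) \<tau> = (\<Sum>u\<in>\<tau>. if u = v then orient \<tau> u else 0 :: 'b)"
    unfolding inc_def by (simp cong: sum.cong)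
  thus ?thesis using assms by simp
qed

lemma inc_nonzero:
  assumes "inc (Suc q) \<sigma> \<tau> \<noteq> 0"
  obtains v where "v \<in> \<tau>" "\<sigma> = \<tau> - {v}"
proof -
  have "\<exists>v\<in>\<tau>. \<sigma> = \<tau> - {v}"
    using assms by (rule contrapos_np) (auto simp: inc_def intro: sum.neutral)
  thus ?thesis using that by blast
qed

lemma orient_nonzero: "orient W v \<noteq> (0 :: 'k::field)"
  by (simp add: orient_def)

text \<open>Vertices are ordered by factor and then by position. Deleting the earlier of two
  vertices lowers the count before the later one by 1, while deleting the later one leaves the count
  before the earlier one unchanged; so the two orders of removal have opposite signs.\<close>

lemma orient_swap:
  assumes W: "W \<subseteq> verts" "v \<in> W" "w \<in> W" "v \<noteq> w"
  shows "orient (W - {v}) w * orient W v + orient (W - {w}) v * orient W w = (0 :: 'k::field)"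
proof -
  have *: "orient (W - {v}) w * orient W v + orient (W - {w}) v * orient W w = (0 :: 'k)"
    if vw: "v \<in> before W w" "w \<notin> before W v" "v \<in> W" "w \<in> W" for v w
  proof -
    have fin: "finite (before W w)" using finite_verts W(1) by (auto simp: before_def intro: finite_subset)
    have "before (W - {v}) w = before W w - {v}" "before (W - {w}) v = before W v"
      using vw by (auto simp: before_def)
    moreover have "card (before W w) = Suc (card (before W w - {v}))"
      using card_Suc_Diff1[OF fin vw(1)] by simp
    ultimately show ?thesis by (simp add: orient_def power_add)
  qed
  have "v \<in> (\<Union>i<n. A i)" "w \<in> (\<Union>i<n. A i)" using W by (auto simp: verts_def)
  hence "pos v \<noteq> pos w" using inj_onD[OF inj_pos] W(4) by blast
  hence "v \<in> before W w \<and> w \<notin> before W v \<or> w \<in> before W v \<and> v \<notin> before W w"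
    using W by (auto simp: before_def)
  thus ?thesis using *[of v w] *[of w v] W by (auto simp: add.commute)
qed

text \<open>Exactly two facets of \<open>W\<close> contain a given face of codimension two.\<close>

lemma codim_two_sum:
  assumes "finite Z" "finite W" "v \<in> W" "w \<in> W" "v \<noteq> w"
    and g: "\<And>\<tau>. g \<tau> \<noteq> 0 \<Longrightarrow> \<tau> \<in> Z \<and> (\<exists>u\<in>W. \<tau> = W - {u})"
  shows "(\<Sum>\<tau>\<in>Z. inc (Suc q) (W - {v, w}) \<tau> * g \<tau>) =
    orient (W - {v}) w * g (W - {v}) + orient (W - {w}) v * (g (W - {w}) :: 'k::field)"
proof -
  let ?D = "{W - {v}, W - {w}}" and ?\<rho> = "W - {v, w}"
  have zero: "inc (Suc q) ?\<rho> \<tau> * g \<tau> = 0" if "\<tau> \<notin> ?D" for \<tau>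
  proof (rule ccontr)
    assume "\<not> ?thesis"
    hence nz: "inc (Suc q) ?\<rho> \<tau> \<noteq> (0 :: 'k)" "g \<tau> \<noteq> 0" by auto
    from g[OF nz(2)] obtain u where u: "u \<in> W" "\<tau> = W - {u}" by blast
    from inc_nonzero[OF nz(1)] have "?\<rho> \<subseteq> \<tau>" by blast
    with u have "u = v \<or> u = w" by blast
    with u that show False by auto
  qed
  have "(\<Sum>\<tau>\<in>Z. inc (Suc q) ?\<rho> \<tau> * g \<tau>) = (\<Sum>\<tau>\<in>Z \<union> ?D. inc (Suc q) ?\<rho> \<tau> * g \<tau>)"
    by (rule sum.mono_neutral_left) (use assms(1) g in auto)
  also have "\<dots> = (\<Sum>\<tau>\<in>?D. inc (Suc q) ?\<rho> \<tau> * g \<tau>)"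
    by (rule sum.mono_neutral_right) (use assms(1) zero in auto)
  also have "\<dots> = inc (Suc q) ?\<rho> (W - {v}) * g (W - {v}) + inc (Suc q) ?\<rho> (W - {w}) * g (W - {w})"
    using assms by (subst sum.insert) auto
  also have "inc (Suc q) ?\<rho> (W - {v}) = (orient (W - {v}) w :: 'k)"
  proof -
    have "?\<rho> = W - {v} - {w}" by blast
    thus ?thesis using inc_facet[of "W - {v}" w q] assms by simp
  qed
  also have "inc (Suc q) ?\<rho> (W - {w}) = (orient (W - {w}) v :: 'k)"
  proof -
    have "?\<rho> = W - {w} - {v}" by blast
    thus ?thesis using inc_facet[of "W - {w}" v q] assms by simp
  qed
  finally show ?thesis .
qed

text \<open>With n + 1 vertices over n indices, exactly one index is taken twice, and the two
  vertices sharing it are the removable ones: W is an edge. They are neighbours in the order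
  defining \<open>before\<close>, which makes their signs opposite.\<close>

lemma edge_cell:
  assumes W: "full W" "card W = Suc n"
  obtains v w where "v \<in> W" "w \<in> W" "v \<noteq> w" "\<forall>u\<in>W. full (W - {u}) \<longleftrightarrow> u = v \<or> u = w"
    "orient W v + orient W w = (0 :: 'k::field)"
proof -
  note fin = full_finite[OF W(1)]
  have WV: "W \<subseteq> verts" using W by (simp add: full_def)
  have "\<not> inj_on ix W"
    using card_image[of ix W] full_ix[OF W(1)] W(2) by auto
  then obtain a b where ab: "a \<in> W" "b \<in> W" "a \<noteq> b" "ix a = ix b" by (auto simp: inj_on_def)
  have "a \<in> (\<Union>i<n. A i)" "b \<in> (\<Union>i<n. A i)" using ab WV by (auto simp: verts_def)
  hence "pos a \<noteq> pos b" using inj_onD[OF inj_pos] ab(3) by blast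
  then obtain v w where vw: "v \<in> W" "w \<in> W" "v \<noteq> w" "ix v = ix w" "pos v < pos w"
    using ab by (metis linorder_neqE_nat)
  have full_remove: "full (W - {x})" if "x \<in> {v, w}" for x
    unfolding full_def
  proof
    show "{..<n} \<subseteq> ix ` (W - {x})"
    proof
      fix k assume "k \<in> {..<n}"
      hence "k \<in> ix ` W" by (simp add: full_ix[OF W(1)])
      then obtain y where y: "y \<in> W" "ix y = k" by blast
      show "k \<in> ix ` (W - {x})"
        by (rule image_eqI[of _ _ "if y = x then (if x = v then w else v) else y"]) (use y vw that in auto)
    qed
  qed (use WV in auto)
  hence fullv: "full (W - {v})" by simp
  \<comment> \<open>Without v there are n vertices left and all n indices still occur, so v and w
    are the only pair sharing an index.\<close>
  have "card (ix ` (W - {v})) = card (W - {v})"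
    using full_ix[OF fullv] W(2) vw fin by simp
  hence inj: "inj_on ix (W - {v})" using fin by (intro eq_card_imp_inj_on) auto
  have other: "ix u \<noteq> ix v" if "u \<in> W" "u \<noteq> v" "u \<noteq> w" for u
    using inj_onD[OF inj, of u w] that vw by auto
  have iff: "full (W - {u}) \<longleftrightarrow> u = v \<or> u = w" if u: "u \<in> W" for u
  proof
    assume full: "full (W - {u})"
    show "u = v \<or> u = w"
    proof (rule ccontr)
      assume ne: "\<not> (u = v \<or> u = w)"
      have "ix u \<in> ix ` (W - {u})" using full_ix[OF full] full_ix[OF W(1)] u by auto
      then obtain u' where "ix u = ix u'" "u' \<in> W - {u}" by (rule imageE)
      hence u': "u' \<in> W" "u' \<noteq> u" "ix u' = ix u" by simp_all
      hence "u' \<noteq> v" using other[OF u] ne by auto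
      thus False using inj_onD[OF inj, of u' u] u' u ne by auto
    qed
  next
    show "u = v \<or> u = w \<Longrightarrow> full (W - {u})" using full_remove by auto
  qed
  have "before W w = insert v (before W v)"
  proof (rule Set.set_eqI)
    fix x
    show "x \<in> before W w \<longleftrightarrow> x \<in> insert v (before W v)"
      using vw other[of x] by (cases "x = v"; cases "x = w") (auto simp: before_def)
  qed
  moreover have "v \<notin> before W v" "finite (before W v)" using fin by (auto simp: before_def)
  ultimately have "orient W v + orient W w = (0 :: 'k)"
    using vw by (simp add: orient_def)
  with vw iff show ?thesis using that by blast
qed

text \<open>This is \<open>codim_two_sum\<close> one level lower, for the augmentation: the two ends
  of an edge share only the empty cell.\<close>

lemma bd_0_edge:
  assumes W: "full W" "card W = Suc n"
    and vw: "v \<in> W" "w \<in> W" "v \<noteq> w" "\<forall>u\<in>W. full (W - {u}) \<longleftrightarrow> u = v \<or> u = w"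
    and g: "\<And>\<tau>. g \<tau> \<noteq> 0 \<Longrightarrow> \<tau> \<in> cell_sets T 0 \<and> (\<exists>u\<in>W. \<tau> = W - {u})"
  shows "(\<Sum>\<tau>\<in>cell_sets T 0. g \<tau>) = g (W - {v}) + (g (W - {w}) :: 'k::field)"
proof -
  let ?D = "{W - {v}, W - {w}}"
  have fin: "finite (cell_sets T 0)" using finite_X[of 1] by simp
  have zero: "g \<tau> = 0" if "\<tau> \<notin> ?D" for \<tau>
  proof (rule ccontr)
    assume nz: "g \<tau> \<noteq> 0"
    from g[OF nz] obtain u where u: "u \<in> W" "\<tau> = W - {u}" "\<tau> \<in> cell_sets T 0" by blast
    hence "full (W - {u})" using cell_sets_full by blast
    with vw(4) u that show False by auto
  qed
  have "(\<Sum>\<tau>\<in>cell_sets T 0. g \<tau>) = (\<Sum>\<tau>\<in>cell_sets T 0 \<union> ?D. g \<tau>)"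
    by (rule sum.mono_neutral_left) (use fin g in auto)
  also have "\<dots> = (\<Sum>\<tau>\<in>?D. g \<tau>)"
    by (rule sum.mono_neutral_right) (use fin zero in auto)
  also have "\<dots> = g (W - {v}) + g (W - {w})"
    using vw by (subst sum.insert) auto
  finally show ?thesis .
qed

lemma bd_bd:
  assumes \<sigma>: "\<sigma> \<in> X i" and \<upsilon>: "\<upsilon> \<in> X (Suc (Suc i))"
  shows "(\<Sum>\<tau>\<in>X (Suc i). inc i \<sigma> \<tau> * inc (Suc i) \<tau> \<upsilon>) = (0 :: 'k::field)"
proof -
  \<comment> \<open>\<open>inc\<close> does not test fullness, so facets of \<upsilon> that are not
    cells are cut off here.\<close>
  define g :: "'a set \<Rightarrow> 'k" where "g \<tau> = (if \<tau> \<in> X (Suc i) then inc (Suc i) \<tau> \<upsilon> else 0)" for \<tau>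
  have \<upsilon>': "\<upsilon> \<in> cell_sets T (Suc i)" using \<upsilon> by simp
  note fin = cell_sets_finite[OF \<upsilon>'] and full = cell_sets_full[OF \<upsilon>'] and card = cell_sets_card[OF \<upsilon>']
  have \<upsilon>V: "\<upsilon> \<subseteq> verts" using full by (simp add: full_def)
  have g: "\<tau> \<in> X (Suc i) \<and> (\<exists>u\<in>\<upsilon>. \<tau> = \<upsilon> - {u})" if "g \<tau> \<noteq> 0" for \<tau>
    using that by (auto simp: g_def split: if_splits elim!: inc_nonzero)
  have g_facet: "g (\<upsilon> - {v}) = orient \<upsilon> v" if "v \<in> \<upsilon>" "full (\<upsilon> - {v})" for v
  proof -
    have "\<upsilon> - {v} \<in> cell_sets T i"
      by (rule cell_sets_subset[OF \<upsilon>' _ that(2)]) (use that fin card in auto)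
    thus ?thesis by (simp add: g_def inc_facet[OF fin that(1)])
  qed
  have eq: "(\<Sum>\<tau>\<in>X (Suc i). inc i \<sigma> \<tau> * inc (Suc i) \<tau> \<upsilon>) = (\<Sum>\<tau>\<in>X (Suc i). inc i \<sigma> \<tau> * g \<tau>)"
    by (simp add: g_def)
  show ?thesis
  proof (cases i)
    case 0
    have "card \<upsilon> = Suc n" using card 0 by simp
    then obtain v w where vw: "v \<in> \<upsilon>" "w \<in> \<upsilon>" "v \<noteq> w"
      "\<forall>u\<in>\<upsilon>. full (\<upsilon> - {u}) \<longleftrightarrow> u = v \<or> u = w" "orient \<upsilon> v + orient \<upsilon> w = (0 :: 'k)"
      by (rule edge_cell[OF full])
    have "(\<Sum>\<tau>\<in>cell_sets T 0. g \<tau>) = g (\<upsilon> - {v}) + g (\<upsilon> - {w})"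
      by (rule bd_0_edge[OF full \<open>card \<upsilon> = Suc n\<close> vw(1-4)]) (use g 0 in auto)
    thus ?thesis using vw eq by (simp add: g_facet 0)
  next
    case (Suc q)
    show ?thesis
    proof (rule ccontr)
      assume ne: "\<not> ?thesis"
      then obtain \<tau> where \<tau>: "\<tau> \<in> X (Suc i)" "inc i \<sigma> \<tau> * inc (Suc i) \<tau> \<upsilon> \<noteq> (0 :: 'k)"
        by (meson sum.neutral)
      hence nz: "inc i \<sigma> \<tau> \<noteq> (0 :: 'k)" "inc (Suc i) \<tau> \<upsilon> \<noteq> (0 :: 'k)" by auto
      from inc_nonzero[OF nz(2)] obtain v where v: "v \<in> \<upsilon>" "\<tau> = \<upsilon> - {v}" .
      from inc_nonzero[OF nz(1)[unfolded Suc]] obtain w where w: "w \<in> \<tau>" "\<sigma> = \<tau> - {w}" .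
      have vw: "w \<in> \<upsilon>" "v \<noteq> w" "\<sigma> = \<upsilon> - {v, w}" using v w by auto
      \<comment> \<open>Both intermediate facets contain the full set \<sigma>, so both are cells
        and both terms of the sum occur. The empty cell is not covered by this argument, hence the
        separate treatment of edges.\<close>
      have "full \<sigma>" using \<sigma> Suc cell_sets_full by simp
      hence "full (\<upsilon> - {v})" "full (\<upsilon> - {w})"
        using vw \<upsilon>V by (auto intro: full_mono)
      hence "(\<Sum>\<tau>\<in>X (Suc i). inc i \<sigma> \<tau> * g \<tau>) =
          orient (\<upsilon> - {v}) w * orient \<upsilon> v + orient (\<upsilon> - {w}) v * orient \<upsilon> w"
        using codim_two_sum[OF finite_X[of "Suc i"] fin v(1) vw(1,2), where g = g and q = q, OF g] vw(3) Suc v vw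
        by (simp add: g_facet del: X_simps)
      also have "\<dots> = 0" by (rule orient_swap[OF \<upsilon>V v(1) vw(1,2)])
      finally show False using ne eq by simp
    qed
  qed
qed

text \<open>In dimension 0 the augmentation detects the cell; in positive dimension a vertex off
  some transversal can be removed, and the resulting facet has the coefficient
  \<open>f \<tau>\<close> up to sign. The lemma yields \<open>bd_inj\<close>, because distinct cells
  have distinct labels.\<close>

lemma bd_single_nonzero:
  assumes \<tau>: "\<tau> \<in> X (Suc i)" "f \<tau> \<noteq> (0 :: 'k::field)" and f: "\<forall>\<tau>'\<in>X (Suc i). f \<tau>' \<noteq> 0 \<longrightarrow> \<tau>' = \<tau>"
  shows "\<exists>\<sigma>\<in>X i. bd i f \<sigma> \<noteq> 0"
proof -
  have \<tau>': "\<tau> \<in> cell_sets T i" using \<tau> by simp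
  have eq: "bd i f \<sigma> = inc i \<sigma> \<tau> * f \<tau>" for \<sigma>
  proof -
    have "bd i f \<sigma> = (\<Sum>\<tau>'\<in>{\<tau>}. inc i \<sigma> \<tau>' * f \<tau>')"
      unfolding incidence_boundary_def
      by (rule sum.mono_neutral_right) (use finite_X[of "Suc i"] f \<tau>(1) in auto)
    thus ?thesis by simp
  qed
  show ?thesis
  proof (cases i)
    case 0
    have "bd i f {} \<noteq> 0" unfolding eq using 0 \<tau>(2) by simp
    thus ?thesis using 0 by auto
  next
    case (Suc q)
    have "n < card \<tau>" using cell_sets_card[OF \<tau>'] Suc by simp
    moreover obtain t where t: "t \<in> PiE {..<n} (part \<tau>)"
      by (rule full_transversal[OF cell_sets_full[OF \<tau>']])
    ultimately obtain w where w: "w \<in> \<tau>" "full (\<tau> - {w})"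
      using transversal_remove[OF cell_sets_full[OF \<tau>']] by metis
    have "\<tau> - {w} \<in> cell_sets T q"
      by (rule cell_sets_subset[OF \<tau>' _ w(2)])
        (use w cell_sets_card[OF \<tau>'] cell_sets_finite[OF \<tau>'] Suc in auto)
    moreover have "bd i f (\<tau> - {w}) \<noteq> 0"
      unfolding eq by (simp add: Suc inc_facet[OF cell_sets_finite[OF \<tau>'] w(1)] orient_nonzero \<tau>(2))
    ultimately show ?thesis using Suc by auto
  qed
qed

text \<open>
  A cycle supported on facets of \<open>W\<close> is determined by one of its coefficients, because any two
  facets are joined by a chain of facets meeting in codimension two.
\<close>

lemma facet_cycle_propagate:
  assumes W: "W \<subseteq> verts" "card W = Suc (n + i)"
    and g: "\<And>\<tau>. g \<tau> \<noteq> 0 \<Longrightarrow> \<tau> \<in> cell_sets T i \<and> (\<exists>u\<in>W. \<tau> = W - {u})"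
    and cyc: "\<forall>\<sigma>\<in>X i. bd i g \<sigma> = (0 :: 'k::field)"
    and v: "v \<in> W" "g (W - {v}) \<noteq> 0" and w: "w \<in> W" "full (W - {w})"
  shows "g (W - {w}) \<noteq> 0"
proof (cases i)
  case 0
  have full: "full W" by (rule full_mono[OF w(2)]) (use W in auto)
  have card: "card W = Suc n" using W 0 by simp
  obtain a b where ab: "a \<in> W" "b \<in> W" "a \<noteq> b"
    "\<forall>u\<in>W. full (W - {u}) \<longleftrightarrow> u = a \<or> u = b" "orient W a + orient W b = (0 :: 'k)"
    by (rule edge_cell[OF full card])
  have "g (W - {a}) + g (W - {b}) = (\<Sum>\<tau>\<in>cell_sets T 0. g \<tau>)"
    by (rule bd_0_edge[OF full card ab(1-4), symmetric]) (use g 0 in auto)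
  also have "\<dots> = 0" using cyc by (simp add: 0 incidence_boundary_def)
  finally have sum: "g (W - {a}) + g (W - {b}) = 0" .
  have "full (W - {v})" using g[OF v(2)] cell_sets_full by blast
  hence "v = a \<or> v = b" "w = a \<or> w = b" using ab(4) v(1) w by auto
  thus ?thesis using sum v(2) by auto
next
  case (Suc q)
  have fin: "finite W" using W finite_verts finite_subset by blast
  \<comment> \<open>If removing both v and w leaves a full set, that face lies in exactly two facets
    of W, and the cycle condition at it ties their coefficients together.\<close>
  have step: "g (W - {w}) \<noteq> 0"
    if vw: "v \<in> W" "w \<in> W" "v \<noteq> w" "g (W - {v}) \<noteq> 0" "full (W - {v, w})" for v w
  proof
    assume 0: "g (W - {w}) = 0"
    have Wv: "W - {v} \<in> cell_sets T i" using g[OF vw(4)] by blast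
    have "W - {v, w} \<in> cell_sets T q"
      by (rule cell_sets_subset[OF Wv _ vw(5)]) (use W vw fin Suc in \<open>auto simp: card_Diff_insert\<close>)
    hence "bd i g (W - {v, w}) = 0" using cyc Suc by simp
    moreover have "bd i g (W - {v, w}) = orient (W - {v}) w * g (W - {v}) + orient (W - {w}) v * g (W - {w})"
      using codim_two_sum[OF finite_X[of "Suc i"] fin vw(1-3), of g q] g Suc
      by (simp add: incidence_boundary_def)
    ultimately show False using 0 vw(4) orient_nonzero[of "W - {v}" w, where 'k = 'k] by simp
  qed
  show ?thesis
  proof (cases "w = v \<or> full (W - {v, w})")
    case True
    thus ?thesis using step[of v w] v w by auto
  next
    case False
    have fullv: "full (W - {v})" using g[OF v(2)] cell_sets_full by blast
    have vw: "v \<noteq> w" using False by auto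
    \<comment> \<open>Otherwise v and w are the only vertices of W with some index j. Too many
      vertices remain for the other n - 1 indices, so two of them, u and u', share an index, and the
      facet without u is adjacent to both given facets.\<close>
    obtain j where j: "j < n" "j \<notin> ix ` (W - {v, w})"
      using False W by (auto simp: full_def)
    have "j \<in> ix ` (W - {v})" by (simp add: full_ix[OF fullv] j(1))
    then obtain y where y: "j = ix y" "y \<in> W - {v}" by (rule imageE)
    have "j \<in> ix ` (W - {w})" by (simp add: full_ix[OF w(2)] j(1))
    then obtain z where z: "j = ix z" "z \<in> W - {w}" by (rule imageE)
    have "y = w" "z = v" using j(2) y z by blast+
    hence ixvw: "ix v = j" "ix w = j" using y z by simp_all
    let ?W = "W - {v, w}"
    have "ix ` ?W \<subseteq> {..<n} - {j}" using ix_verts W j(2) by auto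
    hence "card (ix ` ?W) \<le> n - 1"
      using card_mono[of "{..<n} - {j}" "ix ` ?W"] j(1) by simp
    moreover have "card ?W = n + q" using W fin v w vw Suc by (simp add: card_Diff_insert)
    ultimately have "\<not> inj_on ix ?W" using card_image[of ix ?W] j(1) by auto
    then obtain u u' where u: "u \<in> ?W" "u' \<in> ?W" "u \<noteq> u'" "ix u = ix u'" by (auto simp: inj_on_def)
    have full_u: "full (W - {x, u})" if "full (W - {x})" "x = v \<or> x = w" for x
      unfolding full_def
    proof
      show "{..<n} \<subseteq> ix ` (W - {x, u})"
      proof
        fix k assume "k \<in> {..<n}"
        hence "k \<in> ix ` (W - {x})" by (simp only: full_ix[OF that(1)])
        then obtain y where y: "y \<in> W - {x}" "ix y = k" by blast
        show "k \<in> ix ` (W - {x, u})"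
          by (rule image_eqI[of _ _ "if y = u then u' else y"]) (use y u that(2) in auto)
      qed
    qed (use W in auto)
    have "g (W - {u}) \<noteq> 0" using step[of v u] u v full_u[OF fullv] by auto
    thus ?thesis using step[of u w] u w full_u[OF w(2)] by (auto simp: insert_commute)
  qed
qed

lemma facet_cycle_boundary:
  fixes f :: "'a set \<Rightarrow> 'k::field"
  assumes W: "W \<subseteq> verts" "card W = Suc (n + i)"
    and f: "\<And>\<tau>. \<tau> \<in> cell_sets T i \<Longrightarrow> f \<tau> \<noteq> 0 \<Longrightarrow> \<tau> \<subseteq> W"
    and cyc: "\<forall>\<sigma>\<in>X i. bd i f \<sigma> = 0" and nz: "\<tau>\<^sub>0 \<in> cell_sets T i" "f \<tau>\<^sub>0 \<noteq> 0"
  shows "\<exists>h. (\<forall>\<upsilon>\<in>X (Suc (Suc i)). h \<upsilon> \<noteq> 0 \<longrightarrow> \<upsilon> = W) \<and> (\<forall>\<tau>\<in>X (Suc i). f \<tau> = bd (Suc i) h \<tau>)"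
proof -
  have fin: "finite W" using W finite_verts finite_subset by blast
  have facet: "\<exists>u\<in>W. \<tau> = W - {u}" if "\<tau> \<in> cell_sets T i" "\<tau> \<subseteq> W" for \<tau>
    using card_facet[OF fin that(2)] W(2) cell_sets_card[OF that(1)] by auto
  define g where "g \<tau> = (if \<tau> \<in> cell_sets T i then f \<tau> else 0)" for \<tau>
  have g: "\<tau> \<in> cell_sets T i \<and> (\<exists>u\<in>W. \<tau> = W - {u})" if "g \<tau> \<noteq> 0" for \<tau>
    using that f facet by (auto simp: g_def split: if_splits)
  have g_cyc: "\<forall>\<sigma>\<in>X i. bd i g \<sigma> = 0"
    using cyc by (auto simp: incidence_boundary_def g_def)
  obtain v where v: "v \<in> W" "\<tau>\<^sub>0 = W - {v}" using facet[OF nz(1) f[OF nz]] by blast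
  have fullv: "full (W - {v})" using nz(1) v cell_sets_full by blast
  have full: "full W" by (rule full_mono[OF fullv]) (use W in auto)
  have gv: "g (W - {v}) \<noteq> 0" using nz v by (simp add: g_def)
  \<comment> \<open>By propagation every full facet of W has a non-zero coefficient and so is a cell
    inside T; each transversal of W lies in such a facet.\<close>
  have Wcell: "W \<in> cell_sets T (Suc i)"
    unfolding cell_sets_def
  proof (intro CollectI conjI full subsetI)
    fix t assume t: "t \<in> PiE {..<n} (part W)"
    have "n < card W" using W by simp
    then obtain w where w: "w \<in> W" "full (W - {w})" "t \<in> PiE {..<n} (part (W - {w}))"
      using transversal_remove[OF full _ t] by metis
    have "g (W - {w}) \<noteq> 0"
      by (rule facet_cycle_propagate[OF W g g_cyc v(1) gv w(1,2)])
    with g w(3) show "t \<in> T" by (auto simp: cell_sets_def)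
  qed (use W in simp)
  define c where "c = f \<tau>\<^sub>0 / orient W v"
  define h where "h \<upsilon> = (if \<upsilon> = W then c else 0)" for \<upsilon>
  have bdh: "bd (Suc i) h \<tau> = inc (Suc i) \<tau> W * c" for \<tau>
  proof -
    have "bd (Suc i) h \<tau> = (\<Sum>\<upsilon>\<in>X (Suc (Suc i)). if \<upsilon> = W then inc (Suc i) \<tau> W * c else 0)"
      unfolding incidence_boundary_def h_def by (intro sum.cong) auto
    thus ?thesis using Wcell finite_X[of "Suc (Suc i)"] by (simp add: sum.delta')
  qed
  define g' where "g' \<tau> = (if \<tau> \<in> cell_sets T i then f \<tau> - bd (Suc i) h \<tau> else 0)" for \<tau>
  have g': "\<tau> \<in> cell_sets T i \<and> (\<exists>u\<in>W. \<tau> = W - {u})" if "g' \<tau> \<noteq> 0" for \<tau>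
  proof -
    have \<tau>: "\<tau> \<in> cell_sets T i" and "f \<tau> \<noteq> 0 \<or> inc (Suc i) \<tau> W \<noteq> (0 :: 'k)"
      using that by (auto simp: g'_def bdh split: if_splits)
    hence "\<tau> \<subseteq> W" using f[OF \<tau>] by (auto elim!: inc_nonzero)
    thus ?thesis using facet \<tau> by blast
  qed
  have g'_cyc: "\<forall>\<sigma>\<in>X i. bd i g' \<sigma> = 0"
  proof
    fix \<sigma> assume \<sigma>: "\<sigma> \<in> X i"
    have "bd i g' \<sigma> = (\<Sum>\<tau>\<in>X (Suc i). inc i \<sigma> \<tau> * f \<tau> - inc i \<sigma> \<tau> * inc (Suc i) \<tau> W * c)"
      unfolding incidence_boundary_def by (intro sum.cong) (auto simp: g'_def bdh algebra_simps)
    also have "\<dots> = bd i f \<sigma> - (\<Sum>\<tau>\<in>X (Suc i). inc i \<sigma> \<tau> * inc (Suc i) \<tau> W) * c"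
      by (simp add: incidence_boundary_def sum_subtractf sum_distrib_right)
    also have "\<dots> = 0" using bd_bd[OF \<sigma>, of W, where 'k = 'k] Wcell cyc \<sigma> by simp
    finally show "bd i g' \<sigma> = 0" .
  qed
  have "g' (W - {v}) = 0"
    using v nz by (simp add: g'_def bdh c_def inc_facet[OF fin v(1)] orient_nonzero)
  hence "g' \<tau> = 0" for \<tau>
    using g'[of \<tau>] facet_cycle_propagate[OF W g' g'_cyc _ _ v(1) fullv] by blast
  hence "\<forall>\<tau>\<in>X (Suc i). f \<tau> = bd (Suc i) h \<tau>"
    by (metis X_simps(2) eq_iff_diff_eq_0 g'_def)
  thus ?thesis by (intro exI[of _ h]) (auto simp: h_def)
qed

lemma linear_labelled_complex:
  "linear_labelled_complex X label (inc :: nat \<Rightarrow> 'a set \<Rightarrow> 'a set \<Rightarrow> 'k::field) verts n"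
proof
  fix i \<sigma> \<tau>
  assume "\<sigma> \<in> X i" and \<tau>: "\<tau> \<in> X (Suc i)" and nz: "inc i \<sigma> \<tau> \<noteq> (0 :: 'k)"
  have "finite \<tau>" using \<tau> cell_sets_finite by simp
  moreover have "\<sigma> \<subseteq> \<tau>"
    using \<open>\<sigma> \<in> X i\<close> nz by (cases i) (auto elim!: inc_nonzero)
  ultimately show "mon_dvd (label \<sigma>) (label \<tau>)"
    by (simp add: mon_dvd_label_iff keys_label finite_subset)
next
  fix i and \<tau> :: "'a set"
  show "finite (X i)" by (rule finite_X)
  show "keys (label \<tau>) \<subseteq> verts" if "\<tau> \<in> X i"
    using that by (cases i) (auto simp: cell_sets_finite keys_label dest!: cell_sets_full simp: full_def)
  show "mon_degree (label \<tau>) = n + i" if "\<tau> \<in> X (Suc i)"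
    using that by (simp add: mon_degree_label cell_sets_finite cell_sets_card)
  show "card (X 0) = 1" by simp
  show "label \<tau> = 0" if "\<tau> \<in> X 0" using that by (simp add: label_def)
next
  fix \<sigma> \<upsilon> i
  assume "\<sigma> \<in> X i" "\<upsilon> \<in> X (Suc (Suc i))"
  thus "(\<Sum>\<tau>\<in>X (Suc i). inc i \<sigma> \<tau> * inc (Suc i) \<tau> \<upsilon>) = (0 :: 'k)" by (rule bd_bd)
next
  fix i m \<tau> and f :: "'a set \<Rightarrow> 'k"
  assume f: "\<forall>\<tau>\<in>X (Suc i). f \<tau> \<noteq> 0 \<longrightarrow> label \<tau> = m" "\<forall>\<sigma>\<in>X i. bd i f \<sigma> = 0" and \<tau>: "\<tau> \<in> X (Suc i)"
  show "f \<tau> = 0"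
  proof (rule ccontr)
    assume nz: "f \<tau> \<noteq> 0"
    have "\<forall>\<tau>'\<in>X (Suc i). f \<tau>' \<noteq> 0 \<longrightarrow> \<tau>' = \<tau>"
      using f(1) \<tau> nz by (metis X_simps(2) cell_sets_finite label_eq_iff)
    from bd_single_nonzero[OF \<tau> nz this] f(2) show False by blast
  qed
next
  fix i m and f :: "'a set \<Rightarrow> 'k"
  assume dvd: "\<forall>\<tau>\<in>X (Suc i). f \<tau> \<noteq> 0 \<longrightarrow> mon_dvd (label \<tau>) m" and deg: "mon_degree m = Suc (n + i)"
    and cyc: "\<forall>\<sigma>\<in>X i. bd i f \<sigma> = 0"
  \<comment> \<open>A priori m may involve variables outside \<open>verts\<close>; if f is non-zero,
    the cardinality bounds below exclude this.\<close>
  let ?W = "keys m \<inter> verts"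
  have sub: "\<tau> \<subseteq> ?W" if "\<tau> \<in> cell_sets T i" "f \<tau> \<noteq> 0" for \<tau>
  proof -
    have "mon_dvd (label \<tau>) m" using dvd that by simp
    thus ?thesis
      using cell_sets_full[OF that(1)] mon_dvd_label_iff[OF cell_sets_finite[OF that(1)]]
      by (simp add: full_def)
  qed
  have le: "card (keys m) \<le> mon_degree m"
    unfolding mon_degree_def using sum_mono[of "keys m" "\<lambda>_. 1" "Poly_Mapping.lookup m"]
    by (simp add: in_keys_iff Suc_leI)
  show "\<exists>h. (\<forall>\<upsilon>\<in>X (Suc (Suc i)). h \<upsilon> \<noteq> 0 \<longrightarrow> label \<upsilon> = m) \<and> (\<forall>\<tau>\<in>X (Suc i). f \<tau> = bd (Suc i) h \<tau>)"
  proof (cases "\<exists>\<tau>\<in>cell_sets T i. f \<tau> \<noteq> 0")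
    case True
    then obtain \<tau>\<^sub>0 where \<tau>\<^sub>0: "\<tau>\<^sub>0 \<in> cell_sets T i" "f \<tau>\<^sub>0 \<noteq> 0" by blast
    \<comment> \<open>If W were the cell itself, that cell would be the whole support of f, and a
      single cell is never a cycle.\<close>
    have ne: "?W \<noteq> \<tau>\<^sub>0"
    proof
      assume eq: "?W = \<tau>\<^sub>0"
      have "\<forall>\<tau>'\<in>X (Suc i). f \<tau>' \<noteq> 0 \<longrightarrow> \<tau>' = \<tau>\<^sub>0"
      proof (intro ballI impI)
        fix \<tau>' assume "\<tau>' \<in> X (Suc i)" "f \<tau>' \<noteq> 0"
        hence \<tau>': "\<tau>' \<in> cell_sets T i" "\<tau>' \<subseteq> \<tau>\<^sub>0" using sub eq by simp_all
        show "\<tau>' = \<tau>\<^sub>0"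
          by (rule card_subset_eq[OF cell_sets_finite[OF \<tau>\<^sub>0(1)] \<tau>'(2)])
            (simp add: cell_sets_card[OF \<tau>'(1)] cell_sets_card[OF \<tau>\<^sub>0(1)])
      qed
      from bd_single_nonzero[OF _ \<tau>\<^sub>0(2) this] \<tau>\<^sub>0(1) cyc show False by simp
    qed
    hence "card \<tau>\<^sub>0 < card ?W"
      using sub[OF \<tau>\<^sub>0] by (intro psubset_card_mono) auto
    \<comment> \<open>The chain n + i + 1 \<le> card W \<le> card (keys m) \<le> degree of m = n + i
      + 1 collapses, so m is squarefree with support W.\<close>
    hence ge: "Suc (n + i) \<le> card ?W" using cell_sets_card[OF \<tau>\<^sub>0(1)] by simp
    moreover have "card ?W \<le> card (keys m)" by (rule card_mono) auto
    ultimately have card: "card ?W = Suc (n + i)" "card (keys m) = mon_degree m"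
      using le deg by auto
    hence W: "?W = keys m" using deg by (intro card_subset_eq) auto
    have m: "label ?W = m" unfolding W using card by (intro label_keys) simp
    have "\<exists>h. (\<forall>\<upsilon>\<in>X (Suc (Suc i)). h \<upsilon> \<noteq> 0 \<longrightarrow> \<upsilon> = ?W) \<and>
        (\<forall>\<tau>\<in>X (Suc i). f \<tau> = bd (Suc i) h \<tau>)"
      by (rule facet_cycle_boundary[OF Int_lower2 card(1) sub cyc \<tau>\<^sub>0])
    then obtain h where h: "\<forall>\<upsilon>\<in>X (Suc (Suc i)). h \<upsilon> \<noteq> 0 \<longrightarrow> \<upsilon> = ?W"
      "\<forall>\<tau>\<in>X (Suc i). f \<tau> = bd (Suc i) h \<tau>" by (elim exE conjE)
    have "\<forall>\<upsilon>\<in>X (Suc (Suc i)). h \<upsilon> \<noteq> 0 \<longrightarrow> label \<upsilon> = m"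
      using h(1) m by metis
    with h(2) show ?thesis by (intro exI[of _ h] conjI)
  next
    case False
    thus ?thesis by (intro exI[of _ "\<lambda>_. 0"]) (auto simp: incidence_boundary_def)
  qed
qed

end

section \<open>Linear resolutions as exact linear strands\<close>

lemma coeff_mult_0:
  fixes p q :: "('a, 'k::field) mpoly"
  shows "coeff (p * q) 0 = coeff p 0 * coeff q 0"
proof -
  have eq: "k + l = (0 :: 'a \<Rightarrow>\<^sub>0 nat) \<longleftrightarrow> k = 0 \<and> l = 0" for k l
    by (metis add_is_0 mon_degree_eq_0_iff mon_degree_plus add.right_neutral)
  have "coeff (p * q) 0 = (\<Sum>k. coeff p k * coeff q 0 when 0 = k)"
    unfolding lookup_mult
  proof (rule Sum_any.cong)
    fix k
    show "coeff p k * (\<Sum>l. coeff q l when 0 = k + l) = (coeff p k * coeff q 0 when 0 = k)"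
      by (cases "k = 0") (simp_all add: eq)
  qed
  thus ?thesis by simp
qed

lemma homogeneous_0_eq_0: "homogeneous 0 p \<Longrightarrow> coeff p 0 = 0 \<Longrightarrow> p = 0"
  by (rule poly_mapping_eqI) (metis homogeneousD lookup_zero mon_degree_eq_0_iff of_nat_0_eq_iff)

lemma poly_mapping_sum_monom: "p = (\<Sum>m\<in>keys p. monom m (coeff p m))"
  by (rule poly_mapping_eqI)
    (simp add: lookup_sum lookup_single when_def sum.delta in_keys_iff)

lemma mon_degree_1D:
  assumes "mon_degree m = 1"
  obtains a where "a \<in> keys m" "m = Poly_Mapping.single a 1"
proof -
  have "m \<noteq> 0" using assms by (auto simp: mon_degree_def)
  then obtain a where a: "a \<in> keys m" by (metis in_keys_iff lookup_zero poly_mapping_eqI)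
  have "m = Poly_Mapping.single a 1 + (m - Poly_Mapping.single a 1)"
    using a by (intro poly_mapping_eqI) (auto simp: lookup_add lookup_minus lookup_single when_def in_keys_iff)
  moreover have "mon_degree (Poly_Mapping.single a 1) = 1" by (simp add: mon_degree_def)
  ultimately have "m - Poly_Mapping.single a 1 = 0"
    using assms by (metis add_cancel_right_right mon_degree_eq_0_iff mon_degree_plus)
  with \<open>m = _\<close> have "m = Poly_Mapping.single a 1" by (metis add.right_neutral)
  thus ?thesis using a that by blast
qed

text \<open>Each monomial of a linear form is a constant times a variable from V. Hence a resolution
  read off from a linear strand is automatically minimal.\<close>

lemma linear_in_irrelevant_ideal:
  assumes p: "(p :: ('a, 'k::field) mpoly) \<in> polys V" "homogeneous 1 p"
  shows "p \<in> irrelevant_ideal V"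
proof -
  interpret R: cring "mpoly_ring V :: ('a, 'k) mpoly ring" by (rule cring_mpoly_ring)
  have V: "mvar ` V \<subseteq> (polys V :: ('a, 'k) mpoly set)"
    by (auto simp: mvar_def mem_polys lookup_single when_def split: if_splits)
  interpret I: ideal "irrelevant_ideal V" "mpoly_ring V :: ('a, 'k) mpoly ring"
    unfolding irrelevant_ideal_def by (rule R.genideal_ideal[OF V])
  have mon: "monom m (coeff p m) \<in> irrelevant_ideal V" if "m \<in> keys p" for m
  proof -
    have "mon_degree m = 1" using p(2) that by (auto simp: homogeneous_def)
    then obtain a where a: "a \<in> keys m" "m = Poly_Mapping.single a 1" by (rule mon_degree_1D)
    have "a \<in> V" using p(1) that a(1) unfolding mem_polys by (metis in_keys_iff subsetD)
    hence "(mvar a :: ('a, 'k) mpoly) \<in> irrelevant_ideal V"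
      using R.genideal_self[OF V] by (auto simp: irrelevant_ideal_def)
    moreover have "monom 0 (coeff p m) \<in> polys V"
      by (auto simp: mem_polys lookup_single when_def split: if_splits)
    ultimately have "monom 0 (coeff p m) * mvar a \<in> irrelevant_ideal V"
      using I.I_l_closed[of "mvar a" "monom 0 (coeff p m)"] by (simp add: mpoly_ring_simps)
    thus ?thesis unfolding a(2) by (simp add: mvar_def mult_single)
  qed
  have "(\<Sum>m\<in>S. monom m (coeff p m)) \<in> irrelevant_ideal V" if "S \<subseteq> keys p" for S
  proof -
    have "finite S" by (rule finite_subset[OF that finite_keys])
    from this that show ?thesis
    proof (induction S rule: finite_induct)
      case empty
      thus ?case using I.zero_closed by (simp add: mpoly_ring_simps)
    next
      case (insert m S)
      thus ?case using I.a_closed[of "monom m (coeff p m)"] mon by (simp add: mpoly_ring_simps)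
    qed
  qed
  from this[OF order_refl] show ?thesis unfolding poly_mapping_sum_monom[of p, symmetric] .
qed

lemma unit_vec_free_module: "unit_vec r j \<in> free_module V r"
  by (auto simp: free_module_def unit_vec_def polys_zero polys_one)

lemma mult_unit_vec: "(M :: 'a::comm_ring_1 mat) \<in> carrier_mat r s \<Longrightarrow> j < s \<Longrightarrow> M *\<^sub>v unit_vec s j = col M j"
  by (intro eq_vecI) (auto simp: scalar_prod_right_unit)

section \<open>Translation between linear strands and linear resolutions\<close>

definition augmentation_image ::
  "'a set \<Rightarrow> (nat \<Rightarrow> nat) \<Rightarrow> (nat \<Rightarrow> ('a, 'k::field) mpoly mat) \<Rightarrow> ('a, 'k) mpoly set" where
  "augmentation_image V r E = (\<lambda>v. (E 0 *\<^sub>v v) $ 0) ` free_module V (r 1)"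

text \<open>The entries of \<open>E 0\<close> are combinations of those of \<open>E' 0\<close>, and
  all of them have degree n; comparing components of degree n leaves only the constant parts of the
  coefficients.\<close>

lemma linear_strand_base:
  assumes F: "linear_strand V n r E" and G: "linear_strand V n r' E'"
    and im: "augmentation_image V r E \<subseteq> augmentation_image V r' E'"
  shows "\<exists>P\<in>carrier_mat (r' 1) (r 1). hom_mat 0 P \<and> E 0 = E' 0 * P"
proof -
  interpret F: linear_strand V n r E by fact
  interpret G: linear_strand V n r' E' by fact
  have E0: "E 0 \<in> carrier_mat 1 (r 1)" "E' 0 \<in> carrier_mat 1 (r' 1)"
    using F.E_carrier[of 0] G.E_carrier[of 0] by (simp_all add: F.r0 G.r0)
  show ?thesis
  proof (rule factor_mat_columns[OF E0])
    fix j assume j: "j < r 1"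
    have "(E 0 *\<^sub>v unit_vec (r 1) j) $ 0 \<in> augmentation_image V r E"
      unfolding augmentation_image_def by (intro imageI unit_vec_free_module)
    hence "col (E 0) j $ 0 \<in> augmentation_image V r' E'"
      using im unfolding mult_unit_vec[OF E0(1) j] by (rule rev_subsetD)
    then obtain w where w: "w \<in> free_module V (r' 1)" "col (E 0) j $ 0 = (E' 0 *\<^sub>v w) $ 0"
      by (auto simp: augmentation_image_def)
    note wc = free_module_carrier[OF w(1)]
    have col: "col (E 0) j = E' 0 *\<^sub>v w"
      by (rule eq_vecI) (use w(2) E0 in auto)
    have "col (E 0) j = map_vec (hcomp n) (col (E 0) j)"
      using F.E_0_hom E0 j by (intro map_hcomp_hom_vec[symmetric] hom_vec_col) auto
    also have "\<dots> = E' 0 *\<^sub>v map_vec (hcomp 0) w"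
      unfolding col using map_hcomp_mult_mat_vec[OF G.E_0_hom, of w 0] wc E0 by simp
    finally have "col (E 0) j = E' 0 *\<^sub>v map_vec (hcomp 0) w" .
    moreover have "hom_vec 0 (map_vec (hcomp 0) w)" by (simp add: hom_vec_def homogeneous_hcomp)
    ultimately show "\<exists>c\<in>carrier_vec (r' 1). hom_vec 0 c \<and> col (E 0) j = E' 0 *\<^sub>v c"
      using wc by (intro bexI[of _ "map_vec (hcomp 0) w"]) auto
  qed
qed

text \<open>Putting S in front turns the generators g into the first matrix. By exactness a constant
  vector in a kernel is some \<open>D i\<close> applied to a vector, so minimality kills its
  constant terms and with them the vector. A linear vector in a kernel has a preimage whose degree-0
  component is already a preimage.\<close>

lemma linear_strand_of_resolution:
  fixes D :: "nat \<Rightarrow> ('a, 'k::field) mpoly mat"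
  assumes res: "minimal_graded_free_resolution V I b d g D"
    and lin: "\<And>i j. j < b i \<Longrightarrow> d i j = int (n + i)"
  defines "r \<equiv> case_nat 1 b" and "E \<equiv> case_nat (mat 1 (b 0) (\<lambda>(_, j). g $ j)) D"
  shows "linear_strand V (int n) r E" "exact_complex V r E" "augmentation_image V r E = I"
proof -
  note res' = res[unfolded minimal_graded_free_resolution_def]
  have r [simp]: "r 0 = 1" "r (Suc i) = b i" for i by (simp_all add: r_def)
  have E [simp]: "E 0 = mat 1 (b 0) (\<lambda>(_, j). g $ j)" "E (Suc i) = D i" for i by (simp_all add: E_def)
  have g: "g \<in> free_module V (b 0)" using res' by blast
  have D: "D i \<in> carrier_mat (b i) (b (Suc i))" for i using res' by blast
  have Dirr: "D i $$ (s, t) \<in> irrelevant_ideal V" "homogeneous 1 (D i $$ (s, t))"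
    if "s < b i" "t < b (Suc i)" for i s t
  proof -
    have "homogeneous (d (Suc i) t - d i s) (D i $$ (s, t))" using res' that by blast
    thus "homogeneous 1 (D i $$ (s, t))" using lin[of t "Suc i"] lin[of s i] that by simp
    show "D i $$ (s, t) \<in> irrelevant_ideal V" using res' that by blast
  qed
  have E0v: "E 0 *\<^sub>v v = vec 1 (\<lambda>_. g \<bullet> v)" if "v \<in> carrier_vec (b 0)" for v
    using that g by (intro eq_vecI) (auto simp: free_module_def scalar_prod_def intro!: sum.cong)
  have E0v0: "E 0 *\<^sub>v v = 0\<^sub>v 1 \<longleftrightarrow> g \<bullet> v = 0" if "v \<in> carrier_vec (b 0)" for v
    unfolding E0v[OF that] by (auto simp: vec_eq_iff)
  show ex: "exact_complex V r E"
    unfolding exact_complex_def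
  proof
    fix i
    show "{v \<in> free_module V (r (Suc i)). E i *\<^sub>v v = 0\<^sub>v (r i)} =
        (\<lambda>w. E (Suc i) *\<^sub>v w) ` free_module V (r (Suc (Suc i)))"
    proof (cases i)
      case 0
      have "{v \<in> free_module V (b 0). E 0 *\<^sub>v v = 0\<^sub>v 1} = {v \<in> free_module V (b 0). g \<bullet> v = 0}"
        using E0v0 free_module_carrier by blast
      thus ?thesis using res' 0 by (simp del: E(1))
    next
      case (Suc k)
      thus ?thesis using res' by simp
    qed
  qed
  show "augmentation_image V r E = I"
  proof -
    have "augmentation_image V r E = (\<lambda>v. g \<bullet> v) ` free_module V (b 0)"
      unfolding augmentation_image_def
    proof (rule image_cong)
      fix v :: "('a, 'k) mpoly vec" assume "v \<in> free_module V (b 0)"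
      thus "(E 0 *\<^sub>v v) $ 0 = g \<bullet> v" using E0v[OF free_module_carrier] by (simp del: E(1))
    qed simp
    thus ?thesis using res' by simp
  qed
  have carrier: "E i \<in> carrier_mat (r i) (r (Suc i))" for i
    by (cases i) (simp_all add: D)
  have polys: "polys_mat V (E i)" for i
  proof (cases i)
    case 0
    thus ?thesis using g by (auto simp: polys_mat_def free_module_def)
  next
    case (Suc k)
    have "irrelevant_ideal V \<subseteq> (polys V :: ('a, 'k) mpoly set)"
    proof -
      interpret R: cring "mpoly_ring V :: ('a, 'k) mpoly ring" by (rule cring_mpoly_ring)
      have "mvar ` V \<subseteq> (polys V :: ('a, 'k) mpoly set)"
        by (auto simp: mvar_def mem_polys lookup_single when_def split: if_splits)
      from R.genideal_ideal[OF this] show ?thesis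
        unfolding irrelevant_ideal_def by (meson additive_subgroup.a_subset ideal.axioms(1))
    qed
    thus ?thesis using Dirr D[of k] Suc by (auto simp: polys_mat_def)
  qed
  have ker: "E i *\<^sub>v v = 0\<^sub>v (r i) \<Longrightarrow> v \<in> free_module V (r (Suc i)) \<Longrightarrow>
      \<exists>w\<in>free_module V (r (Suc (Suc i))). v = E (Suc i) *\<^sub>v w" for i v
    using ex unfolding exact_complex_def by blast
  have EE: "E i *\<^sub>v (E (Suc i) *\<^sub>v w) = 0\<^sub>v (r i)" if "w \<in> free_module V (r (Suc (Suc i)))" for i w
    using ex that unfolding exact_complex_def by blast
  show "linear_strand V (int n) r E"
  proof
    show "r 0 = 1" by simp
    show "E i \<in> carrier_mat (r i) (r (Suc i))" for i by (rule carrier)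
    show "polys_mat V (E i)" for i by (rule polys)
    show "hom_mat (int n) (E 0)"
      using res' lin[of _ 0] by (auto simp: hom_mat_def)
    show hom1: "hom_mat 1 (E (Suc i))" for i
      using Dirr(2) D[of i] by (auto simp: hom_mat_def)
    show "E i * E (Suc i) = 0\<^sub>m (r i) (r (Suc (Suc i)))" for i
    proof (rule mat_col_eqI)
      fix j assume "j < dim_col (0\<^sub>m (r i) (r (Suc (Suc i))) :: ('a, 'k) mpoly mat)"
      hence j: "j < r (Suc (Suc i))" by simp
      have "col (E i * E (Suc i)) j = E i *\<^sub>v (E (Suc i) *\<^sub>v unit_vec (r (Suc (Suc i))) j)"
        using col_mult2[OF carrier carrier j] mult_unit_vec[OF carrier j] by simp
      thus "col (E i * E (Suc i)) j = col (0\<^sub>m (r i) (r (Suc (Suc i)))) j"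
        using EE[OF unit_vec_free_module] j by simp
    qed (use carrier[of i] carrier[of "Suc i"] in auto)
  next
    fix c i assume c: "c \<in> carrier_vec (r (Suc i))" "hom_vec 0 c" and 0: "E i *\<^sub>v c = 0\<^sub>v (r i)"
    obtain w where w: "w \<in> free_module V (b (Suc i))" "c = D i *\<^sub>v w"
      using ker[OF 0 hom_vec_0_free_module[OF c(2,1)]] by auto
    show "c = 0\<^sub>v (r (Suc i))"
    proof (rule eq_vecI)
      fix j assume "j < dim_vec (0\<^sub>v (r (Suc i)) :: ('a, 'k) mpoly vec)"
      hence j: "j < b i" by simp
      have "coeff (c $ j) 0 = (\<Sum>t = 0..<dim_vec w. coeff (D i $$ (j, t)) 0 * coeff (w $ t) 0)"
        using j D[of i] free_module_carrier[OF w(1)]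
        by (simp add: w(2) scalar_prod_def lookup_sum coeff_mult_0)
      also have "\<dots> = 0"
        using Dirr(1)[OF j] free_module_carrier[OF w(1)]
        by (intro sum.neutral) (auto simp: irrelevant_ideal_coeff_0[of _ V])
      finally show "c $ j = 0\<^sub>v (r (Suc i)) $ j"
        using c j by (auto simp: hom_vec_def intro: homogeneous_0_eq_0)
    qed (use c in simp)
  next
    fix v i assume v: "v \<in> free_module V (r (Suc i))" "hom_vec 1 v" "E i *\<^sub>v v = 0\<^sub>v (r i)"
    obtain w where w: "w \<in> free_module V (b (Suc i))" "v = D i *\<^sub>v w" using ker[OF v(3,1)] by auto
    note wc = free_module_carrier[OF w(1)]
    have hom1: "hom_mat 1 (D i)" using Dirr(2) D[of i] by (auto simp: hom_mat_def)
    have "v = map_vec (hcomp 1) v" by (rule map_hcomp_hom_vec[OF v(2), symmetric])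
    also have "\<dots> = D i *\<^sub>v map_vec (hcomp 0) w"
      unfolding w(2) using map_hcomp_mult_mat_vec[OF hom1, of w 0] D[of i] wc by simp
    finally have "v = D i *\<^sub>v map_vec (hcomp 0) w" .
    moreover have "hom_vec 0 (map_vec (hcomp 0) w)" by (simp add: hom_vec_def homogeneous_hcomp)
    ultimately show "\<exists>c\<in>carrier_vec (r (Suc (Suc i))). hom_vec 0 c \<and> v = E (Suc i) *\<^sub>v c"
      using wc by (intro bexI[of _ "map_vec (hcomp 0) w"]) auto
  qed
qed

lemma resolution_of_linear_strand:
  fixes E :: "nat \<Rightarrow> ('a, 'k::field) mpoly mat"
  assumes F: "linear_strand V (int n) r E" and ex: "exact_complex V r E"
  shows "has_linear_resolution V n (augmentation_image V r E)"
proof -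
  interpret linear_strand V "int n" r E by fact
  define b where "b i = r (Suc i)" for i
  define g where "g = row (E 0) 0"
  define D where "D i = E (Suc i)" for i
  have E0: "E 0 \<in> carrier_mat 1 (r 1)" using E_carrier[of 0] by (simp add: r0)
  have D: "D i \<in> carrier_mat (b i) (b (Suc i))" for i by (simp add: D_def b_def E_carrier)
  have gv: "(E 0 *\<^sub>v v) $ 0 = g \<bullet> v" for v using E0 by (simp add: g_def)
  have E0v0: "E 0 *\<^sub>v v = 0\<^sub>v (r 0) \<longleftrightarrow> g \<bullet> v = 0" for v
    using E0 by (auto simp: vec_eq_iff r0 gv[symmetric] simp del: index_mult_mat_vec)
  have "minimal_graded_free_resolution V (augmentation_image V r E) b (\<lambda>i j. int (n + i)) g D"
    unfolding minimal_graded_free_resolution_def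
  proof (intro conjI allI impI)
    show "g \<in> free_module V (b 0)"
      using E_polys[of 0] E0 by (auto simp: g_def b_def free_module_def polys_mat_def intro!: carrier_vecI)
    show "homogeneous (int (n + 0)) (g $ j)" if "j < b 0" for j
      using E_0_hom E0 that by (auto simp: g_def b_def hom_mat_def)
    show "D i \<in> carrier_mat (b i) (b (Suc i))" for i by (rule D)
    fix i s t assume st: "s < b i" "t < b (Suc i)"
    have hom: "homogeneous 1 (D i $$ (s, t))"
      using E_Suc_hom[of i] D[of i] st by (auto simp: hom_mat_def D_def)
    thus "homogeneous (int (n + Suc i) - int (n + i)) (D i $$ (s, t))" by simp
    show "D i $$ (s, t) \<in> irrelevant_ideal V"
      by (rule linear_in_irrelevant_ideal[OF _ hom])
        (use E_polys[of "Suc i"] D[of i] st in \<open>auto simp: polys_mat_def D_def\<close>)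
  next
    show "(\<lambda>v. g \<bullet> v) ` free_module V (b 0) = augmentation_image V r E"
      by (simp add: augmentation_image_def gv b_def)
    show "{v \<in> free_module V (b 0). g \<bullet> v = 0} = (\<lambda>w. D 0 *\<^sub>v w) ` free_module V (b 1)"
      using ex[unfolded exact_complex_def, rule_format, of 0] by (simp add: E0v0 b_def D_def)
    show "{v \<in> free_module V (b (Suc i)). D i *\<^sub>v v = 0\<^sub>v (b i)} =
        (\<lambda>w. D (Suc i) *\<^sub>v w) ` free_module V (b (Suc (Suc i)))" for i
      using ex[unfolded exact_complex_def, rule_format, of "Suc i"] by (simp add: b_def D_def)
  qed
  thus ?thesis unfolding has_linear_resolution_def by blast
qed

theorem has_linear_resolution_iff_exact:
  assumes G: "linear_strand V (int n) r E"
  shows "has_linear_resolution V n (augmentation_image V r E) \<longleftrightarrow> exact_complex V r E"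
proof
  assume "has_linear_resolution V n (augmentation_image V r E)"
  then obtain b d g D where res: "minimal_graded_free_resolution V (augmentation_image V r E) b d g D"
    "\<forall>i. \<forall>j<b i. d i j = int (n + i)"
    unfolding has_linear_resolution_def by blast
  note F = linear_strand_of_resolution[OF res(1) res(2)[rule_format]]
  show "exact_complex V r E"
    by (rule linear_strand_exact_transfer[OF F(1) G linear_strand_base[OF F(1) G]
          linear_strand_base[OF G F(1)] F(2)]) (simp_all only: F(3) order_refl)
qed (rule resolution_of_linear_strand[OF G])

section \<open>Cellular chains\<close>

context rainbow
begin

section \<open>Dictionary between cells and vertex sets\<close>

lemma Union_part: "W \<subseteq> verts \<Longrightarrow> (\<Union>i<n. part W i) = W"
  by (auto simp: part_def verts_def)

lemma part_eq_iff: "W \<subseteq> verts \<Longrightarrow> W' \<subseteq> verts \<Longrightarrow> part W = part W' \<longleftrightarrow> W = W'"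
  by (metis Union_part)

lemma card_part_sum:
  assumes "W \<subseteq> verts" "I \<subseteq> {..<n}"
  shows "(\<Sum>i\<in>I. card (part W i)) = card (\<Union>i\<in>I. part W i)"
proof (rule card_UN_disjoint[symmetric])
  show "finite I" using assms finite_subset by blast
  show "\<forall>i\<in>I. finite (part W i)" using assms finite_A by (auto simp: part_def)
  show "\<forall>i\<in>I. \<forall>j\<in>I. i \<noteq> j \<longrightarrow> part W i \<inter> part W j = {}"
  proof (intro ballI impI)
    fix i j assume "i \<in> I" "j \<in> I" "i \<noteq> j"
    hence "A i \<inter> A j = {}" using disjoint_A assms(2) by (auto simp: disjoint_family_on_def)
    thus "part W i \<inter> part W j = {}" using \<open>i \<in> I\<close> \<open>j \<in> I\<close> assms(2) by (auto simp: part_def)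
  qed
qed

lemma cell_dim_part: "full W \<Longrightarrow> cell_dim n (part W) = int (card W) - int n"
  using card_part_sum[of W "{..<n}"] Union_part[of W]
  by (simp add: cell_dim_def full_def flip: of_nat_sum)

lemma cell_complex_eq: "cell_complex n A U = part ` {W. full W \<and> PiE {..<n} (part W) \<subseteq> U}"
proof (intro equalityI subsetI)
  fix R assume R: "R \<in> cell_complex n A U"
  hence R': "R \<in> extensional {..<n}" "\<And>i. i < n \<Longrightarrow> R i \<subseteq> A i \<and> R i \<noteq> {}" "PiE {..<n} R \<subseteq> U"
    by (auto simp: cell_complex_def PiE_iff)
  let ?W = "\<Union>i<n. R i"
  have WV: "?W \<subseteq> verts" using R'(2) by (fastforce simp: verts_def)
  have part: "part ?W = R"
  proof (rule extensionalityI[OF _ R'(1)])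
    fix i assume "i \<in> {..<n}"
    hence i: "i < n" by simp
    have "v \<in> R i" if "v \<in> R j" "j < n" "v \<in> A i" for v j
      using R'(2)[OF that(2)] that i ix_eq[of i v] ix_eq[of j v] by auto
    thus "part ?W i = R i" using R'(2)[OF i] i by (auto simp: part_def)
  qed (simp add: part_def)
  hence "full ?W" using R'(2) full_iff_part[OF WV] by simp
  thus "R \<in> part ` {W. full W \<and> PiE {..<n} (part W) \<subseteq> U}"
    using part R'(3) by (intro image_eqI[of _ _ ?W]) auto
next
  fix R assume "R \<in> part ` {W. full W \<and> PiE {..<n} (part W) \<subseteq> U}"
  then obtain W where W: "full W" "PiE {..<n} (part W) \<subseteq> U" "R = part W" by blast
  have "part W i \<noteq> {}" if "i < n" for i
    using W(1) full_iff_part[of W] that by (simp add: full_def)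
  thus "R \<in> cell_complex n A U"
    using W by (auto simp: cell_complex_def PiE_iff part_def)
qed

definition cell :: "'a set \<Rightarrow> (nat \<Rightarrow> 'a set) option" where
  "cell W = Some (part W)"

lemma cell_eq_iff: "full W \<Longrightarrow> full W' \<Longrightarrow> cell W = cell W' \<longleftrightarrow> W = W'"
  by (simp add: cell_def part_eq_iff full_def)

lemma cells_of_dim_eq: "cells_of_dim n A U (int q) = cell ` cell_sets U q"
  by (auto simp: cells_of_dim_def cell_complex_eq cell_sets_def cell_dim_part cell_def image_iff)

lemma finite_cell_sets: "finite (cell_sets U q)"
  by (rule finite_subset[of _ "Pow verts"]) (auto simp: cell_sets_def full_def finite_verts)

text \<open>The two exponents differ by 2 * \<open>ix v\<close>: one \<open>ix v\<close> arises
  because each earlier factor is counted with one vertex fewer, the other is the summand in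
  \<open>orient\<close>. Non-empty factors make the truncated subtraction exact.\<close>

lemma orient_part:
  assumes W: "full W" "v \<in> W"
  shows "(- 1) ^ ((\<Sum>j<ix v. card (part W j) - 1) + card {w \<in> part W (ix v). pos w < pos v}) =
    (orient W v :: 'k::field)"
proof -
  let ?i = "ix v" and ?P = "{w \<in> part W (ix v). pos w < pos v}"
  have WV: "W \<subseteq> verts" using W by (simp add: full_def)
  have i: "?i < n" using W WV ix_verts by blast
  note fin = full_finite[OF W(1)]
  have before: "before W v = (\<Union>j<?i. part W j) \<union> ?P"
    using WV i by (auto simp: before_def part_def mem_A_iff ix_verts)
  have disj: "(\<Union>j<?i. part W j) \<inter> ?P = {}"
    using WV i by (auto simp: part_def mem_A_iff)
  have fins: "finite (\<Union>j<?i. part W j)" "finite ?P"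
    using fin i by (auto simp: part_def intro: finite_subset[of _ W])
  have "card (before W v) = (\<Sum>j<?i. card (part W j)) + card ?P"
    unfolding before card_Un_disjoint[OF fins disj]
    using card_part_sum[OF WV, of "{..<?i}"] i by simp
  also have "(\<Sum>j<?i. card (part W j)) = (\<Sum>j<?i. (card (part W j) - 1) + 1)"
  proof (rule sum.cong[OF refl])
    fix j assume "j \<in> {..<?i}"
    hence "part W j \<noteq> {}" "finite (part W j)"
      using W(1) full_iff_part[OF WV] i fin by (auto simp: part_def)
    hence "card (part W j) > 0" by (simp add: card_gt_0_iff)
    thus "card (part W j) = card (part W j) - 1 + 1" by simp
  qed
  also have "\<dots> = (\<Sum>j<?i. card (part W j) - 1) + ?i" by (simp only: sum.distrib) simp
  finally have "card (before W v) + ?i = ((\<Sum>j<?i. card (part W j) - 1) + card ?P) + 2 * ?i" by simp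
  thus ?thesis by (simp add: orient_def power_add)
qed

lemma full_remove_iff:
  assumes "full W" "v \<in> W"
  shows "full (W - {v}) \<longleftrightarrow> part W (ix v) \<noteq> {v}"
proof -
  have WV: "W \<subseteq> verts" using assms by (simp add: full_def)
  have v: "ix v < n" "v \<in> A (ix v)" using assms WV ix_verts by auto
  have other: "part (W - {v}) j = part W j" if "j < n" "j \<noteq> ix v" for j
    using that ix_eq by (auto simp: part_def)
  have self: "part (W - {v}) (ix v) = part W (ix v) - {v}" using v by (auto simp: part_def)
  have ne: "\<forall>j<n. part W j \<noteq> {}" using assms(1) full_iff_part[OF WV] by blast
  have "full (W - {v}) \<longleftrightarrow> (\<forall>j<n. part (W - {v}) j \<noteq> {})"
    by (rule full_iff_part) (use WV in auto)
  also have "\<dots> \<longleftrightarrow> part W (ix v) - {v} \<noteq> {}"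
    using other self ne v(1) by metis
  also have "\<dots> \<longleftrightarrow> part W (ix v) \<noteq> {v}" using ne v(1) by blast
  finally show ?thesis .
qed

text \<open>The double sum over factors and vertices collapses because a vertex determines its
  factor, and one-point factors are skipped exactly where the removal would destroy
  fullness.\<close>

lemma cell_boundary_cell:
  assumes W: "full W" "n < card W"
  shows "cell_boundary n pos x (cell W) =
    (\<Sum>v\<in>{v \<in> W. full (W - {v})}. Poly_Mapping.single (cell (W - {v})) (orient W v * x))"
proof -
  have WV: "W \<subseteq> verts" using W by (simp add: full_def)
  let ?f = "\<lambda>i v. Poly_Mapping.single (Some ((part W)(i := part W i - {v})))
    ((- 1) ^ ((\<Sum>j<i. (card (part W j) - 1)) + card {w \<in> part W i. pos w < pos v}) * x)"
  let ?S = "\<lambda>i. {v \<in> part W i. part W i \<noteq> {v}}" and ?V = "{v \<in> W. full (W - {v})}"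
  have "cell_dim n (part W) \<noteq> 0" using W by (simp add: cell_dim_part)
  hence "cell_boundary n pos x (cell W) = (\<Sum>i<n. \<Sum>v\<in>?S i. ?f i v)"
    by (simp add: cell_def)
  also have "\<dots> = (\<Sum>(i, v)\<in>(SIGMA i:{..<n}. ?S i). ?f i v)"
    by (rule sum.Sigma) (use finite_A in \<open>auto simp: part_def\<close>)
  also have "\<dots> = (\<Sum>v\<in>?V. ?f (ix v) v)"
  proof (rule sum.reindex_bij_witness[of _ "\<lambda>v. (ix v, v)" snd])
    fix iv assume "iv \<in> (SIGMA i:{..<n}. ?S i)"
    then obtain i v where iv: "iv = (i, v)" "i < n" "v \<in> part W i" "part W i \<noteq> {v}" by auto
    hence v: "v \<in> W" "ix v = i" using ix_eq by (auto simp: part_def)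
    show "(ix (snd iv), snd iv) = iv" using iv v by simp
    show "snd iv \<in> ?V" using iv v full_remove_iff[OF W(1) v(1)] by simp
    show "?f (ix (snd iv)) (snd iv) = (case iv of (i, v) \<Rightarrow> ?f i v)" using iv v by simp
  next
    fix v assume v: "v \<in> ?V"
    show "snd (ix v, v) = v" by simp
    show "(ix v, v) \<in> (SIGMA i:{..<n}. ?S i)"
      using v WV ix_verts full_remove_iff[OF W(1)] by (auto simp: part_def)
  qed
  also have "\<dots> = (\<Sum>v\<in>?V. Poly_Mapping.single (cell (W - {v})) (orient W v * x))"
  proof (rule sum.cong[OF refl])
    fix v assume v: "v \<in> ?V"
    hence "ix v < n" using WV ix_verts by blast
    hence "(part W)(ix v := part W (ix v) - {v}) = part (W - {v})"
      using ix_eq by (auto simp: part_def fun_eq_iff)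
    thus "?f (ix v) v = Poly_Mapping.single (cell (W - {v})) (orient W v * x)"
      using orient_part[OF W(1), of v, where 'k = 'b] v by (simp add: cell_def)
  qed
  finally show ?thesis .
qed

section \<open>Chains as coefficient functions on vertex sets\<close>

definition to_chain :: "(nat \<Rightarrow> 'a) set \<Rightarrow> nat \<Rightarrow> ('a set \<Rightarrow> 'k::field) \<Rightarrow> ('a, 'k) chain" where
  "to_chain U q f = (\<Sum>W\<in>cell_sets U q. Poly_Mapping.single (cell W) (f W))"

lemma lookup_to_chain:
  "W \<in> cell_sets U q \<Longrightarrow> Poly_Mapping.lookup (to_chain U q f) (cell W) = f W"
proof -
  assume W: "W \<in> cell_sets U q"
  have "Poly_Mapping.lookup (to_chain U q f) (cell W) = (\<Sum>W'\<in>cell_sets U q. if W' = W then f W' else 0)"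
    unfolding to_chain_def lookup_sum lookup_single
    by (rule sum.cong[OF refl]) (use W in \<open>auto simp: cell_eq_iff cell_sets_full when_def\<close>)
  thus ?thesis using W by (simp add: finite_cell_sets)
qed

lemma lookup_to_chain_other:
  "\<sigma> \<notin> cell ` cell_sets U q \<Longrightarrow> Poly_Mapping.lookup (to_chain U q f) \<sigma> = 0"
  unfolding to_chain_def lookup_sum lookup_single
  by (rule sum.neutral) (auto simp: when_def)

lemma to_chain_eq_iff: "to_chain U q f = to_chain U q g \<longleftrightarrow> (\<forall>W\<in>cell_sets U q. f W = g W)"
proof
  assume "to_chain U q f = to_chain U q g"
  thus "\<forall>W\<in>cell_sets U q. f W = g W" by (metis lookup_to_chain)
qed (simp add: to_chain_def)

lemma to_chain_zero: "to_chain U q (\<lambda>_. 0) = 0"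
  by (simp add: to_chain_def)

lemma to_chain_add: "to_chain U q f + to_chain U q g = to_chain U q (\<lambda>W. f W + g W)"
  by (simp add: to_chain_def sum.distrib single_add)

lemma to_chain_uminus: "- to_chain U q f = to_chain U q (\<lambda>W. - f W)"
  by (simp add: to_chain_def sum_negf single_uminus)

lemma carrier_chain_group:
  "carrier (chain_group n A U (int q) :: ('a, 'k::field) chain monoid) = range (to_chain U q)"
proof (intro equalityI subsetI)
  fix c :: "('a, 'k) chain" assume "c \<in> carrier (chain_group n A U (int q))"
  hence keys: "keys c \<subseteq> cell ` cell_sets U q" by (simp add: chain_group_def cells_of_dim_eq)
  have "c = to_chain U q (\<lambda>W. Poly_Mapping.lookup c (cell W))"
  proof (rule poly_mapping_eqI)
    fix \<sigma>
    show "Poly_Mapping.lookup c \<sigma> = Poly_Mapping.lookup (to_chain U q (\<lambda>W. Poly_Mapping.lookup c (cell W))) \<sigma>"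
    proof (cases "\<sigma> \<in> cell ` cell_sets U q")
      case True
      thus ?thesis by (auto simp: lookup_to_chain)
    next
      case False
      thus ?thesis using keys by (simp add: lookup_to_chain_other) (metis in_keys_iff subsetD)
    qed
  qed
  thus "c \<in> range (to_chain U q)" by blast
next
  fix c :: "('a, 'k) chain" assume "c \<in> range (to_chain U q)"
  hence "keys c \<subseteq> cell ` cell_sets U q"
    using lookup_to_chain_other by (fastforce simp: in_keys_iff)
  thus "c \<in> carrier (chain_group n A U (int q))" by (simp add: chain_group_def cells_of_dim_eq)
qed

lemma cell_boundary_zero: "cell_boundary n pos 0 \<sigma> = 0"
  by (cases \<sigma>) (auto intro!: sum.neutral)

lemma boundary_to_chain:
  "boundary n pos (to_chain U q f) = (\<Sum>W\<in>cell_sets U q. cell_boundary n pos (f W) (cell W))"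
proof -
  let ?c = "to_chain U q f"
  have inj: "inj_on cell (cell_sets U q)" by (auto simp: inj_on_def cell_eq_iff cell_sets_full)
  have sub: "keys ?c \<subseteq> cell ` cell_sets U q"
    using lookup_to_chain_other by (fastforce simp: in_keys_iff)
  have "boundary n pos ?c = (\<Sum>\<sigma>\<in>cell ` cell_sets U q. cell_boundary n pos (Poly_Mapping.lookup ?c \<sigma>) \<sigma>)"
    unfolding boundary_def
    by (rule sum.mono_neutral_left) (use sub finite_cell_sets in \<open>auto simp: in_keys_iff cell_boundary_zero\<close>)
  also have "\<dots> = (\<Sum>W\<in>cell_sets U q. cell_boundary n pos (f W) (cell W))"
    by (simp add: sum.reindex[OF inj] lookup_to_chain)
  finally show ?thesis .
qed

lemma boundary_to_chain_0:
  "boundary n pos (to_chain U 0 f) = Poly_Mapping.single None (\<Sum>W\<in>cell_sets U 0. f W)"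
proof -
  have "boundary n pos (to_chain U 0 f) = (\<Sum>W\<in>cell_sets U 0. Poly_Mapping.single None (f W))"
    unfolding boundary_to_chain
    by (rule sum.cong[OF refl]) (simp add: cell_def cell_dim_part cell_sets_full cell_sets_card)
  thus ?thesis by (intro poly_mapping_eqI) (simp add: lookup_sum lookup_single when_def)
qed

lemma boundary_to_chain_Suc:
  "boundary n pos (to_chain U (Suc q) f) =
    to_chain U q (\<lambda>\<sigma>. \<Sum>\<tau>\<in>cell_sets U (Suc q). inc (Suc q) \<sigma> \<tau> * (f \<tau> :: 'k::field))"
proof (rule poly_mapping_eqI)
  fix \<sigma>
  let ?b = "\<lambda>\<tau>. \<Sum>v\<in>{v \<in> \<tau>. full (\<tau> - {v})}. Poly_Mapping.single (cell (\<tau> - {v})) (orient \<tau> v * f \<tau>)"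
  have "boundary n pos (to_chain U (Suc q) f) = (\<Sum>\<tau>\<in>cell_sets U (Suc q). ?b \<tau>)"
    unfolding boundary_to_chain
    by (rule sum.cong[OF refl]) (simp add: cell_boundary_cell cell_sets_full cell_sets_card)
  hence eq: "Poly_Mapping.lookup (boundary n pos (to_chain U (Suc q) f)) \<sigma> =
      (\<Sum>\<tau>\<in>cell_sets U (Suc q). \<Sum>v\<in>{v \<in> \<tau>. full (\<tau> - {v})}.
        (orient \<tau> v * f \<tau> when cell (\<tau> - {v}) = \<sigma>))"
    by (simp add: lookup_sum lookup_single)
  show "Poly_Mapping.lookup (boundary n pos (to_chain U (Suc q) f)) \<sigma> = Poly_Mapping.lookup
      (to_chain U q (\<lambda>\<sigma>. \<Sum>\<tau>\<in>cell_sets U (Suc q). inc (Suc q) \<sigma> \<tau> * f \<tau>)) \<sigma>"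
  proof (cases "\<sigma> \<in> cell ` cell_sets U q")
    case True
    then obtain W where W: "W \<in> cell_sets U q" "\<sigma> = cell W" by blast
    note fullW = cell_sets_full[OF W(1)]
    have "(\<Sum>v\<in>{v \<in> \<tau>. full (\<tau> - {v})}. (orient \<tau> v * f \<tau> when cell (\<tau> - {v}) = \<sigma>)) =
        inc (Suc q) W \<tau> * f \<tau>" if \<tau>: "\<tau> \<in> cell_sets U (Suc q)" for \<tau>
    proof -
      have "(\<Sum>v\<in>{v \<in> \<tau>. full (\<tau> - {v})}. (orient \<tau> v * f \<tau> when cell (\<tau> - {v}) = \<sigma>)) =
          (\<Sum>v\<in>{v \<in> \<tau>. full (\<tau> - {v})}. (if W = \<tau> - {v} then orient \<tau> v else 0) * f \<tau>)"
        by (rule sum.cong[OF refl]) (use fullW in \<open>auto simp: W(2) cell_eq_iff when_def\<close>)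
      also have "\<dots> = (\<Sum>v\<in>\<tau>. (if W = \<tau> - {v} then orient \<tau> v else 0) * f \<tau>)"
        by (rule sum.mono_neutral_left) (use fullW cell_sets_finite[OF \<tau>] in auto)
      finally show ?thesis by (simp add: inc_def sum_distrib_right)
    qed
    thus ?thesis using eq unfolding W(2) lookup_to_chain[OF W(1)] by simp
  next
    case False
    have "cell (\<tau> - {v}) \<noteq> \<sigma>" if "\<tau> \<in> cell_sets U (Suc q)" "v \<in> \<tau>" "full (\<tau> - {v})" for \<tau> v
    proof -
      have "\<tau> - {v} \<in> cell_sets U q"
        by (rule cell_sets_subset[OF that(1) _ that(3)])
          (use that cell_sets_card[OF that(1)] cell_sets_finite[OF that(1)] in auto)
      thus ?thesis using False by blast
    qed
    thus ?thesis unfolding eq lookup_to_chain_other[OF False] by (auto intro!: sum.neutral)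
  qed
qed

text \<open>The \<open>case_nat\<close> expression lists the cells one dimension below q, starting
  with the empty cell, in the indexing of \<open>X\<close> but for U in place of T.\<close>

lemma cycles_subset_boundaries_iff:
  "(cycles n A pos U (int q) :: ('a, 'k::field) chain set) \<subseteq> boundaries n A pos U (int q) \<longleftrightarrow>
    (\<forall>f :: 'a set \<Rightarrow> 'k.
      (\<forall>\<sigma>\<in>case_nat {{}} (cell_sets U) q. (\<Sum>\<tau>\<in>cell_sets U q. inc q \<sigma> \<tau> * f \<tau>) = 0) \<longrightarrow>
      (\<exists>h. \<forall>\<tau>\<in>cell_sets U q. f \<tau> = (\<Sum>\<upsilon>\<in>cell_sets U (Suc q). inc (Suc q) \<tau> \<upsilon> * h \<upsilon>)))"
proof -
  have zero: "boundary n pos (to_chain U q f) = 0 \<longleftrightarrow>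
      (\<forall>\<sigma>\<in>case_nat {{}} (cell_sets U) q. (\<Sum>\<tau>\<in>cell_sets U q. inc q \<sigma> \<tau> * f \<tau>) = 0)" for f :: "'a set \<Rightarrow> 'k"
  proof (cases q)
    case 0
    thus ?thesis by (simp add: boundary_to_chain_0) (metis lookup_single_eq lookup_zero single_zero)
  next
    case (Suc p)
    thus ?thesis
      using to_chain_eq_iff[of U p _ "\<lambda>_. 0 :: 'k"] by (simp add: boundary_to_chain_Suc to_chain_zero)
  qed
  have "int q + 1 = int (Suc q)" by simp
  hence bnd: "(boundaries n A pos U (int q) :: ('a, 'k) chain set) =
      boundary n pos ` range (to_chain U (Suc q))"
    unfolding boundaries_def by (simp only: carrier_chain_group)
  have mem: "to_chain U q f \<in> boundaries n A pos U (int q) \<longleftrightarrow>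
      (\<exists>h. \<forall>\<tau>\<in>cell_sets U q. f \<tau> = (\<Sum>\<upsilon>\<in>cell_sets U (Suc q). inc (Suc q) \<tau> \<upsilon> * h \<upsilon>))" for f :: "'a set \<Rightarrow> 'k"
    unfolding bnd image_image by (auto simp: image_iff boundary_to_chain_Suc to_chain_eq_iff)
  have "(cycles n A pos U (int q) :: ('a, 'k) chain set) =
      to_chain U q ` {f. boundary n pos (to_chain U q f) = 0}"
    unfolding cycles_def carrier_chain_group by auto
  thus ?thesis by (simp add: image_subset_iff mem zero)
qed

section \<open>Vanishing of the homology groups\<close>

lemma boundaries_subgroup:
  "(0 :: ('a, 'k::field) chain) \<in> boundaries n A pos U (int q)"
  "b \<in> boundaries n A pos U (int q) \<Longrightarrow> b' \<in> boundaries n A pos U (int q) \<Longrightarrow>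
    b + (b' :: ('a, 'k) chain) \<in> boundaries n A pos U (int q)"
  "b \<in> boundaries n A pos U (int q) \<Longrightarrow> - b \<in> boundaries n A pos U (int q)"
proof -
  have "int q + 1 = int (Suc q)" by simp
  hence bnd: "(boundaries n A pos U (int q) :: ('a, 'k) chain set) =
      range (\<lambda>h. to_chain U q (\<lambda>\<sigma>. \<Sum>\<tau>\<in>cell_sets U (Suc q). inc (Suc q) \<sigma> \<tau> * h \<tau>))"
    unfolding boundaries_def by (simp only: carrier_chain_group image_image boundary_to_chain_Suc)
  show "(0 :: ('a, 'k) chain) \<in> boundaries n A pos U (int q)"
    unfolding bnd by (rule range_eqI[of _ _ "\<lambda>_. 0"]) (simp add: to_chain_zero)
  show "b \<in> boundaries n A pos U (int q) \<Longrightarrow> b' \<in> boundaries n A pos U (int q) \<Longrightarrow>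
    b + (b' :: ('a, 'k) chain) \<in> boundaries n A pos U (int q)"
    unfolding bnd
  proof (elim rangeE)
    fix f g
    assume "b = to_chain U q (\<lambda>\<sigma>. \<Sum>\<tau>\<in>cell_sets U (Suc q). inc (Suc q) \<sigma> \<tau> * f \<tau>)"
      "b' = to_chain U q (\<lambda>\<sigma>. \<Sum>\<tau>\<in>cell_sets U (Suc q). inc (Suc q) \<sigma> \<tau> * g \<tau>)"
    thus "b + b' \<in> range (\<lambda>h. to_chain U q (\<lambda>\<sigma>. \<Sum>\<tau>\<in>cell_sets U (Suc q). inc (Suc q) \<sigma> \<tau> * h \<tau>))"
      by (intro range_eqI[of _ _ "\<lambda>\<tau>. f \<tau> + g \<tau>"]) (simp add: to_chain_add sum.distrib distrib_left)
  qed
  show "b \<in> boundaries n A pos U (int q) \<Longrightarrow> - b \<in> boundaries n A pos U (int q)"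
    unfolding bnd
  proof (elim rangeE)
    fix f
    assume "b = to_chain U q (\<lambda>\<sigma>. \<Sum>\<tau>\<in>cell_sets U (Suc q). inc (Suc q) \<sigma> \<tau> * f \<tau>)"
    thus "- b \<in> range (\<lambda>h. to_chain U q (\<lambda>\<sigma>. \<Sum>\<tau>\<in>cell_sets U (Suc q). inc (Suc q) \<sigma> \<tau> * h \<tau>))"
      by (intro range_eqI[of _ _ "\<lambda>\<tau>. - f \<tau>"]) (simp add: to_chain_uminus sum_negf)
  qed
qed

lemma trivial_homology_iff:
  "trivial_group (cell_homology n A pos U (int q) :: ('a, 'k::field) chain set monoid) \<longleftrightarrow>
    (cycles n A pos U (int q) :: ('a, 'k) chain set) \<subseteq> boundaries n A pos U (int q)"
proof -
  let ?Z = "cycles n A pos U (int q) :: ('a, 'k) chain set"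
  let ?B = "boundaries n A pos U (int q) :: ('a, 'k) chain set"
  let ?H = "cell_homology n A pos U (int q) :: ('a, 'k) chain set monoid"
  note B = boundaries_subgroup[where U = U and q = q and 'k = 'k]
  have coset: "?B #>\<^bsub>chain_group n A U (int q)\<^esub> c = (\<lambda>b. b + c) ` ?B" for c
    by (auto simp: r_coset_def chain_group_def)
  have car: "carrier ?H = (\<lambda>c. (\<lambda>b. b + c) ` ?B) ` ?Z"
    by (simp add: cell_homology_def carrier_FactGroup coset)
  have one: "\<one>\<^bsub>?H\<^esub> = ?B" by (simp add: cell_homology_def)
  have mult: "K \<otimes>\<^bsub>?H\<^esub> L = {k + l |k l. k \<in> K \<and> l \<in> L}" for K L
    by (auto simp: cell_homology_def set_mult_def chain_group_def)
  have "0 = to_chain U q (\<lambda>_. 0 :: 'k)" by (simp add: to_chain_zero)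
  hence "0 \<in> ?Z" by (simp add: cycles_def carrier_chain_group boundary_def)
  have shift: "(\<lambda>b. b + c) ` ?B = ?B" if "c \<in> ?B" for c
  proof (intro equalityI subsetI)
    fix b assume "b \<in> ?B"
    hence "b + - c \<in> ?B" using B(2,3) that by blast
    thus "b \<in> (\<lambda>b. b + c) ` ?B" by (rule rev_image_eqI) simp
  qed (use B(2) that in auto)
  show ?thesis
  proof
    assume "trivial_group ?H"
    hence sing: "(\<lambda>c. (\<lambda>b. b + c) ` ?B) ` ?Z = {?B}"
      unfolding trivial_group_def car one by (rule conjunct2)
    have eq: "(\<lambda>b. b + c) ` ?B = ?B" if "c \<in> ?Z" for c
      using imageI[OF that, of "\<lambda>c. (\<lambda>b. b + c) ` ?B"] unfolding sing by (rule singletonD)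
    show "?Z \<subseteq> ?B"
    proof
      fix c assume "c \<in> ?Z"
      have "0 + c \<in> (\<lambda>b. b + c) ` ?B" using B(1) by (rule imageI)
      thus "c \<in> ?B" unfolding eq[OF \<open>c \<in> ?Z\<close>] by simp
    qed
  next
    assume sub: "?Z \<subseteq> ?B"
    have "(\<lambda>c. (\<lambda>b. b + c) ` ?B) ` ?Z = (\<lambda>c. ?B) ` ?Z"
      by (rule image_cong[OF refl], rule shift, rule subsetD[OF sub])
    also have "\<dots> = {?B}" using \<open>0 \<in> ?Z\<close> by (rule image_constant)
    finally have car': "carrier ?H = {?B}" unfolding car .
    have BB: "?B \<otimes>\<^bsub>?H\<^esub> ?B = ?B"
      unfolding mult
    proof (intro equalityI subsetI)
      fix b assume "b \<in> ?B"
      thus "b \<in> {k + l |k l. k \<in> ?B \<and> l \<in> ?B}"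
        using B(1) by (intro CollectI exI[of _ 0] exI[of _ b]) simp
    qed (use B(2) in blast)
    \<comment> \<open>Being a group is part of \<open>trivial_group\<close>; on a one-element
      carrier the group laws reduce to B + B = B.\<close>
    have "Group.group ?H"
      by (rule groupI) (simp_all only: car' one BB singleton_iff, simp_all add: BB)
    thus "trivial_group ?H" by (simp add: trivial_group_def car' one)
  qed
qed

end

section \<open>Linear resolutions of rainbow ideals\<close>

context rainbow
begin

section \<open>Generators of the rainbow ideal\<close>

lemma vertex_monomial:
  assumes "t \<in> T"
  shows "(\<Prod>i<n. mvar (t i)) = (monom (label (t ` {..<n})) 1 :: ('a, 'k::field) mpoly)"
proof -
  have "inj_on t {..<n}"
    using T_subset assms ix_eq by (intro inj_on_inverseI[of _ ix]) (fastforce simp: PiE_iff)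
  hence "label (t ` {..<n}) = (\<Sum>i<n. Poly_Mapping.single (t i) 1)"
    by (simp add: label_def sum.reindex)
  moreover have "(\<Prod>i\<in>I. mvar (t i)) = (monom (\<Sum>i\<in>I. Poly_Mapping.single (t i) 1) 1 :: ('a, 'k) mpoly)"
    if "finite I" for I
    using that by (induction I rule: finite_induct) (simp_all add: mvar_def mult_single)
  ultimately show ?thesis by simp
qed

text \<open>A set of n vertices that meets all n parts has one vertex in each, so a 0-cell is the
  image of its only transversal.\<close>

lemma cell_sets_0: "cell_sets T 0 = (\<lambda>t. t ` {..<n}) ` T"
proof (intro equalityI subsetI)
  fix W assume W: "W \<in> cell_sets T 0"
  obtain t where t: "t \<in> PiE {..<n} (part W)" by (rule full_transversal[OF cell_sets_full[OF W]])
  have "inj_on t {..<n}"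
    using transversal_ix[OF t] by (intro inj_on_inverseI[of _ ix]) auto
  hence "card (t ` {..<n}) = card W" using cell_sets_card[OF W] by (simp add: card_image)
  moreover have "t ` {..<n} \<subseteq> W" using transversal_ix[OF t] by auto
  ultimately have "t ` {..<n} = W" using cell_sets_finite[OF W] by (intro card_subset_eq)
  moreover have "t \<in> T" using t W by (auto simp: cell_sets_def)
  ultimately show "W \<in> (\<lambda>t. t ` {..<n}) ` T" by blast
next
  fix W assume "W \<in> (\<lambda>t. t ` {..<n}) ` T"
  then obtain t where t: "t \<in> T" "W = t ` {..<n}" by blast
  have tA: "t i \<in> A i" if "i < n" for i using T_subset t(1) that by (auto simp: PiE_iff)
  hence ixt: "ix (t i) = i" if "i < n" for i using that ix_eq by blast
  have WV: "W \<subseteq> verts" using tA t(2) by (auto simp: verts_def)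
  have part: "part W i = {t i}" if "i < n" for i
    using that tA ixt ix_eq by (fastforce simp: part_def t(2))
  have "full W" using full_iff_part[OF WV] part by simp
  moreover have "PiE {..<n} (part W) \<subseteq> T"
  proof
    fix s assume s: "s \<in> PiE {..<n} (part W)"
    have "s = t"
      by (rule extensionalityI[of _ "{..<n}"])
        (use s part T_subset t(1) in \<open>auto simp: PiE_iff\<close>)
    thus "s \<in> T" using t(1) by simp
  qed
  moreover have "card W = n"
    unfolding t(2) using ixt by (subst card_image) (auto intro: inj_on_inverseI[of _ ix])
  ultimately show "W \<in> cell_sets T 0" by (simp add: cell_sets_def)
qed

lemma generators: "(\<lambda>a. \<Prod>i<n. mvar (a i)) ` T = (\<lambda>W. monom (label W) 1 :: ('a, 'k::field) mpoly) ` cell_sets T 0"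
  unfolding cell_sets_0 image_image by (rule image_cong) (simp_all add: vertex_monomial)

end

lemma monom_combinations_ideal:
  fixes m :: "nat \<Rightarrow> ('a, 'k::field) mpoly"
  assumes m: "\<And>j. j < r \<Longrightarrow> m j \<in> polys V"
  shows "Idl\<^bsub>mpoly_ring V\<^esub> (m ` {..<r}) = (\<lambda>v. \<Sum>j<r. m j * v $ j) ` free_module V r"
    (is "_ = ?f ` _")
proof
  interpret R: cring "mpoly_ring V :: ('a, 'k) mpoly ring" by (rule cring_mpoly_ring)
  have gens: "m ` {..<r} \<subseteq> polys V" using m by auto
  have "ideal (?f ` free_module V r) (mpoly_ring V)"
  proof (rule idealI_mpoly_ring)
    show "?f ` free_module V r \<subseteq> polys V"
      using m by (auto simp: free_module_def intro!: polys_sum polys_mult)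
    have "0\<^sub>v r \<in> (free_module V r :: ('a, 'k) mpoly vec set)" by (simp add: free_module_def polys_zero)
    thus "0 \<in> ?f ` free_module V r" by (rule rev_image_eqI) simp
  next
    fix a b :: "('a, 'k) mpoly" assume "a \<in> ?f ` free_module V r" "b \<in> ?f ` free_module V r"
    then obtain v w where vw: "v \<in> free_module V r" "a = ?f v" "w \<in> free_module V r" "b = ?f w" by blast
    have "(v + w) $ j \<in> polys V" if "j < r" for j
      using polys_add[of "v $ j" V "w $ j"] vw(1,3) that by (auto simp: free_module_def)
    hence "v + w \<in> free_module V r" using vw(1,3) by (auto simp: free_module_def)
    moreover have "a + b = ?f (v + w)"
      unfolding vw sum.distrib[symmetric]
      by (rule sum.cong) (use vw(1,3) in \<open>auto simp: free_module_def distrib_left\<close>)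
    ultimately show "a + b \<in> ?f ` free_module V r" by (rule rev_image_eqI)
  next
    fix a x :: "('a, 'k) mpoly" assume "a \<in> ?f ` free_module V r" and x: "x \<in> polys V"
    then obtain v where v: "v \<in> free_module V r" "a = ?f v" by blast
    have "(x \<cdot>\<^sub>v v) $ j \<in> polys V" if "j < r" for j
      using polys_mult[OF x, of "v $ j"] v(1) that by (auto simp: free_module_def)
    hence "x \<cdot>\<^sub>v v \<in> free_module V r" using v(1) by (auto simp: free_module_def)
    moreover have "x * a = ?f (x \<cdot>\<^sub>v v)"
      unfolding v(2) sum_distrib_left
      by (rule sum.cong) (use v(1) in \<open>auto simp: free_module_def mult.left_commute\<close>)
    ultimately show "x * a \<in> ?f ` free_module V r" by (rule rev_image_eqI)
  qed
  moreover have "m ` {..<r} \<subseteq> ?f ` free_module V r"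
  proof
    fix p assume "p \<in> m ` {..<r}"
    then obtain j where j: "j < r" "p = m j" by blast
    have "?f (unit_vec r j) = (\<Sum>i<r. if i = j then m i else 0)"
      by (rule sum.cong) (use j in auto)
    hence "p = ?f (unit_vec r j)" using j by simp
    with unit_vec_free_module show "p \<in> ?f ` free_module V r" by (rule rev_image_eqI)
  qed
  ultimately show "Idl\<^bsub>mpoly_ring V\<^esub> (m ` {..<r}) \<subseteq> ?f ` free_module V r"
    by (rule R.genideal_minimal)
  interpret I: ideal "Idl\<^bsub>mpoly_ring V\<^esub> (m ` {..<r})" "mpoly_ring V" by (rule R.genideal_ideal[OF gens])
  show "?f ` free_module V r \<subseteq> Idl\<^bsub>mpoly_ring V\<^esub> (m ` {..<r})"
  proof
    fix p assume "p \<in> ?f ` free_module V r"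
    then obtain v where v: "v \<in> free_module V r" "p = ?f v" by blast
    have "(\<Sum>j<k. m j * v $ j) \<in> Idl\<^bsub>mpoly_ring V\<^esub> (m ` {..<r})" if "k \<le> r" for k
      using that
    proof (induction k)
      case 0
      thus ?case using I.zero_closed by (simp add: mpoly_ring_simps)
    next
      case (Suc k)
      have "m k \<in> Idl\<^bsub>mpoly_ring V\<^esub> (m ` {..<r})"
        using R.genideal_self[OF gens] Suc.prems by auto
      hence "m k * v $ k \<in> Idl\<^bsub>mpoly_ring V\<^esub> (m ` {..<r})"
        using I.I_r_closed[of "m k" "v $ k"] v(1) Suc.prems by (simp add: free_module_def mpoly_ring_simps)
      thus ?case
        using I.a_closed[OF Suc.IH] Suc.prems by (simp add: mpoly_ring_simps)
    qed
    thus "p \<in> Idl\<^bsub>mpoly_ring V\<^esub> (m ` {..<r})" using v(2) by simp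
  qed
qed

context rainbow
begin

text \<open>A non-empty product lies in another product iff each factor does, and disjointness of
  the \<open>A i\<close> lets the inclusion of the factors be tested on the unions.\<close>

lemma cell_sets_restrict:
  assumes R: "\<And>i. i < n \<Longrightarrow> R i \<subseteq> A i"
  shows "cell_sets (T \<inter> PiE {..<n} R) q = {W \<in> cell_sets T q. W \<subseteq> (\<Union>i<n. R i)}"
proof -
  have *: "PiE {..<n} (part W) \<subseteq> PiE {..<n} R \<longleftrightarrow> W \<subseteq> (\<Union>i<n. R i)" if W: "full W" for W
  proof -
    have WV: "W \<subseteq> verts" using W by (simp add: full_def)
    have "PiE {..<n} (part W) \<noteq> {}" using full_transversal[OF W] by blast
    hence "PiE {..<n} (part W) \<subseteq> PiE {..<n} R \<longleftrightarrow> (\<forall>i<n. part W i \<subseteq> R i)"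
      by (auto simp: subset_PiE)
    also have "\<dots> \<longleftrightarrow> W \<subseteq> (\<Union>i<n. R i)"
    proof
      assume "\<forall>i<n. part W i \<subseteq> R i"
      hence "(\<Union>i<n. part W i) \<subseteq> (\<Union>i<n. R i)" by (intro UN_mono) auto
      thus "W \<subseteq> (\<Union>i<n. R i)" by (simp only: Union_part[OF WV])
    next
      assume sub: "W \<subseteq> (\<Union>i<n. R i)"
      show "\<forall>i<n. part W i \<subseteq> R i"
      proof (intro allI impI subsetI)
        fix i v assume i: "i < n" and v: "v \<in> part W i"
        then obtain j where j: "j < n" "v \<in> R j" using sub by (auto simp: part_def)
        have "v \<in> A i" using i v by (simp add: part_def)
        hence "j = i" using ix_eq[OF i] ix_eq[OF j(1)] R[OF j(1)] j(2) by blast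
        with j show "v \<in> R i" by simp
      qed
    qed
    finally show ?thesis .
  qed
  show ?thesis
  proof (rule Set.set_eqI)
    fix W
    show "W \<in> cell_sets (T \<inter> PiE {..<n} R) q \<longleftrightarrow> W \<in> {W \<in> cell_sets T q. W \<subseteq> (\<Union>i<n. R i)}"
      using *[of W] by (cases "full W") (simp_all add: cell_sets_def conj_ac)
  qed
qed

text \<open>The restriction moves from the complex to the supports of chains on T, the form in which
  \<open>exact_at\<close> expresses divisibility of labels. Faces of cells inside K lie inside K, so
  the boundary equations at all other cells hold automatically.\<close>

lemma homology_restrict_iff:
  assumes R: "\<And>i. i < n \<Longrightarrow> R i \<subseteq> A i"
  defines "K \<equiv> \<Union>i<n. R i"
  shows "trivial_group (cell_homology n A pos (T \<inter> PiE {..<n} R) (int q) :: ('a, 'k::field) chain set monoid) \<longleftrightarrow>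
    (\<forall>f :: 'a set \<Rightarrow> 'k. (\<forall>\<tau>\<in>X (Suc q). f \<tau> \<noteq> 0 \<longrightarrow> \<tau> \<subseteq> K) \<and> (\<forall>\<sigma>\<in>X q. bd q f \<sigma> = 0) \<longrightarrow>
      (\<exists>h. (\<forall>\<upsilon>\<in>X (Suc (Suc q)). h \<upsilon> \<noteq> 0 \<longrightarrow> \<upsilon> \<subseteq> K) \<and> (\<forall>\<tau>\<in>X (Suc q). f \<tau> = bd (Suc q) h \<tau>)))"
    (is "?L \<longleftrightarrow> (\<forall>f. ?supp f \<and> ?cyc f \<longrightarrow> ?bnd f)")
proof -
  let ?U = "T \<inter> PiE {..<n} R"
  have U: "cell_sets ?U p = {W \<in> cell_sets T p. W \<subseteq> K}" for p
    unfolding K_def by (rule cell_sets_restrict[OF R])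
  let ?cyc' = "\<lambda>f :: 'a set \<Rightarrow> 'k.
    \<forall>\<sigma>\<in>case_nat {{}} (cell_sets ?U) q. (\<Sum>\<tau>\<in>cell_sets ?U q. inc q \<sigma> \<tau> * f \<tau>) = 0"
  let ?bnd' = "\<lambda>f :: 'a set \<Rightarrow> 'k.
    \<exists>h. \<forall>\<tau>\<in>cell_sets ?U q. f \<tau> = (\<Sum>\<upsilon>\<in>cell_sets ?U (Suc q). inc (Suc q) \<tau> \<upsilon> * h \<upsilon>)"
  have bd_eq: "bd p f \<sigma> = (\<Sum>\<tau>\<in>cell_sets ?U p. inc p \<sigma> \<tau> * f \<tau>)"
    if "\<forall>\<tau>\<in>cell_sets T p. f \<tau> \<noteq> 0 \<longrightarrow> \<tau> \<subseteq> K" for p \<sigma> and f :: "'a set \<Rightarrow> 'k"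
    unfolding incidence_boundary_def X_simps
    by (rule sum.mono_neutral_right) (use that in \<open>auto simp: U finite_cell_sets\<close>)
  have bd_0: "bd (Suc p) f \<sigma> = 0"
    if f: "\<forall>\<tau>\<in>cell_sets T (Suc p). f \<tau> \<noteq> 0 \<longrightarrow> \<tau> \<subseteq> K" and "\<not> \<sigma> \<subseteq> K"
    for p \<sigma> and f :: "'a set \<Rightarrow> 'k"
    unfolding incidence_boundary_def X_simps
  proof (rule sum.neutral, intro ballI)
    fix \<tau> assume \<tau>: "\<tau> \<in> cell_sets T (Suc p)"
    show "inc (Suc p) \<sigma> \<tau> * f \<tau> = 0"
    proof (rule ccontr)
      assume "\<not> ?thesis"
      hence "inc (Suc p) \<sigma> \<tau> \<noteq> (0 :: 'k)" "f \<tau> \<noteq> 0" by auto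
      with f \<tau> that(2) show False by (auto elim!: inc_nonzero)
    qed
  qed
  have cyc: "?cyc f \<longleftrightarrow> ?cyc' f" if "?supp f" for f :: "'a set \<Rightarrow> 'k"
  proof (cases q)
    case 0
    thus ?thesis using bd_eq[of 0 f] that by simp
  next
    case (Suc p)
    have "bd q f \<sigma> = 0" if "\<sigma> \<in> cell_sets T p" "\<sigma> \<notin> cell_sets ?U p" for \<sigma>
      using bd_0[of p f \<sigma>] \<open>?supp f\<close> that Suc by (simp add: U)
    moreover have "cell_sets ?U p \<subseteq> cell_sets T p" by (auto simp: U)
    ultimately show ?thesis using bd_eq[of q f] that Suc by auto
  qed
  have bnd: "?bnd f \<longleftrightarrow> ?bnd' f" if supp: "?supp f" for f :: "'a set \<Rightarrow> 'k"
  proof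
    assume "?bnd f"
    then obtain h where h: "\<forall>\<upsilon>\<in>cell_sets T (Suc q). h \<upsilon> \<noteq> 0 \<longrightarrow> \<upsilon> \<subseteq> K"
      "\<forall>\<tau>\<in>cell_sets T q. f \<tau> = bd (Suc q) h \<tau>" by auto
    thus "?bnd' f" using bd_eq[OF h(1)] by (intro exI[of _ h]) (simp add: U)
  next
    assume "?bnd' f"
    then obtain h where h: "\<forall>\<tau>\<in>cell_sets ?U q. f \<tau> = (\<Sum>\<upsilon>\<in>cell_sets ?U (Suc q). inc (Suc q) \<tau> \<upsilon> * h \<upsilon>)"
      by blast
    \<comment> \<open>A filling over the restricted complex says nothing about cells outside K; they
      get the coefficient 0.\<close>
    define h' where "h' \<upsilon> = (if \<upsilon> \<subseteq> K then h \<upsilon> else 0)" for \<upsilon>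
    have h': "\<forall>\<upsilon>\<in>cell_sets T (Suc q). h' \<upsilon> \<noteq> 0 \<longrightarrow> \<upsilon> \<subseteq> K" by (simp add: h'_def)
    have "f \<tau> = bd (Suc q) h' \<tau>" if \<tau>: "\<tau> \<in> cell_sets T q" for \<tau>
    proof (cases "\<tau> \<subseteq> K")
      case True
      hence "f \<tau> = (\<Sum>\<upsilon>\<in>cell_sets ?U (Suc q). inc (Suc q) \<tau> \<upsilon> * h \<upsilon>)" using h \<tau> by (simp add: U)
      also have "\<dots> = bd (Suc q) h' \<tau>"
        unfolding bd_eq[OF h'] by (rule sum.cong) (auto simp: U h'_def)
      finally show ?thesis .
    next
      case False
      thus ?thesis using supp \<tau> bd_0[OF h' False] by auto
    qed
    thus "?bnd f" using h' by (intro exI[of _ h']) auto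
  qed
  have "?L \<longleftrightarrow> (\<forall>f. ?cyc' f \<longrightarrow> ?bnd' f)"
    unfolding trivial_homology_iff cycles_subset_boundaries_iff ..
  also have "\<dots> \<longleftrightarrow> (\<forall>f. ?supp f \<and> ?cyc f \<longrightarrow> ?bnd f)"
  proof (intro iffI allI impI)
    fix f :: "'a set \<Rightarrow> 'k" assume "\<forall>f. ?cyc' f \<longrightarrow> ?bnd' f" "?supp f \<and> ?cyc f"
    thus "?bnd f" using cyc[of f] bnd[of f] by blast
  next
    fix f :: "'a set \<Rightarrow> 'k" assume all: "\<forall>f. ?supp f \<and> ?cyc f \<longrightarrow> ?bnd f" and f: "?cyc' f"
    define f' where "f' \<tau> = (if \<tau> \<subseteq> K then f \<tau> else 0)" for \<tau>
    have supp: "?supp f'" by (simp add: f'_def)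
    have f': "f' \<tau> = f \<tau>" if "\<tau> \<in> cell_sets ?U q" for \<tau> using that by (simp add: U f'_def)
    hence "?cyc' f'" using f by simp
    hence "?bnd' f'" using all cyc[OF supp] bnd[OF supp] supp by blast
    thus "?bnd' f" using f' by simp
  qed
  finally show ?thesis .
qed

theorem linear_resolution_iff:
  "has_linear_resolution verts n (rainbow_ideal n A T :: ('a, 'k::field) mpoly set) \<longleftrightarrow>
    (\<forall>R. (\<forall>i<n. R i \<subseteq> A i \<and> R i \<noteq> {}) \<longrightarrow>
      (\<forall>p\<ge>0. trivial_group
        (cell_homology n A pos (T \<inter> PiE {..<n} R) p :: ('a, 'k) chain set monoid)))"
proof -
  interpret L: linear_labelled_complex X label "inc :: nat \<Rightarrow> 'a set \<Rightarrow> 'a set \<Rightarrow> 'k" verts n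
    by (rule linear_labelled_complex)
  let ?m = "\<lambda>j. monom (label (L.enum 1 j)) 1 :: ('a, 'k) mpoly"
  have rank0: "L.rank 0 = 1" by (simp add: L.rank_def)
  have enum0: "L.enum 0 0 = {}" using L.enum_mem[of 0 0] by (simp add: rank0)
  have "rainbow_ideal n A T = Idl\<^bsub>mpoly_ring verts\<^esub> (?m ` {..<L.rank 1})"
  proof -
    have "L.enum 1 ` {..<L.rank 1} = cell_sets T 0"
      using bij_betw_imp_surj_on[OF L.bij_enum[of 1]] by simp
    moreover have "?m ` {..<L.rank 1} = (\<lambda>W. monom (label W) 1) ` L.enum 1 ` {..<L.rank 1}"
      by (simp only: image_image)
    ultimately have "?m ` {..<L.rank 1} = (\<lambda>W. monom (label W) 1) ` cell_sets T 0"
      by (simp only:)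
    thus ?thesis by (simp add: rainbow_ideal_def generators verts_def)
  qed
  also have "\<dots> = (\<lambda>v. \<Sum>j<L.rank 1. ?m j * v $ j) ` free_module verts (L.rank 1)"
  proof (rule monom_combinations_ideal)
    fix j assume "j < L.rank 1"
    from L.lab_V[OF L.enum_mem[OF this]] show "?m j \<in> polys verts"
      by (auto simp: mem_polys lookup_single when_def split: if_splits)
  qed
  also have "\<dots> = augmentation_image verts L.rank L.dmat"
    unfolding augmentation_image_def
  proof (rule image_cong[OF refl])
    fix v :: "('a, 'k) mpoly vec" assume "v \<in> free_module verts (L.rank 1)"
    hence "dim_vec v = L.rank 1" by (simp add: free_module_def)
    thus "(\<Sum>j<L.rank 1. ?m j * v $ j) = (L.dmat 0 *\<^sub>v v) $ 0"
      by (simp add: L.dmat_def rank0 enum0 scalar_prod_def atLeast0LessThan label_def)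
  qed
  finally have "has_linear_resolution verts n (rainbow_ideal n A T :: ('a, 'k) mpoly set) \<longleftrightarrow>
      exact_complex verts L.rank L.dmat"
    using has_linear_resolution_iff_exact[OF L.linear_strand] by simp
  also have "\<dots> \<longleftrightarrow> (\<forall>q m. keys m \<subseteq> verts \<longrightarrow> L.exact_at q m)"
    by (rule L.exact_complex_iff)
  also have "\<dots> \<longleftrightarrow> (\<forall>R. (\<forall>i<n. R i \<subseteq> A i \<and> R i \<noteq> {}) \<longrightarrow>
      (\<forall>q. trivial_group
        (cell_homology n A pos (T \<inter> PiE {..<n} R) (int q) :: ('a, 'k) chain set monoid)))"
  proof -
    have dvd: "mon_dvd (label \<tau>) m \<longleftrightarrow> \<tau> \<subseteq> keys m" if "\<tau> \<in> X (Suc q)" for \<tau> q and m :: "'a \<Rightarrow>\<^sub>0 nat"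
      using that by (simp add: mon_dvd_label_iff cell_sets_finite)
    have exact: "L.exact_at q m \<longleftrightarrow> trivial_group
        (cell_homology n A pos (T \<inter> PiE {..<n} R) (int q) :: ('a, 'k) chain set monoid)"
      if "\<And>i. i < n \<Longrightarrow> R i \<subseteq> A i" "(\<Union>i<n. R i) = keys m" for R q m
    proof -
      have "trivial_group
          (cell_homology n A pos (T \<inter> PiE {..<n} R) (int q) :: ('a, 'k) chain set monoid) \<longleftrightarrow>
        (\<forall>f :: 'a set \<Rightarrow> 'k. (\<forall>\<tau>\<in>X (Suc q). f \<tau> \<noteq> 0 \<longrightarrow> \<tau> \<subseteq> (\<Union>i<n. R i)) \<and> (\<forall>\<sigma>\<in>X q. bd q f \<sigma> = 0) \<longrightarrow>
          (\<exists>h. (\<forall>\<upsilon>\<in>X (Suc (Suc q)). h \<upsilon> \<noteq> 0 \<longrightarrow> \<upsilon> \<subseteq> (\<Union>i<n. R i)) \<and>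
            (\<forall>\<tau>\<in>X (Suc q). f \<tau> = bd (Suc q) h \<tau>)))"
        by (rule homology_restrict_iff) (rule that(1))
      thus ?thesis
        unfolding that(2) L.exact_at_def by (simp only: dvd cong: ball_cong)
    qed
    show ?thesis
    proof (intro iffI allI impI)
      fix R q assume all: "\<forall>q m. keys m \<subseteq> verts \<longrightarrow> L.exact_at q m"
        and R: "\<forall>i<n. R i \<subseteq> A i \<and> R i \<noteq> {}"
      \<comment> \<open>The squarefree monomial on K stands for the family R:
        \<open>exact_at\<close> depends on a multidegree only through its support.\<close>
      let ?K = "\<Union>i<n. R i"
      have sub: "?K \<subseteq> verts" using R by (fastforce simp: verts_def)
      have keys: "keys (label ?K) = ?K" by (rule keys_label[OF finite_subset[OF sub finite_verts]])
      have "L.exact_at q (label ?K) \<longleftrightarrow> trivial_group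
          (cell_homology n A pos (T \<inter> PiE {..<n} R) (int q) :: ('a, 'k) chain set monoid)"
        by (rule exact) (use R keys in simp_all)
      moreover have "L.exact_at q (label ?K)" using all sub by (simp only: keys)
      ultimately show "trivial_group
          (cell_homology n A pos (T \<inter> PiE {..<n} R) (int q) :: ('a, 'k) chain set monoid)" by simp
    next
      fix q and m :: "'a \<Rightarrow>\<^sub>0 nat"
      assume all: "\<forall>R. (\<forall>i<n. R i \<subseteq> A i \<and> R i \<noteq> {}) \<longrightarrow> (\<forall>q. trivial_group
          (cell_homology n A pos (T \<inter> PiE {..<n} R) (int q) :: ('a, 'k) chain set monoid))"
        and m: "keys m \<subseteq> verts"
      show "L.exact_at q m"
      proof (cases "full (keys m)")
        case True
        hence ne: "\<forall>i<n. part (keys m) i \<noteq> {}" using full_iff_part[OF m] by simp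
        have sub: "part (keys m) i \<subseteq> A i" if "i < n" for i using that by (simp add: part_def)
        have "L.exact_at q m \<longleftrightarrow> trivial_group (cell_homology n A pos
            (T \<inter> PiE {..<n} (part (keys m))) (int q) :: ('a, 'k) chain set monoid)"
          by (rule exact[OF sub Union_part[OF m]])
        thus ?thesis using all ne sub by simp
      next
        case False
        \<comment> \<open>A support that misses some \<open>A i\<close> contains no cell, so every
          admissible f vanishes and there is nothing to fill.\<close>
        have "\<not> \<tau> \<subseteq> keys m" if "\<tau> \<in> X (Suc q)" for \<tau>
          using that False full_mono[OF _ _ m] cell_sets_full by auto
        thus ?thesis
          unfolding L.exact_at_def
          by (intro allI impI exI[of _ "\<lambda>_. 0"]) (auto simp: dvd incidence_boundary_def simp del: X_simps)
      qed
    qed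
  qed
  also have "\<dots> \<longleftrightarrow> (\<forall>R. (\<forall>i<n. R i \<subseteq> A i \<and> R i \<noteq> {}) \<longrightarrow>
      (\<forall>p\<ge>0. trivial_group
        (cell_homology n A pos (T \<inter> PiE {..<n} R) p :: ('a, 'k) chain set monoid)))"
    by (metis nonneg_int_cases of_nat_0_le_iff)
  finally show ?thesis .
qed

end

theorem corollary5p8:
  fixes A :: "nat \<Rightarrow> 'a set" and n :: nat and T :: "(nat \<Rightarrow> 'a) set" and pos :: "'a \<Rightarrow> nat"
  assumes "\<And>i. i < n \<Longrightarrow> finite (A i)"
    and "\<And>i. i < n \<Longrightarrow> A i \<noteq> {}"
    and "disjoint_family_on A {..<n}"
    and "T \<subseteq> PiE {..<n} A"
    and "inj_on pos (\<Union>i<n. A i)"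
  shows "has_linear_resolution (\<Union>i<n. A i) n (rainbow_ideal n A T :: ('a, 'k::field) mpoly set)
     \<longleftrightarrow> (\<forall>R. (\<forall>i<n. R i \<subseteq> A i \<and> R i \<noteq> {}) \<longrightarrow>
            (\<forall>p\<ge>0. trivial_group
               (cell_homology n A pos (T \<inter> PiE {..<n} R) p :: ('a, 'k) chain set monoid)))"
proof -
  interpret rainbow n A T pos
    by unfold_locales (use assms in auto)
  show ?thesis using linear_resolution_iff[where 'k = 'k] unfolding verts_def .
qed

end
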